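(* Let $p>2$ be a prime and let $(a,b,c)$ be a solution in the first case of Fermat's equation, i.e. nonzero pairwise relatively prime integers with $a^p+b^p+c^p=0$ and $p\nmid abc$. If for an odd character $\chi\neq\omega$ of $g$ one has $M_{\chi^*}\big(\frac{-b}{a}\big)\not\equiv 0\pmod p$, where $\chi^*=\omega\chi^{-1}$, then the $\chi$-component $C\ell_\chi=C\ell^{e_\chi}$ of the $p$-class group of $K$ is nontrivial.
   Context: $\zeta$ is a primitive $p$-th root of unity, $K=\mathbb{Q}(\zeta)$, $C\ell$ is the $p$-class group (the $p$-Sylow subgroup of the ideal class group) of $K$. $g=\mathrm{Gal}(K/\mathbb{Q})=\{s_k:1\le k\le p-1\}$ with $s_k(\zeta)=\zeta^k$. $\omega$ is the Teichmüller character: $\omega(k)=\omega(s_k)\in\mathbb{Z}_p^\times$ is the $(p-1)$-th root of unity congruent to $k$ modulo $p$. The $p$-adic characters of $g$ are the $\omega^m$, $1\le m\le p-1$; $\chi$ is odd if $\chi(-1)=-1$. $e_\chi=\frac{1}{p-1}\sum_{k=1}^{p-1}\chi^{-1}(k)s_k\in\mathbb{Z}_p[g]$. For a character $\varphi$ of $g$, $M_\varphi(Z)=\sum_{k=1}^{p-1}\varphi^{-1}(k)Z^k\in\mathbb{Z}_p[Z]$ (modified Mirimanoff polynomial); the congruence is in $\mathbb{Z}_p$. *)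

theory Defs
  imports
    Complex_Main
    "HOL-Computational_Algebra.Computational_Algebra"
    "HOL-Algebra.Algebra"
    "HOL-Algebra.Algebraic_Closure_Type"
begin

section \<open>The \<open>p\<close>-adic integers\<close>

text \<open>
  The ring of \<open>p\<close>-adic integers is the inverse limit of the rings of integers modulo \<open>p ^ n\<close>,
  each residue class being represented by its least nonnegative element.
\<close>

definition padic_ints :: "nat \<Rightarrow> (nat \<Rightarrow> int) ring" where
  "padic_ints p =
     \<lparr> carrier = {x. \<forall>n. x n \<in> {0..<int p ^ n} \<and> x (Suc n) mod int p ^ n = x n},
       monoid.mult = (\<lambda>x y n. (x n * y n) mod int p ^ n),
       one = (\<lambda>n. 1 mod int p ^ n),
       ring.zero = (\<lambda>n. 0),
       add = (\<lambda>x y n. (x n + y n) mod int p ^ n) \<rparr>"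

lemma padic_ints_cring:
  assumes "p > 0"
  shows "cring (padic_ints p)"
proof -
  have pos: "int p ^ n > 0" for n using assms by simp
  have step: "(z mod int p ^ Suc n) mod int p ^ n = z mod int p ^ n" for z n
    by (rule mod_mod_cancel) (simp add: le_imp_power_dvd)
  have rep: "x n mod int p ^ n = x n" if "x \<in> carrier (padic_ints p)" for x n
    using that by (auto simp: padic_ints_def)
  have coh: "x (Suc n) mod int p ^ n = x n" if "x \<in> carrier (padic_ints p)" for x n
    using that by (auto simp: padic_ints_def)
  have carrI: "x \<in> carrier (padic_ints p)"
    if "\<And>n. x n mod int p ^ n = x n" "\<And>n. x (Suc n) mod int p ^ n = x n" for x
  proof -
    have "x n \<in> {0..<int p ^ n}" for n
      using that(1)[of n] pos[of n] by (metis atLeastLessThan_iff pos_mod_bound pos_mod_sign)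
    then show ?thesis using that(2) by (simp add: padic_ints_def)
  qed
  have cong_eq: "(\<lambda>n. f n mod int p ^ n) \<in> carrier (padic_ints p)"
    if "\<And>n. f (Suc n) mod int p ^ n = f n mod int p ^ n" for f
    by (rule carrI) (use that step in auto)
  show ?thesis
  proof (intro cringI abelian_groupI comm_monoidI)
    fix x y
    assume x: "x \<in> carrier (padic_ints p)" and y: "y \<in> carrier (padic_ints p)"
    show "x \<oplus>\<^bsub>padic_ints p\<^esub> y \<in> carrier (padic_ints p)"
      using cong_eq[of "\<lambda>n. x n + y n"] coh[OF x] coh[OF y]
      by (simp add: padic_ints_def) (metis mod_add_eq)
    show "x \<otimes>\<^bsub>padic_ints p\<^esub> y \<in> carrier (padic_ints p)"
      using cong_eq[of "\<lambda>n. x n * y n"] coh[OF x] coh[OF y]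
      by (simp add: padic_ints_def) (metis mod_mult_eq)
  next
    fix x
    assume x: "x \<in> carrier (padic_ints p)"
    have "(\<lambda>n. (- x n) mod int p ^ n) \<in> carrier (padic_ints p)"
      using coh[OF x] by (intro cong_eq) (metis mod_minus_eq)
    moreover have "(\<lambda>n. (- x n) mod int p ^ n) \<oplus>\<^bsub>padic_ints p\<^esub> x = \<zero>\<^bsub>padic_ints p\<^esub>"
      by (auto simp: padic_ints_def mod_simps)
    ultimately show "\<exists>y\<in>carrier (padic_ints p). y \<oplus>\<^bsub>padic_ints p\<^esub> x = \<zero>\<^bsub>padic_ints p\<^esub>"
      by blast
  next
    show "\<zero>\<^bsub>padic_ints p\<^esub> \<in> carrier (padic_ints p)"
      by (rule carrI) (auto simp: padic_ints_def)
    show "\<one>\<^bsub>padic_ints p\<^esub> \<in> carrier (padic_ints p)"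
      using cong_eq[of "\<lambda>n. 1"] by (simp add: padic_ints_def)
  qed (use rep in \<open>auto simp: padic_ints_def mod_simps algebra_simps\<close>)
qed

text \<open>The canonical image of an integer, and congruence modulo \<open>p\<close>, in the \<open>p\<close>-adic integers.\<close>

definition padic_of_int :: "nat \<Rightarrow> int \<Rightarrow> nat \<Rightarrow> int" where
  "padic_of_int p k = [k] \<cdot>\<^bsub>padic_ints p\<^esub> \<one>\<^bsub>padic_ints p\<^esub>"

definition padic_cong :: "nat \<Rightarrow> (nat \<Rightarrow> int) \<Rightarrow> (nat \<Rightarrow> int) \<Rightarrow> bool" where
  "padic_cong p x y \<longleftrightarrow> padic_of_int p (int p) divides\<^bsub>padic_ints p\<^esub> (x \<ominus>\<^bsub>padic_ints p\<^esub> y)"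

definition teichmuller :: "nat \<Rightarrow> nat \<Rightarrow> nat \<Rightarrow> int" where
  "teichmuller p k =
     (THE x. x \<in> carrier (padic_ints p) \<and> x [^]\<^bsub>padic_ints p\<^esub> (p - 1) = \<one>\<^bsub>padic_ints p\<^esub> \<and>
             padic_cong p x (padic_of_int p (int k)))"


section \<open>The cyclotomic field and its Galois group\<close>

definition cyclo_field :: "complex \<Rightarrow> complex ring" where
  "cyclo_field \<zeta> =
     ring_of_type_algebra\<lparr>carrier := generate_field ring_of_type_algebra (\<rat> \<union> {\<zeta>})\<rparr>"

definition cyclo_integers :: "complex \<Rightarrow> complex ring" where
  "cyclo_integers \<zeta> =
     ring_of_type_algebra\<lparr>carrier := {x \<in> carrier (cyclo_field \<zeta>). algebraic_int x}\<rparr>"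

definition cyclo_gal :: "complex \<Rightarrow> (complex \<Rightarrow> complex) set" where
  "cyclo_gal \<zeta> =
     {\<sigma> \<in> ring_iso (cyclo_field \<zeta>) (cyclo_field \<zeta>).
        \<sigma> \<in> extensional (carrier (cyclo_field \<zeta>)) \<and> (\<forall>q\<in>\<rat>. \<sigma> q = q)}"

definition cyclo_aut :: "complex \<Rightarrow> nat \<Rightarrow> complex \<Rightarrow> complex" where
  "cyclo_aut \<zeta> k = (THE \<sigma>. \<sigma> \<in> cyclo_gal \<zeta> \<and> \<sigma> \<zeta> = \<zeta> ^ k)"


section \<open>Characters, idempotents and Mirimanoff polynomials\<close>

text \<open>
  Characters are functions on the Galois group, undefined outside of it, so that two
  characters are equal as functions iff they agree on the Galois group.
\<close>

definition omega :: "nat \<Rightarrow> complex \<Rightarrow> (complex \<Rightarrow> complex) \<Rightarrow> (nat \<Rightarrow> int)" where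
  "omega p \<zeta> = (\<lambda>\<sigma>\<in>cyclo_gal \<zeta>. teichmuller p (THE k. k \<in> {1..p - 1} \<and> \<sigma> = cyclo_aut \<zeta> k))"

definition padic_characters :: "nat \<Rightarrow> complex \<Rightarrow> ((complex \<Rightarrow> complex) \<Rightarrow> (nat \<Rightarrow> int)) set" where
  "padic_characters p \<zeta> =
     (\<lambda>m. \<lambda>\<sigma>\<in>cyclo_gal \<zeta>. omega p \<zeta> \<sigma> [^]\<^bsub>padic_ints p\<^esub> (m::nat)) ` {1..p - 1}"

text \<open>The argument \<open>-1\<close> of a character corresponds to the automorphism with index \<open>p - 1\<close>.\<close>

definition odd_character ::
  "nat \<Rightarrow> complex \<Rightarrow> ((complex \<Rightarrow> complex) \<Rightarrow> (nat \<Rightarrow> int)) \<Rightarrow> bool" where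
  "odd_character p \<zeta> \<chi> \<longleftrightarrow> \<chi> (cyclo_aut \<zeta> (p - 1)) = \<ominus>\<^bsub>padic_ints p\<^esub> \<one>\<^bsub>padic_ints p\<^esub>"

definition dual_character ::
  "nat \<Rightarrow> complex \<Rightarrow> ((complex \<Rightarrow> complex) \<Rightarrow> (nat \<Rightarrow> int)) \<Rightarrow> ((complex \<Rightarrow> complex) \<Rightarrow> (nat \<Rightarrow> int))"
  where
  "dual_character p \<zeta> \<chi> =
     (\<lambda>\<sigma>\<in>cyclo_gal \<zeta>. omega p \<zeta> \<sigma> \<otimes>\<^bsub>padic_ints p\<^esub> inv\<^bsub>padic_ints p\<^esub> (\<chi> \<sigma>))"

text \<open>
  An element of the group ring of the Galois group over the \<open>p\<close>-adic integers is given by its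
  coefficient function on the Galois group.
\<close>

definition char_idempotent ::
  "nat \<Rightarrow> complex \<Rightarrow> ((complex \<Rightarrow> complex) \<Rightarrow> (nat \<Rightarrow> int)) \<Rightarrow> ((complex \<Rightarrow> complex) \<Rightarrow> (nat \<Rightarrow> int))"
  where
  "char_idempotent p \<zeta> \<chi> =
     (\<lambda>\<sigma>\<in>cyclo_gal \<zeta>. inv\<^bsub>padic_ints p\<^esub> (padic_of_int p (int p - 1))
                          \<otimes>\<^bsub>padic_ints p\<^esub> inv\<^bsub>padic_ints p\<^esub> (\<chi> \<sigma>))"

definition mirimanoff ::
  "nat \<Rightarrow> complex \<Rightarrow> ((complex \<Rightarrow> complex) \<Rightarrow> (nat \<Rightarrow> int)) \<Rightarrow> (nat \<Rightarrow> (nat \<Rightarrow> int))" where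
  "mirimanoff p \<zeta> \<phi> =
     (\<Oplus>\<^bsub>UP (padic_ints p)\<^esub>k\<in>{1..p - 1}.
        up_ring.monom (UP (padic_ints p)) (inv\<^bsub>padic_ints p\<^esub> (\<phi> (cyclo_aut \<zeta> k))) k)"

definition mirimanoff_eval ::
  "nat \<Rightarrow> complex \<Rightarrow> ((complex \<Rightarrow> complex) \<Rightarrow> (nat \<Rightarrow> int)) \<Rightarrow> (nat \<Rightarrow> int) \<Rightarrow> (nat \<Rightarrow> int)" where
  "mirimanoff_eval p \<zeta> \<phi> z =
     eval (padic_ints p) (padic_ints p) (\<lambda>x. x) z (mirimanoff p \<zeta> \<phi>)"


section \<open>The ideal class group and its \<open>p\<close>-part\<close>

definition fractional_ideals :: "complex \<Rightarrow> complex set set" where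
  "fractional_ideals \<zeta> =
     {(\<lambda>x. x / d) ` J | J d. ideal J (cyclo_integers \<zeta>) \<and> J \<noteq> {0} \<and>
                             d \<in> carrier (cyclo_integers \<zeta>) \<and> d \<noteq> 0}"

definition fractional_ideal_group :: "complex \<Rightarrow> complex set monoid" where
  "fractional_ideal_group \<zeta> =
     \<lparr> carrier = fractional_ideals \<zeta>,
       monoid.mult = ideal_prod (cyclo_field \<zeta>),
       one = carrier (cyclo_integers \<zeta>) \<rparr>"

definition principal_fractional_ideals :: "complex \<Rightarrow> complex set set" where
  "principal_fractional_ideals \<zeta> =
     {(\<lambda>x. \<alpha> * x) ` carrier (cyclo_integers \<zeta>) | \<alpha>. \<alpha> \<in> carrier (cyclo_field \<zeta>) \<and> \<alpha> \<noteq> 0}"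

definition class_group :: "complex \<Rightarrow> complex set set monoid" where
  "class_group \<zeta> = fractional_ideal_group \<zeta> Mod principal_fractional_ideals \<zeta>"

definition p_subgroup :: "nat \<Rightarrow> ('a, 'b) monoid_scheme \<Rightarrow> 'a set \<Rightarrow> bool" where
  "p_subgroup p G H \<longleftrightarrow> subgroup H G \<and> (\<forall>x\<in>H. \<exists>n::nat. x [^]\<^bsub>G\<^esub> (p ^ n) = \<one>\<^bsub>G\<^esub>)"

definition sylow_subgroup :: "nat \<Rightarrow> ('a, 'b) monoid_scheme \<Rightarrow> 'a set \<Rightarrow> bool" where
  "sylow_subgroup p G H \<longleftrightarrow>
     p_subgroup p G H \<and> (\<forall>H'. p_subgroup p G H' \<and> H \<subseteq> H' \<longrightarrow> H' = H)"

lemma (in comm_group) sylow_subgroup_unique: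
  "sylow_subgroup p G H \<longleftrightarrow> H = {x \<in> carrier G. \<exists>n::nat. x [^] (p ^ n) = \<one>}"
proof -
  let ?T = "{x \<in> carrier G. \<exists>n::nat. x [^] (p ^ n) = \<one>}"
  have "subgroup ?T G"
  proof (rule subgroupI)
    show "?T \<noteq> {}" by (auto intro!: exI[of _ \<one>])
  next
    fix x assume "x \<in> ?T"
    then show "inv x \<in> ?T" by (auto simp: nat_pow_inv)
  next
    fix x y assume "x \<in> ?T" "y \<in> ?T"
    then obtain m n where x: "x \<in> carrier G" "x [^] (p ^ m) = \<one>"
      and y: "y \<in> carrier G" "y [^] (p ^ n) = \<one>" by auto
    have "x [^] (p ^ (m + n)) = \<one>"
      using x by (simp add: power_add nat_pow_pow[symmetric])
    moreover have "y [^] (p ^ (m + n)) = \<one>"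
      using y by (simp add: power_add mult.commute[of "p ^ m"] nat_pow_pow[symmetric])
    ultimately have "(x \<otimes> y) [^] (p ^ (m + n)) = \<one>"
      using x(1) y(1) by (simp add: nat_pow_distrib)
    then show "x \<otimes> y \<in> ?T" using x(1) y(1) by blast
  qed auto
  then have T: "p_subgroup p G ?T" by (auto simp: p_subgroup_def)
  have "H' \<subseteq> ?T" if "p_subgroup p G H'" for H'
    using that subgroup.subset by (fastforce simp: p_subgroup_def)
  with T show ?thesis unfolding sylow_subgroup_def by blast
qed

definition p_class_group :: "nat \<Rightarrow> complex \<Rightarrow> complex set set set" where
  "p_class_group p \<zeta> = (THE H. sylow_subgroup p (class_group \<zeta>) H)"

definition class_act :: "(complex \<Rightarrow> complex) \<Rightarrow> complex set set \<Rightarrow> complex set set" where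
  "class_act \<sigma> c = (\<lambda>I. \<sigma> ` I) ` c"

text \<open>
  The power \<open>x ^ a\<close> of an element of \<open>p\<close>-power order with \<open>p\<close>-adic exponent \<open>a\<close>: the residue of
  \<open>a\<close> modulo the order \<open>p ^ n\<close> of \<open>x\<close> is the component \<open>a n\<close>.
\<close>

definition padic_power :: "nat \<Rightarrow> ('a, 'b) monoid_scheme \<Rightarrow> 'a \<Rightarrow> (nat \<Rightarrow> int) \<Rightarrow> 'a" where
  "padic_power p G x a = x [^]\<^bsub>G\<^esub> a (LEAST n. x [^]\<^bsub>G\<^esub> (p ^ n) = \<one>\<^bsub>G\<^esub>)"

definition group_ring_power ::
  "nat \<Rightarrow> complex \<Rightarrow> complex set set \<Rightarrow> ((complex \<Rightarrow> complex) \<Rightarrow> (nat \<Rightarrow> int)) \<Rightarrow> complex set set" where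
  "group_ring_power p \<zeta> c \<theta> =
     finprod (class_group \<zeta>) (\<lambda>\<sigma>. padic_power p (class_group \<zeta>) (class_act \<sigma> c) (\<theta> \<sigma>))
       (cyclo_gal \<zeta>)"

definition class_component ::
  "nat \<Rightarrow> complex \<Rightarrow> ((complex \<Rightarrow> complex) \<Rightarrow> (nat \<Rightarrow> int)) \<Rightarrow> complex set set set" where
  "class_component p \<zeta> \<chi> =
     (\<lambda>c. group_ring_power p \<zeta> c (char_idempotent p \<zeta> \<chi>)) ` p_class_group p \<zeta>"

end

theory Submission
  imports Defs "Jordan_Normal_Form.Char_Poly" "HOL-Number_Theory.Residues"
begin

text \<open>
  Let \<open>\<chi> = \<omega>\<^sup>m\<close>; since \<open>\<chi>\<close> is odd and different from \<open>\<omega>\<close>, the exponent \<open>m\<close> is odd and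
  \<open>3 \<le> m \<le> p - 2\<close>. Write \<open>s\<^sub>k\<close> for the automorphism \<open>\<zeta> \<mapsto> \<zeta>\<^sup>k\<close>.

  In the first case the factors of \<open>\<Prod>k<p. a + \<zeta>\<^sup>k b = (-c)\<^sup>p\<close> generate pairwise comaximal
  ideals, so \<open>a + \<zeta> b\<close> generates the \<open>p\<close>-th power of an ideal \<open>I\<close>
  (\<open>ipow_two_generated\<close>, \<open>lin_1_is_pth_power\<close>). The class of \<open>I\<close> is killed by \<open>p\<close>, hence
  only the residues \<open>n k\<close> modulo \<open>p\<close> of the coefficients of the idempotent \<open>e\<^sub>\<chi>\<close> act on it.
  If the \<open>\<chi>\<close>-component were trivial, then \<open>\<Prod>k. s\<^sub>k(I)\<^bsup>n k\<^esup>\<close> would be principal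
  and \<open>A = \<Prod>k. (a + \<zeta>\<^sup>k b)\<^bsup>n k\<^esup>\<close> would be \<open>u \<gamma>\<^sup>p\<close> with a unit \<open>u\<close>
  (\<open>principal_of_trivial_component\<close>). Now \<open>\<gamma>\<^sup>p\<close> is congruent to a rational integer modulo
  \<open>p\<close>, and \<open>u\<close> divided by its complex conjugate is \<open>\<plusminus>\<zeta>\<^sup>t\<close> (\<open>unit_modulus_1\<close>), so that \<open>A\<close> and
  \<open>\<plusminus>\<zeta>\<^sup>t\<close> times the conjugate of \<open>A\<close> agree modulo \<open>p\<close> (\<open>congruence_of_pth_power\<close>).

  This congruence between integer polynomials in \<open>\<zeta>\<close> is a congruence between the polynomials
  themselves modulo \<open>p\<close> and \<open>(X - 1)\<^bsup>p-1\<^esup>\<close>, because \<open>p\<close> is totally ramified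
  (\<open>vanishes_mod_if_p_dvd\<close>). Kummer's logarithmic derivative turns it into a linear condition:
  with \<open>z = -b/a\<close>, the logarithmic derivative of \<open>1 - z X\<^sup>k\<close> under \<open>X d/dX\<close> is, up to a constant
  factor and a constant term, the polynomial \<open>k \<Sum>j<p. z\<^sup>j X\<^bsup>kj\<^esup>\<close>. Applying
  \<open>X d/dX\<close> a further \<open>m - 1\<close> times and putting \<open>X = 1\<close> leaves the Mirimanoff sum
  \<open>\<Sum>j. j\<^bsup>m-1\<^esup> z\<^sup>j\<close>, multiplied by \<open>\<Sum>k. n k \<cdot> k\<^sup>m\<close> for \<open>A\<close> and by its
  negative for the conjugate of \<open>A\<close>; the factor \<open>\<zeta>\<^sup>t\<close> contributes a constant that disappears
  because \<open>m > 1\<close>. As \<open>n k \<cdot> k\<^sup>m \<equiv> -1\<close>, these multipliers do not cancel, and the Mirimanoff sum,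
  which is the value at \<open>z\<close> of the Mirimanoff polynomial of the character dual to \<open>\<chi>\<close>, vanishes
  modulo \<open>p\<close> (\<open>power_sum_dvd_of_congruence\<close>), against the hypothesis.

  For the class group to be a group, fractional ideals must be invertible. The inverse is found
  by Kronecker's method: a polynomial \<open>f\<close> whose coefficients generate the ideal is multiplied by
  its conjugates, the product has rational integer coefficients with greatest common divisor
  \<open>c\<close>, and Dedekind's generalization of Gauss's lemma (\<open>algebraic_int_coeff_mult\<close>) shows that
  \<open>c\<close> divides every product of a coefficient of \<open>f\<close> with one of the cofactor
  (\<open>one_in_integral_inverse\<close>, \<open>iprod_inverse\<close>).
\<close>

alias coeff = Polynomial.coeff
alias monom = Polynomial.monom
alias degree = Polynomial.degree

section \<open>Algebraic integers\<close>

lemma algebraic_int_eigenvalue: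
  assumes A: "A \<in> carrier_mat n n" and ev: "eigenvalue (map_mat complex_of_int A) x"
  shows "algebraic_int x"
proof -
  have m: "map_mat complex_of_int A \<in> carrier_mat n n" using A by simp
  have "poly (char_poly (map_mat of_int A)) x = 0"
    using eigenvalue_root_char_poly[OF m] ev by blast
  moreover have "char_poly (map_mat complex_of_int A) = map_poly of_int (char_poly A)"
    by (rule of_int_hom.char_poly_hom[OF A])
  moreover have "lead_coeff (char_poly A) = 1"
    using degree_monic_char_poly[OF A] by auto
  ultimately show ?thesis unfolding algebraic_int_altdef_ipoly by metis
qed

interpretation zmod: Modules.module "\<lambda>(n::int) (x::complex). of_int n * x"
  by unfold_locales (auto simp: algebra_simps)

text \<open>
  Multiplication by \<open>x\<close> is given on generators by an integer matrix, of which the nonzero vector of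
  generators is an eigenvector; its characteristic polynomial is the equation of integral dependence.
\<close>

lemma algebraic_int_module:
  fixes x :: complex
  assumes fin: "finite B" and b: "\<exists>b\<in>B. b \<noteq> 0"
    and cl: "\<And>b. b \<in> B \<Longrightarrow> x * b \<in> zmod.span B"
  shows "algebraic_int x"
proof -
  obtain bs where bs: "set bs = B" "distinct bs" using fin finite_distinct_list by blast
  define n where "n = length bs"
  have "\<forall>b\<in>B. \<exists>u. x * b = (\<Sum>v\<in>B. of_int (u v) * v)"
    using cl zmod.span_finite[OF fin] by blast
  then obtain u where u: "\<And>b. b \<in> B \<Longrightarrow> x * b = (\<Sum>v\<in>B. of_int (u b v) * v)"
    by metis
  define A where "A = mat n n (\<lambda>(i,j). u (bs!i) (bs!j))"
  define v where "v = vec n (\<lambda>i. bs ! i)"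
  have A: "A \<in> carrier_mat n n" by (simp add: A_def)
  have v: "v \<in> carrier_vec n" by (simp add: v_def)
  have sum: "(\<Sum>v\<in>B. f v) = (\<Sum>j<n. f (bs ! j))" for f :: "complex \<Rightarrow> complex"
    using sum.reindex_bij_betw[OF bij_betw_nth[OF bs(2) refl bs(1)[symmetric]], of f]
    by (simp add: n_def)
  have "map_mat complex_of_int A *\<^sub>v v = x \<cdot>\<^sub>v v"
  proof (rule eq_vecI)
    fix i assume "i < dim_vec (x \<cdot>\<^sub>v v)"
    then have i: "i < n" by (simp add: v_def)
    then have "bs ! i \<in> B" using bs n_def by auto
    then have "x * bs ! i = (\<Sum>j<n. of_int (u (bs ! i) (bs ! j)) * bs ! j)"
      using u sum by simp
    then show "(map_mat complex_of_int A *\<^sub>v v) $ i = (x \<cdot>\<^sub>v v) $ i"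
      using i by (simp add: A_def v_def scalar_prod_def lessThan_atLeast0)
  qed (simp add: A_def v_def)
  moreover have "v \<noteq> 0\<^sub>v n"
  proof
    assume eq: "v = 0\<^sub>v n"
    obtain i where "i < n" "bs ! i \<noteq> 0" using b bs n_def by (metis in_set_conv_nth)
    moreover have "v $ i = (0\<^sub>v n :: complex vec) $ i" using eq by simp
    ultimately show False unfolding v_def by simp
  qed
  ultimately have "eigenvalue (map_mat complex_of_int A) x"
    unfolding eigenvalue_def eigenvector_def using v A by (intro exI[of _ v]) auto
  then show ?thesis using algebraic_int_eigenvalue[OF A] by blast
qed

text \<open>
  The elements of a ring that is finitely generated as an abelian group are algebraic integers.
  Sums, products and integral dependence are reduced to this by adjoining finitely many elements.
\<close>

definition finite_Z_algebra :: "complex set \<Rightarrow> bool" where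
  "finite_Z_algebra R \<longleftrightarrow> 1 \<in> R \<and> (\<forall>x\<in>R. \<forall>y\<in>R. x * y \<in> R) \<and> (\<exists>B. finite B \<and> R = zmod.span B)"

lemma finite_Z_algebra_algebraic_int:
  assumes R: "finite_Z_algebra R" and x: "x \<in> R"
  shows "algebraic_int x"
proof -
  obtain B where B: "finite B" "R = zmod.span B" using R unfolding finite_Z_algebra_def by blast
  show ?thesis
  proof (rule algebraic_int_module[OF B(1)])
    show "\<exists>b\<in>B. b \<noteq> 0"
    proof (rule ccontr)
      assume "\<not> ?thesis"
      then have "zmod.span B \<subseteq> {0}" by (intro zmod.span_minimal) (auto simp: zmod.subspace_def)
      moreover have "1 \<in> zmod.span B" using R B finite_Z_algebra_def by simp
      ultimately show False by auto
    qed
    show "x * b \<in> zmod.span B" if "b \<in> B" for b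
      using that R x B zmod.span_base unfolding finite_Z_algebra_def by blast
  qed
qed

text \<open>
  The monic equation for \<open>y\<close> expresses all its powers by those below \<open>n\<close>, so the products \<open>b y\<^sup>i\<close> with
  \<open>i < n\<close> and \<open>b\<close> in a generating set of \<open>R\<close> span \<open>R[y]\<close>.
\<close>

lemma finite_Z_algebra_adjoin:
  assumes R: "finite_Z_algebra R" and n: "0 < n" and r: "\<And>i. i < n \<Longrightarrow> r i \<in> R"
    and root: "y ^ n = (\<Sum>i<n. r i * y ^ i)"
  obtains R' where "finite_Z_algebra R'" "R \<subseteq> R'" "y \<in> R'"
proof -
  obtain B where B: "finite B" "R = zmod.span B" using R unfolding finite_Z_algebra_def by blast
  have one: "1 \<in> R" and mult: "\<And>x y. x \<in> R \<Longrightarrow> y \<in> R \<Longrightarrow> x * y \<in> R"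
    using R unfolding finite_Z_algebra_def by auto
  define S where "S = zmod.span ((\<lambda>(b, i). b * y ^ i) ` (B \<times> {..<n}))"
  have gen: "x * y ^ i \<in> S" if x: "x \<in> R" and i: "i < n" for x i
    using x unfolding B(2)
  proof (induction rule: zmod.span_induct_alt)
    case base then show ?case by (simp add: S_def zmod.span_zero)
  next
    case (step c b z)
    have "b * y ^ i \<in> S" unfolding S_def using step(1) i by (intro zmod.span_base) auto
    then have "of_int c * (b * y ^ i) \<in> S" unfolding S_def by (rule zmod.span_scale)
    then have "of_int c * (b * y ^ i) + z * y ^ i \<in> S"
      using step(2) unfolding S_def by (intro zmod.span_add)
    then show ?case by (simp add: algebra_simps)
  qed
  have S_add: "u + v \<in> S" if "u \<in> S" "v \<in> S" for u v using that zmod.span_add S_def by auto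
  have S_sum: "(\<Sum>i\<in>I. f i) \<in> S" if "\<And>i. i \<in> I \<Longrightarrow> f i \<in> S" for f :: "nat \<Rightarrow> complex" and I
    using that unfolding S_def by (intro zmod.span_sum) auto
  have S_zero: "0 \<in> S" by (simp add: S_def zmod.span_zero)
  have S_scale: "of_int c * s \<in> S" if "s \<in> S" for c s using that zmod.span_scale S_def by auto
  have S_R: "x * s \<in> S" if x: "x \<in> R" and s: "s \<in> S" for x s
    using s unfolding S_def
  proof (induction rule: zmod.span_induct_alt)
    case (step c z w)
    from step(1) obtain b i where bi: "b \<in> B" "i < n" "z = b * y ^ i" by auto
    have "b \<in> R" using bi B zmod.span_base by auto
    then have "(x * b) * y ^ i \<in> S" using gen mult x bi by blast
    then have "of_int c * ((x * b) * y ^ i) + x * w \<in> S" using S_add S_scale step(2) S_def by auto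
    then show ?case using S_def bi by (simp add: algebra_simps)
  qed (use S_zero S_def in auto)
  have S_y: "y * s \<in> S" if s: "s \<in> S" for s
    using s unfolding S_def
  proof (induction rule: zmod.span_induct_alt)
    case (step c z w)
    from step(1) obtain b i where bi: "b \<in> B" "i < n" "z = b * y ^ i" by auto
    have bR: "b \<in> R" using bi B zmod.span_base by auto
    have "b * y ^ Suc i \<in> S"
    proof (cases "Suc i < n")
      case True then show ?thesis using gen bR by blast
    next
      case False
      then have "Suc i = n" using bi by simp
      then have "b * y ^ Suc i = (\<Sum>i<n. (b * r i) * y ^ i)"
        by (simp add: root sum_distrib_left mult.assoc del: power_Suc)
      also have "\<dots> \<in> S" using gen mult bR r by (intro S_sum) auto
      finally show ?thesis .
    qed
    then have "of_int c * (b * y ^ Suc i) + y * w \<in> S" using S_add S_scale step(2) S_def by auto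
    then show ?case using S_def bi by (simp add: algebra_simps)
  qed (use S_zero S_def in auto)
  have S_pow: "y ^ i * s \<in> S" if "s \<in> S" for s i
    using that by (induction i) (auto simp: mult.assoc intro: S_y)
  have S_mult: "t * s \<in> S" if t: "t \<in> S" and s: "s \<in> S" for s t
    using t unfolding S_def
  proof (induction rule: zmod.span_induct_alt)
    case (step c z w)
    from step(1) obtain b i where bi: "b \<in> B" "i < n" "z = b * y ^ i" by auto
    have "b \<in> R" using bi B zmod.span_base by auto
    then have "b * (y ^ i * s) \<in> S" using S_R S_pow s by blast
    then have "of_int c * (b * (y ^ i * s)) + w * s \<in> S" using S_add S_scale step(2) S_def by auto
    then show ?case using S_def bi by (simp add: algebra_simps)
  qed (use S_zero S_def in auto)
  have sub: "R \<subseteq> S" using gen[of _ 0] n by auto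
  have yS: "y \<in> S" using S_y[of 1] sub one by auto
  have "finite_Z_algebra S"
    unfolding finite_Z_algebra_def
  proof (intro conjI)
    show "\<exists>B. finite B \<and> S = zmod.span B"
      unfolding S_def using B(1) by (intro exI[of _ "(\<lambda>(b, i). b * y ^ i) ` (B \<times> {..<n})"]) auto
  qed (use sub one S_mult in auto)
  then show thesis using that sub yS by blast
qed

lemma finite_Z_algebra_Ints: "finite_Z_algebra \<int>"
proof -
  have "zmod.span {1} = \<int>" by (auto simp: zmod.span_singleton Ints_def)
  then show ?thesis unfolding finite_Z_algebra_def by (intro conjI exI[of _ "{1}"]) auto
qed

lemma finite_Z_algebra_adjoin_root:
  assumes R: "finite_Z_algebra R" and q: "\<And>i. coeff q i \<in> R" "lead_coeff q = 1" "poly q y = 0"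
  obtains R' where "finite_Z_algebra R'" "R \<subseteq> R'" "y \<in> R'"
proof -
  define n where "n = degree q"
  have "n \<noteq> 0"
  proof
    assume "n = 0"
    then have "q = 1" using q(2) n_def by (metis degree_0_id one_pCons)
    then show False using q(3) by simp
  qed
  have neg: "- x \<in> R" if "x \<in> R" for x
    using R that zmod.span_neg unfolding finite_Z_algebra_def by auto
  have "poly q y = (\<Sum>i<n. coeff q i * y ^ i) + y ^ n"
    using q(2) unfolding poly_altdef n_def[symmetric] by (simp add: lessThan_Suc_atMost[symmetric] n_def)
  then have "y ^ n = (\<Sum>i<n. - coeff q i * y ^ i)"
    using q(3) by (simp add: sum_negf add_eq_0_iff)
  then show thesis
    using finite_Z_algebra_adjoin[OF R, of n "\<lambda>i. - coeff q i" y] neg q(1) \<open>n \<noteq> 0\<close> that by blast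
qed

lemma finite_Z_algebra_superset:
  assumes "finite S" "\<And>x. x \<in> S \<Longrightarrow> algebraic_int x"
  obtains R where "finite_Z_algebra R" "S \<subseteq> R"
  using assms
proof (induction S arbitrary: thesis rule: finite_induct)
  case empty then show ?case using finite_Z_algebra_Ints by blast
next
  case (insert x S)
  obtain R where R: "finite_Z_algebra R" "S \<subseteq> R" using insert.IH insert.prems by auto
  have ints: "\<int> \<subseteq> R"
  proof
    fix z :: complex assume "z \<in> \<int>"
    then obtain k where "z = of_int k * 1" by (auto elim: Ints_cases)
    then show "z \<in> R" using R(1) zmod.span_scale[of 1 _ k] unfolding finite_Z_algebra_def by auto
  qed
  obtain q where q: "lead_coeff q = 1" "\<forall>i. coeff q i \<in> \<int>" "poly q x = 0"
    using insert.prems(2)[of x] by (auto simp: algebraic_int.simps)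
  obtain R' where "finite_Z_algebra R'" "R \<subseteq> R'" "x \<in> R'"
    using finite_Z_algebra_adjoin_root[OF R(1), of q x] q ints by blast
  then show ?case using insert.prems(1) R by blast
qed

lemma
  fixes x y :: complex
  assumes "algebraic_int x" "algebraic_int y"
  shows algebraic_int_add: "algebraic_int (x + y)" and algebraic_int_mult: "algebraic_int (x * y)"
proof -
  obtain R where R: "finite_Z_algebra R" "{x, y} \<subseteq> R"
    using finite_Z_algebra_superset[of "{x,y}"] assms by auto
  have "x + y \<in> R" "x * y \<in> R"
    using R zmod.span_add unfolding finite_Z_algebra_def by auto
  then show "algebraic_int (x + y)" "algebraic_int (x * y)"
    using finite_Z_algebra_algebraic_int R by blast+
qed

lemma algebraic_int_diff: "algebraic_int x \<Longrightarrow> algebraic_int y \<Longrightarrow> algebraic_int (x - y)" for x y :: complex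
  using algebraic_int_add[of x "- y"] by simp

lemma algebraic_int_sum: "(\<And>i. i \<in> I \<Longrightarrow> algebraic_int (f i)) \<Longrightarrow> algebraic_int (\<Sum>i\<in>I. f i :: complex)"
  by (induction I rule: infinite_finite_induct) (auto intro: algebraic_int_add)

lemma algebraic_int_prod: "(\<And>i. i \<in> I \<Longrightarrow> algebraic_int (f i)) \<Longrightarrow> algebraic_int (\<Prod>i\<in>I. f i :: complex)"
  by (induction I rule: infinite_finite_induct) (auto intro: algebraic_int_mult)

lemma algebraic_int_power: "algebraic_int x \<Longrightarrow> algebraic_int (x ^ n :: complex)"
  by (induction n) (auto intro: algebraic_int_mult)

lemma algebraic_int_monic_root:
  fixes y :: complex
  assumes "\<And>i. algebraic_int (coeff q i)" "lead_coeff q = 1" "poly q y = 0"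
  shows "algebraic_int y"
proof -
  have *: "algebraic_int x" if "x \<in> coeff q ` {..degree q}" for x
    using that assms(1) by auto
  obtain R where R: "finite_Z_algebra R" "coeff q ` {..degree q} \<subseteq> R"
    by (rule finite_Z_algebra_superset[OF _ *]) auto
  have "0 \<in> R" using R zmod.span_zero unfolding finite_Z_algebra_def by auto
  have "coeff q i \<in> R" for i
  proof (cases "i \<le> degree q")
    case False
    then have "coeff q i = 0" by (simp add: coeff_eq_0)
    then show ?thesis using \<open>0 \<in> R\<close> by simp
  qed (use R in auto)
  then obtain R' where "finite_Z_algebra R'" "y \<in> R'"
    using finite_Z_algebra_adjoin_root[OF R(1), of q y] assms by blast
  then show ?thesis by (rule finite_Z_algebra_algebraic_int)
qed

text \<open>
  Multiplying the equation of degree \<open>n\<close> by the \<open>(n - 1)\<close>-st power of its leading coefficient \<open>d\<close>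
  makes it a monic equation for \<open>d y\<close>.
\<close>

lemma algebraic_int_lead_coeff_root:
  fixes y :: complex
  assumes int: "\<And>i. algebraic_int (coeff q i)" and y: "poly q y = 0" and nc: "degree q > 0"
  shows "algebraic_int (lead_coeff q * y)"
proof -
  define n where "n = degree q"
  define d where "d = lead_coeff q"
  have d0: "d \<noteq> 0" using nc d_def by auto
  define h where "h = (\<lambda>i. if i < n then coeff q i * d ^ (n - 1 - i) else if i = n then 1 else 0)"
  define Q where "Q = Abs_poly h"
  have cQ: "coeff Q = h"
    unfolding Q_def by (rule coeff_Abs_poly[of n]) (auto simp: h_def)
  have deg: "degree Q = n"
  proof (rule antisym)
    show "degree Q \<le> n" by (rule degree_le) (auto simp: cQ h_def)
    show "n \<le> degree Q" by (rule le_degree) (auto simp: cQ h_def)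
  qed
  have "poly Q (d * y) = (\<Sum>i<n. h i * (d * y) ^ i) + (d * y) ^ n"
    unfolding poly_altdef deg cQ by (simp add: lessThan_Suc_atMost[symmetric] h_def)
  also have "(\<Sum>i<n. h i * (d * y) ^ i) = (\<Sum>i<n. d ^ (n - 1) * (coeff q i * y ^ i))"
  proof (rule sum.cong)
    fix i assume i: "i \<in> {..<n}"
    then have "d ^ (n - 1 - i) * d ^ i = d ^ (n - 1)" by (simp add: power_add[symmetric])
    then show "h i * (d * y) ^ i = d ^ (n - 1) * (coeff q i * y ^ i)"
      using i by (simp add: h_def power_mult_distrib algebra_simps)
  qed simp
  also have "(d * y) ^ n = d ^ (n - 1) * (d * y ^ n)"
    using nc unfolding n_def[symmetric] by (cases n) (auto simp: power_mult_distrib)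
  also have "(\<Sum>i<n. d ^ (n - 1) * (coeff q i * y ^ i)) + d ^ (n - 1) * (d * y ^ n)
    = d ^ (n - 1) * poly q y"
    unfolding poly_altdef n_def[symmetric] lessThan_Suc_atMost[symmetric]
    by (simp add: sum_distrib_left distrib_left d_def n_def)
  finally have "poly Q (d * y) = 0" using y by simp
  moreover have "algebraic_int (coeff Q i)" for i
    unfolding cQ h_def using int by (auto intro!: algebraic_int_mult algebraic_int_power simp: d_def)
  moreover have "lead_coeff Q = 1" unfolding deg cQ by (simp add: h_def)
  ultimately show ?thesis using algebraic_int_monic_root d_def by blast
qed

text \<open>
  With \<open>d\<close> the leading coefficient and \<open>n\<close> the degree of \<open>q\<close>, both \<open>d\<close> and \<open>d y\<close> are algebraic integers,
  so \<open>d X\<^sup>n\<close> can be split off from \<open>q\<close> and the degree drops.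
\<close>

lemma algebraic_int_linear_cofactor:
  fixes y :: complex
  assumes "\<And>i. algebraic_int (coeff ([:- y, 1:] * q) i)"
  shows "algebraic_int (coeff q i)"
  using assms
proof (induction "degree q" arbitrary: q i rule: less_induct)
  case less
  show ?case
  proof (cases "q = 0")
    case False
    define f where "f = [:- y, 1:] * q"
    define n where "n = degree q"
    define d where "d = lead_coeff q"
    have degf: "degree f = Suc n"
      unfolding f_def n_def using False by (subst degree_mult_eq) auto
    have lead: "lead_coeff f = d" unfolding f_def d_def by (simp only: lead_coeff_mult) simp
    have d: "algebraic_int d" using less.prems[of "Suc n"] lead degf f_def by simp
    have dy: "algebraic_int (d * y)"
      using algebraic_int_lead_coeff_root[of f y] less.prems lead degf f_def by simp
    define q' where "q' = q - monom d n"
    have main: "algebraic_int (coeff q' i)" for i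
    proof (cases "n = 0")
      case True
      then have "q' = 0" unfolding q'_def d_def n_def
        by (metis degree_0_id diff_self monom_0)
      then show ?thesis by simp
    next
      case False
      have "coeff ([:- y, 1:] * q') j = coeff f j
          - (if j = Suc n then d else 0) + (if j = n then d * y else 0)" for j
        unfolding q'_def f_def by (cases j) (auto simp: algebra_simps coeff_pCons)
      then have "algebraic_int (coeff ([:- y, 1:] * q') j)" for j
        using less.prems[of j] d dy f_def
        by (auto intro: algebraic_int_add algebraic_int_diff)
      moreover have "degree q' < degree q"
      proof -
        have "degree q' \<le> n" unfolding q'_def n_def
          by (intro degree_diff_le) (auto simp: degree_monom_le)
        moreover have "coeff q' n = 0" by (simp add: q'_def d_def n_def)
        ultimately show ?thesis using False n_def
          by (metis leading_coeff_0_iff le_neq_implies_less degree_0 not_gr_zero)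
      qed
      ultimately show ?thesis using less.hyps by blast
    qed
    have "coeff q i = coeff q' i + (if i = n then d else 0)"
      unfolding q'_def by auto
    then show ?thesis using main[of i] d by (auto intro: algebraic_int_add)
  qed simp
qed

text \<open>
  Dedekind's Prague theorem. If \<open>f = (X - r) h\<close>, the preceding lemma makes \<open>k h g\<close> integral, and then
  \<open>k r h g = k X h g - k f g\<close> is integral as well. By induction all \<open>k c d\<close> and \<open>k r c d\<close> are integral,
  where \<open>c\<close> and \<open>d\<close> run through the coefficients of \<open>h\<close> and \<open>g\<close>, and the coefficients of \<open>f\<close> are of
  the form \<open>c - r c'\<close>.
\<close>

theorem algebraic_int_coeff_mult:
  fixes f g :: "complex poly"
  assumes "\<And>i. algebraic_int (k * coeff (f * g) i)"
  shows "algebraic_int (k * (coeff f i * coeff g j))"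
  using assms
proof (induction "degree f" arbitrary: f k i)
  case 0
  then obtain a where f: "f = [:a:]" by (metis degree_0_id)
  show ?case using 0(2)[of j] f by (cases i) auto
next
  case (Suc n)
  then obtain r where "poly f r = 0"
    using fundamental_theorem_of_algebra[of f] constant_degree[of f] by auto
  then obtain h where f: "f = [:- r, 1:] * h" by (auto simp: poly_eq_0_iff_dvd elim: dvdE)
  have "h \<noteq> 0" using Suc(2) f by auto
  then have deg: "n = degree h" using Suc(2) degree_mult_eq[of "[:- r, 1:]" h] f by simp
  have int1: "algebraic_int (coeff (smult k (h * g)) i)" for i
  proof (rule algebraic_int_linear_cofactor[where y = r])
    fix i
    have "[:- r, 1:] * smult k (h * g) = smult k (f * g)"
      by (simp only: f mult_smult_right mult.assoc)
    then show "algebraic_int (coeff ([:- r, 1:] * smult k (h * g)) i)"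
      using Suc.prems[of i] by simp
  qed
  have int2: "algebraic_int (k * r * coeff (h * g) i)" for i
  proof -
    have "f * g = pCons 0 (h * g) - smult r (h * g)" unfolding f by (simp add: algebra_simps)
    then have "k * r * coeff (h * g) i
        = k * coeff (pCons 0 (h * g)) i - k * coeff (f * g) i"
      by (simp add: right_diff_distrib mult.assoc)
    moreover have "algebraic_int (k * coeff (pCons 0 (h * g)) i)"
      using int1 by (cases i) auto
    ultimately show ?thesis using Suc.prems[of i] algebraic_int_diff by presburger
  qed
  have IH1: "algebraic_int (k * (coeff h i * coeff g j))" for i
    using Suc.hyps(1)[OF deg, of k] int1 by simp
  have IH2: "algebraic_int (k * r * (coeff h i * coeff g j))" for i
    using Suc.hyps(1)[OF deg, of "k * r"] int2 by simp
  have "k * (coeff f i * coeff g j)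
     = k * (coeff (pCons 0 h) i * coeff g j) - k * r * (coeff h i * coeff g j)"
    unfolding f by (simp add: algebra_simps)
  moreover have "algebraic_int (k * (coeff (pCons 0 h) i * coeff g j))"
    using IH1 by (cases i) auto
  ultimately show ?case using IH2[of i] algebraic_int_diff by presburger
qed

section \<open>The prime above p in the cyclotomic field\<close>

definition ipoly :: "int poly \<Rightarrow> complex \<Rightarrow> complex" where
  "ipoly F z = poly (map_poly of_int F) z"

lemma ipoly_0 [simp]: "ipoly 0 z = 0" by (simp add: ipoly_def)
lemma ipoly_pCons [simp]: "ipoly (pCons c F) z = of_int c + z * ipoly F z"
  by (cases "c = 0 \<and> F = 0") (auto simp: ipoly_def map_poly_pCons)
lemma ipoly_1 [simp]: "ipoly 1 z = 1" by (simp add: ipoly_def)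
lemma ipoly_add [simp]: "ipoly (F + G) z = ipoly F z + ipoly G z"
  by (simp add: ipoly_def of_int_poly_hom.hom_add)
lemma ipoly_diff [simp]: "ipoly (F - G) z = ipoly F z - ipoly G z"
  by (simp add: ipoly_def of_int_poly_hom.hom_minus)
lemma ipoly_minus [simp]: "ipoly (- F) z = - ipoly F z"
  by (simp add: ipoly_def of_int_poly_hom.hom_uminus)
lemma ipoly_mult [simp]: "ipoly (F * G) z = ipoly F z * ipoly G z"
  by (simp add: ipoly_def of_int_poly_hom.hom_mult)
lemma ipoly_power [simp]: "ipoly (F ^ n) z = ipoly F z ^ n"
  by (induction n) auto
lemma ipoly_smult [simp]: "ipoly (smult c F) z = of_int c * ipoly F z"
  by (simp add: ipoly_def of_int_hom.map_poly_hom_smult)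
lemma ipoly_sum [simp]: "ipoly (\<Sum>i\<in>I. F i) z = (\<Sum>i\<in>I. ipoly (F i) z)"
  by (induction I rule: infinite_finite_induct) auto
lemma ipoly_prod [simp]: "ipoly (\<Prod>i\<in>I. F i) z = (\<Prod>i\<in>I. ipoly (F i) z)"
  by (induction I rule: infinite_finite_induct) auto
lemma ipoly_monom [simp]: "ipoly (monom c n) z = of_int c * z ^ n"
  by (induction n) (auto simp: monom_0 monom_Suc)
lemma ipoly_pcompose: "ipoly (F \<circ>\<^sub>p G) z = ipoly F (ipoly G z)"
  by (induction F) (auto simp: pcompose_pCons)
lemma ipoly_altdef: "ipoly F z = (\<Sum>i\<le>degree F. of_int (coeff F i) * z ^ i)"
  by (simp add: ipoly_def poly_altdef)
lemma ipoly_altdef_less: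
  assumes "degree F < n"
  shows "ipoly F z = (\<Sum>i<n. of_int (coeff F i) * z ^ i)"
  unfolding ipoly_altdef using assms
  by (intro sum.mono_neutral_left) (auto simp: coeff_eq_0)
lemma algebraic_int_ipoly: "algebraic_int z \<Longrightarrow> algebraic_int (ipoly F z)"
  by (induction F) (auto intro: algebraic_int_add algebraic_int_mult)

text \<open>
  The ideal \<open>(p, (X - 1)\<^sup>m)\<close> of the ring of integer polynomials, described by the Taylor coefficients at \<open>1\<close>.
\<close>

definition vanishes_mod :: "nat \<Rightarrow> nat \<Rightarrow> int poly \<Rightarrow> bool" where
  "vanishes_mod p m F \<longleftrightarrow> (\<forall>i<m. int p dvd coeff (F \<circ>\<^sub>p [:1, 1:]) i)"

lemma low_coeffs_dvd_decomp:
  fixes f :: "int poly"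
  assumes "\<And>j. j < i \<Longrightarrow> p dvd coeff f j"
  shows "\<exists>g h. f = smult p g + monom 1 i * h"
  using assms
proof (induction i)
  case 0
  show ?case by (intro exI[of _ 0] exI[of _ f]) simp
next
  case (Suc i)
  then obtain g h where f: "f = smult p g + monom 1 i * h" by (meson less_Suc_eq)
  have "coeff f i = p * coeff g i + coeff h 0"
    unfolding f by (simp add: coeff_monom_mult)
  then have "p dvd coeff h 0" using Suc.prems[of i]
    by (metis dvd_add_right_iff dvd_triv_left lessI)
  then obtain c where c: "coeff h 0 = p * c" ..
  obtain h0 h' where h: "h = pCons h0 h'" by (cases h)
  have "h = smult p [:c:] + monom 1 1 * h'" using h c by (simp add: monom_Suc)
  then have "f = smult p (g + monom c i) + monom 1 (Suc i) * h'"
    unfolding f by (simp add: algebra_simps smult_add_right smult_monom mult_monom monom_Suc monom_0)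
  then show ?case by blast
qed

locale cyclotomic =
  fixes p :: nat and \<zeta> :: complex
  assumes prime: "Factorial_Ring.prime p" and gt2: "p > 2"
    and root: "\<zeta> ^ p = 1" and primitive: "\<And>k. k \<in> {1..<p} \<Longrightarrow> \<zeta> ^ k \<noteq> 1"
begin

lemma zeta_nonzero [simp]: "\<zeta> \<noteq> 0"
  using root gt2 by (cases "\<zeta> = 0") (simp_all add: power_0_left)

lemma zeta_power_mod: "\<zeta> ^ (k mod p) = \<zeta> ^ k"
proof -
  have "\<zeta> ^ k = (\<zeta> ^ p) ^ (k div p) * \<zeta> ^ (k mod p)"
    by (metis mult_div_mod_eq power_add power_mult)
  then show ?thesis using root by simp
qed

lemma zeta_power_eq_1_iff: "\<zeta> ^ k = 1 \<longleftrightarrow> p dvd k"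
proof
  assume "\<zeta> ^ k = 1"
  then have "\<zeta> ^ (k mod p) = 1" by (simp add: zeta_power_mod)
  then have "k mod p \<notin> {1..<p}" using primitive by blast
  moreover have "k mod p < p" using gt2 by simp
  ultimately show "p dvd k" by (auto simp: dvd_eq_mod_eq_0)
qed (auto elim!: dvdE simp: power_mult root)

lemma zeta_power_cong: "k mod p = l mod p \<Longrightarrow> \<zeta> ^ k = \<zeta> ^ l"
  by (metis zeta_power_mod)

lemma zeta_power_eq_iff: "\<zeta> ^ k = \<zeta> ^ l \<longleftrightarrow> k mod p = l mod p"
proof
  assume eq: "\<zeta> ^ k = \<zeta> ^ l"
  have *: "k mod p = l mod p" if "k \<le> l" "\<zeta> ^ k = \<zeta> ^ l" for k l
  proof -
    have "\<zeta> ^ k * \<zeta> ^ (l - k) = \<zeta> ^ k" using that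
      by (metis le_add_diff_inverse power_add)
    then have "p dvd l - k" using zeta_power_eq_1_iff by auto
    then show ?thesis using that(1) by (metis mod_eq_dvd_iff_nat)
  qed
  show "k mod p = l mod p" using *[of k l] *[of l k] eq nat_le_linear[of k l] by metis
qed (rule zeta_power_cong)

lemma algebraic_int_zeta [simp]: "algebraic_int \<zeta>"
proof (rule algebraic_int_root[where y = 1 and p = "monom 1 p"])
qed (use gt2 root in \<open>auto simp: poly_monom degree_monom_eq\<close>)

lemma mod_inverse:
  assumes "\<not> p dvd k"
  obtains l where "k * l mod p = 1" "\<not> p dvd l"
proof -
  have "coprime k p" using assms prime by (metis coprime_commute prime_imp_coprime)
  then obtain l where "[k * l = 1] (mod p)" using coprime_iff_invertible_nat[of k p] by auto
  then have l: "k * l mod p = 1" using gt2 by (simp add: Cong.cong_def)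
  moreover have "\<not> p dvd l" using l by (metis dvd_mult mod_0_imp_dvd mod_eq_0_iff_dvd one_neq_zero)
  ultimately show thesis using that by blast
qed

lemma poly_roots_of_unity: "(\<Prod>k<p. [:- (\<zeta> ^ k), 1:]) = monom 1 p - 1"
proof -
  define D where "D = (\<Prod>k<p. [:- (\<zeta> ^ k), 1:]) - (monom 1 p - 1)"
  have inj: "inj_on (\<lambda>k. \<zeta> ^ k) {..<p}" by (auto intro!: inj_onI simp: zeta_power_eq_iff)
  have deg: "degree (\<Prod>k<p. [:- (\<zeta> ^ k), 1:]) = p"
    by (subst degree_prod_eq_sum_degree) auto
  have lead: "lead_coeff (\<Prod>k<p. [:- (\<zeta> ^ k), 1:]) = 1" by (subst lead_coeff_prod) auto
  have degD: "degree D < p"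
  proof -
    have "degree D \<le> p" unfolding D_def
      by (intro degree_diff_le) (auto simp: deg degree_monom_le)
    moreover have "coeff D p = 0" using lead deg gt2 by (auto simp: D_def)
    ultimately show ?thesis using gt2
      by (metis degree_0 leading_coeff_0_iff le_neq_implies_less not_less_zero not_gr_zero)
  qed
  have "D = 0"
  proof (rule ccontr)
    assume "D \<noteq> 0"
    have "poly D (\<zeta> ^ k) = 0" if "k < p" for k
    proof -
      have "(\<zeta> ^ k) ^ p = 1" by (metis mult.commute power_mult power_one root)
      moreover have "(\<Prod>j<p. \<zeta> ^ k - \<zeta> ^ j) = 0" using that by (intro prod_zero) auto
      ultimately show ?thesis by (simp add: D_def poly_prod poly_monom)
    qed
    then have "(\<lambda>k. \<zeta> ^ k) ` {..<p} \<subseteq> {x. poly D x = 0}" by auto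
    then have "card ((\<lambda>k. \<zeta> ^ k) ` {..<p}) \<le> card {x. poly D x = 0}"
      using poly_roots_finite[OF \<open>D \<noteq> 0\<close>] by (intro card_mono) auto
    also have "\<dots> \<le> degree D" using card_poly_roots_bound[OF \<open>D \<noteq> 0\<close>] .
    finally show False using card_image[OF inj] degD by simp
  qed
  then show ?thesis by (simp add: D_def)
qed

lemma prod_diff_zeta: "(\<Prod>k<p. x - \<zeta> ^ k * y) = x ^ p - y ^ p"
proof (cases "y = 0")
  case False
  have "(\<Prod>k<p. x - \<zeta> ^ k * y) = (\<Prod>k<p. y * (x / y - \<zeta> ^ k))"
    using False by (intro prod.cong refl) (simp add: right_diff_distrib mult.commute)
  also have "\<dots> = y ^ p * poly (\<Prod>k<p. [:- (\<zeta> ^ k), 1:]) (x / y)"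
    by (simp add: prod.distrib poly_prod)
  also have "\<dots> = x ^ p - y ^ p"
    unfolding poly_roots_of_unity using False
    by (simp add: poly_monom power_divide right_diff_distrib)
  finally show ?thesis .
next
  case True
  have "(0 :: complex) ^ p = 0" using gt2 by (intro zero_power) simp
  then show ?thesis using True by simp
qed

lemma odd_p: "odd p"
  using prime gt2 by (rule prime_odd_nat)

lemma prod_add_zeta: "(\<Prod>k<p. x + \<zeta> ^ k * y) = x ^ p + y ^ p"
proof -
  have "(- y) ^ p = - (y ^ p)" by (rule power_minus_odd[OF odd_p])
  then show ?thesis using prod_diff_zeta[of x "- y"] by (simp only: mult_minus_right diff_minus_eq_add)
qed

lemma sum_zeta_powers: "(\<Sum>k<p. (\<zeta> ^ i) ^ k) = (if p dvd i then of_nat p else 0)"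
proof (cases "p dvd i")
  case True
  then have "\<zeta> ^ i = 1" by (simp add: zeta_power_eq_1_iff)
  then show ?thesis using True by simp
next
  case False
  then have "\<zeta> ^ i \<noteq> 1" by (simp add: zeta_power_eq_1_iff)
  moreover have "(\<zeta> ^ i) ^ p = 1" by (metis mult.commute power_mult power_one root)
  ultimately have "(\<Sum>k<p. (\<zeta> ^ i) ^ k) = 0" by (subst geometric_sum) simp_all
  then show ?thesis using False by simp
qed

text \<open>
  The value at \<open>1\<close> of \<open>1 + X + \<dots>\<close>, of degree \<open>p - 1\<close>, whose roots are the nontrivial \<open>p\<close>-th roots of unity.
\<close>

lemma prod_one_minus_zeta: "(\<Prod>k\<in>{1..<p}. 1 - \<zeta> ^ k) = of_nat p"
proof -
  have S: "{..<p} = insert 0 {1..<p}" using gt2 by auto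
  have "[:-1, 1:] * (\<Prod>k\<in>{1..<p}. [:- (\<zeta> ^ k), 1:]) = (\<Prod>k<p. [:- (\<zeta> ^ k), 1:])"
    unfolding S by simp
  also have "\<dots> = [:-1, 1:] * (\<Sum>i<p. [:0, 1:] ^ i)"
  proof -
    have "monom 1 p - 1 = [:0, 1:] ^ p - (1 :: complex poly)" by (simp add: monom_altdef)
    also have "\<dots> = ([:0, 1:] - 1) * (\<Sum>i<p. [:0, 1:] ^ i)" by (rule power_diff_1_eq)
    also have "[:0, 1:] - 1 = [:-1, 1 :: complex:]" by (simp add: one_pCons)
    finally show ?thesis unfolding poly_roots_of_unity .
  qed
  finally have "[:-1, 1:] * (\<Prod>k\<in>{1..<p}. [:- (\<zeta> ^ k), 1:]) = [:-1, 1:] * (\<Sum>i<p. [:0, 1:] ^ i)" .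
  moreover have "[:-1, 1:] \<noteq> (0 :: complex poly)" by simp
  ultimately have "(\<Prod>k\<in>{1..<p}. [:- (\<zeta> ^ k), 1:]) = (\<Sum>i<p. [:0, 1:] ^ i)"
    using mult_left_cancel by blast
  then have "poly (\<Prod>k\<in>{1..<p}. [:- (\<zeta> ^ k), 1:]) 1 = poly (\<Sum>i<p. [:0, 1:] ^ i) 1" by simp
  then show ?thesis by (simp add: poly_prod poly_sum)
qed

text \<open>
  Geometric sums give one quotient; for the other, \<open>\<zeta>\<close> is itself a power of \<open>\<zeta>\<^sup>k\<close>.
\<close>

lemma zeta_minus_1_associated:
  assumes "\<not> p dvd k"
  obtains u v where "algebraic_int u" "1 - \<zeta> ^ k = (1 - \<zeta>) * u" "algebraic_int v" "1 - \<zeta> = (1 - \<zeta> ^ k) * v"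
proof -
  obtain l where l: "k * l mod p = 1" using mod_inverse[OF assms] .
  have "\<zeta> = \<zeta> ^ (k * l)" using zeta_power_cong[of 1 "k * l"] l gt2 by simp
  then have "1 - \<zeta> = 1 - (\<zeta> ^ k) ^ l" by (simp add: power_mult)
  also have "\<dots> = (1 - \<zeta> ^ k) * (\<Sum>i<l. (\<zeta> ^ k) ^ i)" by (rule one_diff_power_eq)
  finally have v: "1 - \<zeta> = (1 - \<zeta> ^ k) * (\<Sum>i<l. (\<zeta> ^ k) ^ i)" .
  show thesis
    by (rule that[OF _ one_diff_power_eq[of \<zeta> k] _ v])
      (auto intro!: algebraic_int_sum algebraic_int_power)
qed

lemma p_associated:
  obtains u v where "algebraic_int u" "of_nat p = (1 - \<zeta>) ^ (p - 1) * u"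
    "algebraic_int v" "(1 - \<zeta>) ^ (p - 1) = of_nat p * v"
proof -
  have "\<exists>u v. algebraic_int u \<and> 1 - \<zeta> ^ k = (1 - \<zeta>) * u \<and> algebraic_int v \<and> 1 - \<zeta> = (1 - \<zeta> ^ k) * v"
    if "k \<in> {1..<p}" for k
  proof -
    have "\<not> p dvd k" using that by (auto dest: dvd_imp_le)
    then show ?thesis using zeta_minus_1_associated by metis
  qed
  then obtain u v where uv: "\<And>k. k \<in> {1..<p} \<Longrightarrow> algebraic_int (u k) \<and> 1 - \<zeta> ^ k = (1 - \<zeta>) * u k
      \<and> algebraic_int (v k) \<and> 1 - \<zeta> = (1 - \<zeta> ^ k) * v k" by metis
  have "of_nat p = (\<Prod>k\<in>{1..<p}. 1 - \<zeta> ^ k)" by (rule prod_one_minus_zeta[symmetric])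
  also have "\<dots> = (\<Prod>k\<in>{1..<p}. (1 - \<zeta>) * u k)"
    using uv by (intro prod.cong refl) blast
  finally have 1: "of_nat p = (1 - \<zeta>) ^ (p - 1) * (\<Prod>k\<in>{1..<p}. u k)" by (simp add: prod.distrib)
  have "(1 - \<zeta>) ^ (p - 1) = (\<Prod>k\<in>{1..<p}. 1 - \<zeta>)" by simp
  also have "\<dots> = (\<Prod>k\<in>{1..<p}. (1 - \<zeta> ^ k) * v k)"
    using uv by (intro prod.cong refl) blast
  finally have 2: "(1 - \<zeta>) ^ (p - 1) = of_nat p * (\<Prod>k\<in>{1..<p}. v k)"
    by (simp only: prod.distrib prod_one_minus_zeta)
  show thesis by (rule that[OF _ 1 _ 2]) (use uv in \<open>auto intro: algebraic_int_prod\<close>)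
qed

text \<open>
  Raising to the power \<open>p - 1\<close> turns divisibility by \<open>1 - \<zeta>\<close> into divisibility by \<open>p\<close>.
\<close>

lemma p_dvd_if_lambda_dvd:
  assumes "algebraic_int y" "of_int m = (1 - \<zeta>) * y"
  shows "int p dvd m"
proof -
  obtain v where v: "algebraic_int v" "(1 - \<zeta>) ^ (p - 1) = of_nat p * v" using p_associated .
  have "of_int (m ^ (p - 1)) = of_nat p * (v * y ^ (p - 1))"
    using assms(2) v(2) by (simp add: power_mult_distrib)
  then have eq: "complex_of_int (m ^ (p - 1)) / of_nat p = v * y ^ (p - 1)" using gt2 by simp
  have "algebraic_int (complex_of_int (m ^ (p - 1)) / of_nat p)"
    unfolding eq by (intro algebraic_int_mult algebraic_int_power v assms)
  then have "complex_of_int (m ^ (p - 1)) / of_nat p \<in> \<int>"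
    by (intro rational_algebraic_int_is_int) auto
  then obtain n where "complex_of_int (m ^ (p - 1)) / of_nat p = of_int n" by (auto elim: Ints_cases)
  then have "complex_of_int (m ^ (p - 1)) = of_int (n * int p)" using gt2 by (simp add: field_simps)
  then have "m ^ (p - 1) = n * int p" by (simp only: of_int_eq_iff)
  then have "int p dvd m ^ (p - 1)" by simp
  then show ?thesis by (rule prime_dvd_power[rotated]) (use prime in simp)
qed

text \<open>
  Total ramification of \<open>p\<close>. Expand \<open>F(\<zeta>)\<close> in powers of \<open>l = \<zeta> - 1\<close>. If all coefficients below the \<open>i\<close>-th
  are divisible by \<open>p\<close>, and \<open>i < p - 1\<close>, then every term but the \<open>i\<close>-th is divisible by \<open>l\<^bsup>i+1\<^esup>\<close>,
  because \<open>p\<close> is. Hence \<open>l\<close> divides the \<open>i\<close>-th coefficient, and so does \<open>p\<close>.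
\<close>

lemma vanishes_mod_if_p_dvd:
  assumes "algebraic_int y" "ipoly F \<zeta> = of_nat p * y"
  shows "vanishes_mod p (p - 1) F"
proof -
  define f where "f = F \<circ>\<^sub>p [:1, 1:]"
  define l where "l = \<zeta> - 1"
  have l: "algebraic_int l" "l \<noteq> 0"
    using primitive[of 1] gt2 by (auto simp: l_def intro: algebraic_int_diff)
  obtain u where u: "algebraic_int u" "of_nat p = (1 - \<zeta>) ^ (p - 1) * u" using p_associated .
  have "even (p - 1)" using odd_p by simp
  then have u': "of_nat p = l ^ (p - 1) * u"
    unfolding u(2) l_def by (metis minus_diff_eq power_minus_even)
  have fl: "ipoly f l = of_nat p * y" using assms(2) by (simp add: f_def ipoly_pcompose l_def)
  have "int p dvd coeff f i" if "i < p - 1" for i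
    using that
  proof (induction i rule: less_induct)
    case (less i)
    obtain g h where f: "f = smult (int p) g + monom 1 i * h"
      using low_coeffs_dvd_decomp[of i "int p" f] less by force
    obtain h0 h' where h: "h = pCons h0 h'" by (cases h)
    define w where "w = l ^ (p - 2 - i) * u * (y - ipoly g l)"
    have "l ^ i * ipoly h l = l ^ (p - 1) * u * (y - ipoly g l)"
      using fl unfolding f u'[symmetric] by (simp add: algebra_simps)
    also have "l ^ (p - 1) = l ^ i * l * l ^ (p - 2 - i)"
    proof -
      have "p - 1 = i + 1 + (p - 2 - i)" using less.prems by simp
      then show ?thesis by (metis power_add power_one_right)
    qed
    finally have "ipoly h l = l * w" using l(2) by (simp add: w_def mult.assoc)
    then have h0: "of_int h0 = (1 - \<zeta>) * (ipoly h' l - w)"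
      by (simp add: h l_def algebra_simps)
    have "algebraic_int (ipoly h' l - w)"
      unfolding w_def using l u assms
      by (intro algebraic_int_diff algebraic_int_mult algebraic_int_ipoly algebraic_int_power)
    from p_dvd_if_lambda_dvd[OF this h0] have "int p dvd h0" .
    moreover have "coeff f i = int p * coeff g i + h0"
      unfolding f by (simp add: coeff_monom_mult) (simp add: h)
    ultimately show ?case by (metis dvd_add dvd_triv_left)
  qed
  then show ?thesis by (simp add: vanishes_mod_def f_def)
qed

lemma p_dvd_coeffs:
  assumes deg: "degree F < p - 1" and "algebraic_int y" "ipoly F \<zeta> = of_nat p * y"
  shows "int p dvd coeff F i"
proof -
  have "int p dvd coeff (F \<circ>\<^sub>p [:1, 1:]) i" for i
  proof (cases "i < p - 1")
    case True
    then show ?thesis using vanishes_mod_if_p_dvd[OF assms(2,3)] by (simp add: vanishes_mod_def)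
  next
    case False
    then show ?thesis using deg by (simp add: coeff_eq_0)
  qed
  then have "[:int p:] dvd F \<circ>\<^sub>p [:1, 1:]" by (simp add: const_poly_dvd_iff)
  then obtain G where "F \<circ>\<^sub>p [:1, 1:] = [:int p:] * G" ..
  then have "(F \<circ>\<^sub>p [:1, 1:]) \<circ>\<^sub>p [:-1, 1:] = smult (int p) (G \<circ>\<^sub>p [:-1, 1:])"
    by (simp add: pcompose_smult)
  moreover have "(F \<circ>\<^sub>p [:1, 1:]) \<circ>\<^sub>p [:-1, 1:] = F"
    by (simp add: pcompose_assoc[symmetric] pcompose_pCons pcompose_idR)
  ultimately have "F = smult (int p) (G \<circ>\<^sub>p [:-1, 1:])" by simp
  then show ?thesis by (metis coeff_smult dvd_triv_left)
qed

text \<open>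
  Irreducibility of the \<open>p\<close>-th cyclotomic polynomial: the content of a primitive relation would be
  divisible by \<open>p\<close>.
\<close>

lemma ipoly_zeta_eq_0_low_degree:
  assumes deg: "degree F < p - 1" and "ipoly F \<zeta> = 0"
  shows "F = 0"
proof (rule ccontr)
  assume F: "F \<noteq> 0"
  define G where "G = primitive_part F"
  have FG: "F = smult (content F) G" by (simp add: G_def)
  have c: "content F \<noteq> 0" using F by simp
  have "ipoly G \<zeta> = 0"
  proof -
    have "ipoly F \<zeta> = of_int (content F) * ipoly G \<zeta>" by (subst FG) (simp only: ipoly_smult)
    then show ?thesis using assms(2) c by simp
  qed
  moreover have "degree G < p - 1" using deg by (simp add: G_def)
  ultimately have "int p dvd coeff G i" for i
    using p_dvd_coeffs[of G 0 i] by simp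
  then have "int p dvd content G" by (simp add: const_poly_dvd_iff flip: const_poly_dvd_iff_dvd_content)
  moreover have "content G = 1" using F by (simp add: G_def content_primitive_part)
  ultimately show False using gt2 by simp
qed

definition cyc_poly :: "int poly" where "cyc_poly = (\<Sum>i<p. monom 1 i)"

lemma coeff_cyc_poly: "coeff cyc_poly i = (if i < p then 1 else 0)"
  by (simp add: cyc_poly_def coeff_sum)

lemma degree_cyc_poly: "degree cyc_poly = p - 1"
proof (rule antisym)
  show "degree cyc_poly \<le> p - 1" by (rule degree_le) (auto simp: coeff_cyc_poly)
  show "p - 1 \<le> degree cyc_poly" using gt2 by (intro le_degree) (auto simp: coeff_cyc_poly)
qed

lemma ipoly_cyc_poly: "\<not> p dvd k \<Longrightarrow> ipoly cyc_poly (\<zeta> ^ k) = 0"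
  using sum_zeta_powers[of k] by (simp add: cyc_poly_def)

lemma cyc_poly_reduce:
  obtains Q R where "F = cyc_poly * Q + R" "degree R < p - 1"
proof -
  obtain Q R where QR: "pseudo_divmod F cyc_poly = (Q, R)" by fastforce
  have ne: "cyc_poly \<noteq> 0" using degree_cyc_poly gt2 by auto
  have "coeff cyc_poly (p - 1) = 1" using gt2 by (simp add: coeff_cyc_poly)
  then have "F = cyc_poly * Q + R" "R = 0 \<or> degree R < degree cyc_poly"
    using pseudo_divmod[OF ne QR] by (simp_all add: degree_cyc_poly)
  then show thesis using that degree_cyc_poly gt2 by force
qed

text \<open>
  This makes the conjugation \<open>\<zeta> \<mapsto> \<zeta>\<^sup>k\<close> well defined on polynomial expressions in \<open>\<zeta>\<close>.
\<close>

lemma ipoly_conjugate: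
  assumes "ipoly F \<zeta> = 0" "\<not> p dvd k"
  shows "ipoly F (\<zeta> ^ k) = 0"
proof -
  obtain Q R where F: "F = cyc_poly * Q + R" "degree R < p - 1" using cyc_poly_reduce .
  have "\<not> p dvd 1" using gt2 by simp
  then have "ipoly R \<zeta> = 0" using assms(1) F(1) ipoly_cyc_poly[of 1] by simp
  then have "R = 0" using ipoly_zeta_eq_0_low_degree F(2) by blast
  then show ?thesis using F(1) ipoly_cyc_poly[OF assms(2)] by simp
qed

end

section \<open>The Galois action and the ring of integers\<close>

context cyclotomic begin

definition K :: "complex set" where
  "K = {ipoly F \<zeta> / of_int n | F n. n \<noteq> 0}"

definition sig :: "nat \<Rightarrow> complex \<Rightarrow> complex" where
  "sig k x = (SOME y. \<exists>F n. n \<noteq> 0 \<and> x = ipoly F \<zeta> / of_int n \<and> y = ipoly F (\<zeta> ^ k) / of_int n)"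

lemma K_E:
  assumes "x \<in> K" obtains F n where "n \<noteq> 0" "x = ipoly F \<zeta> / of_int n"
  using assms unfolding K_def by blast

lemma K_I: "n \<noteq> 0 \<Longrightarrow> ipoly F \<zeta> / of_int n \<in> K" unfolding K_def by blast

lemma sig_eq:
  assumes n: "n \<noteq> 0" and k: "\<not> p dvd k"
  shows "sig k (ipoly F \<zeta> / of_int n) = ipoly F (\<zeta> ^ k) / of_int n"
  unfolding sig_def
proof (rule some_equality)
  show "\<exists>F' n'. n' \<noteq> 0 \<and> ipoly F \<zeta> / complex_of_int n = ipoly F' \<zeta> / of_int n'
    \<and> ipoly F (\<zeta> ^ k) / complex_of_int n = ipoly F' (\<zeta> ^ k) / of_int n'"
    using n by blast
next
  fix y assume "\<exists>F' n'. n' \<noteq> 0 \<and> ipoly F \<zeta> / complex_of_int n = ipoly F' \<zeta> / of_int n'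
    \<and> y = ipoly F' (\<zeta> ^ k) / of_int n'"
  then obtain F' n' where *: "n' \<noteq> 0" "ipoly F \<zeta> / complex_of_int n = ipoly F' \<zeta> / of_int n'"
    "y = ipoly F' (\<zeta> ^ k) / of_int n'" by blast
  have "ipoly (smult n' F - smult n F') \<zeta> = 0" using * n by (simp add: field_simps)
  then have "ipoly (smult n' F - smult n F') (\<zeta> ^ k) = 0" using k by (rule ipoly_conjugate)
  then show "y = ipoly F (\<zeta> ^ k) / of_int n"
    unfolding *(3) using *(1) n by (simp add: frac_eq_eq mult.commute)
qed

lemma sig_ipoly: "\<not> p dvd k \<Longrightarrow> sig k (ipoly F \<zeta>) = ipoly F (\<zeta> ^ k)"
  using sig_eq[of 1 k F] by simp

lemma K_ipoly [simp]: "ipoly F \<zeta> \<in> K" using K_I[of 1 F] by simp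
lemma K_of_int [simp]: "of_int n \<in> K" using K_ipoly[of "[:n:]"] by simp
lemma K_of_nat [simp]: "of_nat n \<in> K" using K_of_int[of "int n"] by simp
lemma K_0 [simp]: "0 \<in> K" and K_1 [simp]: "1 \<in> K" using K_of_int[of 0] K_of_int[of 1] by auto
lemma K_zeta [simp]: "\<zeta> \<in> K" using K_ipoly[of "[:0,1:]"] by simp

lemma sig_of_int [simp]: "\<not> p dvd k \<Longrightarrow> sig k (of_int n) = of_int n"
  using sig_ipoly[of k "[:n:]"] by simp
lemma sig_of_nat [simp]: "\<not> p dvd k \<Longrightarrow> sig k (of_nat n) = of_nat n"
  using sig_of_int[of k "int n"] by simp
lemma sig_0 [simp]: "\<not> p dvd k \<Longrightarrow> sig k 0 = 0" and sig_1 [simp]: "\<not> p dvd k \<Longrightarrow> sig k 1 = 1"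
  using sig_of_int[of k 0] sig_of_int[of k 1] by auto
lemma sig_zeta [simp]: "\<not> p dvd k \<Longrightarrow> sig k \<zeta> = \<zeta> ^ k"
  using sig_ipoly[of k "[:0,1:]"] by simp

lemma
  assumes x: "x \<in> K" and y: "y \<in> K"
  shows K_add [simp]: "x + y \<in> K" and K_mult [simp]: "x * y \<in> K"
    and sig_add: "\<not> p dvd k \<Longrightarrow> sig k (x + y) = sig k x + sig k y"
    and sig_mult: "\<not> p dvd k \<Longrightarrow> sig k (x * y) = sig k x * sig k y"
proof -
  obtain F n where F: "n \<noteq> 0" "x = ipoly F \<zeta> / of_int n" using x by (rule K_E)
  obtain G m where G: "m \<noteq> 0" "y = ipoly G \<zeta> / of_int m" using y by (rule K_E)
  have a: "x + y = ipoly (smult m F + smult n G) \<zeta> / of_int (n * m)" using F G by (simp add: field_simps)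
  have b: "x * y = ipoly (F * G) \<zeta> / of_int (n * m)" unfolding F(2) G(2) by simp
  have nm: "n * m \<noteq> 0" using F G by simp
  show "x + y \<in> K" unfolding a by (rule K_I[OF nm])
  show "x * y \<in> K" unfolding b by (rule K_I[OF nm])
  assume k: "\<not> p dvd k"
  show "sig k (x + y) = sig k x + sig k y"
    unfolding a sig_eq[OF nm k] unfolding F(2) G(2) sig_eq[OF F(1) k] sig_eq[OF G(1) k]
    using F(1) G(1) by (simp add: add_frac_eq mult.commute)
  show "sig k (x * y) = sig k x * sig k y"
    unfolding b sig_eq[OF nm k] unfolding F(2) G(2) sig_eq[OF F(1) k] sig_eq[OF G(1) k]
    by simp
qed

lemma K_uminus [simp]: "x \<in> K \<Longrightarrow> - x \<in> K" using K_mult[of "-1" x] K_of_int[of "-1"] by simp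
lemma K_diff [simp]: "x \<in> K \<Longrightarrow> y \<in> K \<Longrightarrow> x - y \<in> K" using K_add[of x "- y"] by simp
lemma K_power [simp]: "x \<in> K \<Longrightarrow> x ^ n \<in> K" by (induction n) auto
lemma K_sum: "(\<And>i. i \<in> I \<Longrightarrow> f i \<in> K) \<Longrightarrow> (\<Sum>i\<in>I. f i) \<in> K"
  by (induction I rule: infinite_finite_induct) auto
lemma K_prod: "(\<And>i. i \<in> I \<Longrightarrow> f i \<in> K) \<Longrightarrow> (\<Prod>i\<in>I. f i) \<in> K"
  by (induction I rule: infinite_finite_induct) auto
lemma K_Rats: "x \<in> \<rat> \<Longrightarrow> x \<in> K"
proof -
  assume "x \<in> \<rat>"
  then obtain a b :: int where "b > 0" "x = of_int a / of_int b" by (rule Rats_cases')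
  then show "x \<in> K" using K_I[of b "[:a:]"] by simp
qed

lemma sig_power: "\<not> p dvd k \<Longrightarrow> x \<in> K \<Longrightarrow> sig k (x ^ n) = sig k x ^ n"
  by (induction n) (auto simp: sig_mult)
lemma sig_sum: "\<not> p dvd k \<Longrightarrow> (\<And>i. i \<in> I \<Longrightarrow> f i \<in> K) \<Longrightarrow> sig k (\<Sum>i\<in>I. f i) = (\<Sum>i\<in>I. sig k (f i))"
  by (induction I rule: infinite_finite_induct) (auto simp: sig_add K_sum)
lemma sig_prod: "\<not> p dvd k \<Longrightarrow> (\<And>i. i \<in> I \<Longrightarrow> f i \<in> K) \<Longrightarrow> sig k (\<Prod>i\<in>I. f i) = (\<Prod>i\<in>I. sig k (f i))"
  by (induction I rule: infinite_finite_induct) (auto simp: sig_mult K_prod)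
lemma sig_Rats: "\<not> p dvd k \<Longrightarrow> x \<in> \<rat> \<Longrightarrow> sig k x = x"
proof -
  assume k: "\<not> p dvd k" and "x \<in> \<rat>"
  then obtain a b :: int where "b > 0" "x = of_int a / of_int b" by (auto elim: Rats_cases')
  then show "sig k x = x" using sig_eq[of b k "[:a:]"] k by simp
qed

lemma ipoly_zeta_power: "ipoly F (\<zeta> ^ l) = ipoly (F \<circ>\<^sub>p monom 1 l) \<zeta>"
  by (simp add: ipoly_pcompose)

lemma sig_in_K [simp]: "\<not> p dvd k \<Longrightarrow> x \<in> K \<Longrightarrow> sig k x \<in> K"
  by (elim K_E) (simp add: sig_eq ipoly_zeta_power K_I)

lemma not_dvd_mult: "\<not> p dvd k \<Longrightarrow> \<not> p dvd l \<Longrightarrow> \<not> p dvd k * l"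
  using prime by (simp add: prime_dvd_mult_iff)

lemma sig_sig: "\<not> p dvd k \<Longrightarrow> \<not> p dvd l \<Longrightarrow> x \<in> K \<Longrightarrow> sig k (sig l x) = sig (k * l) x"
proof -
  assume k: "\<not> p dvd k" and l: "\<not> p dvd l" and "x \<in> K"
  then obtain F n where F: "n \<noteq> 0" "x = ipoly F \<zeta> / of_int n" by (elim K_E)
  have "sig k (sig l x) = ipoly (F \<circ>\<^sub>p monom 1 l) (\<zeta> ^ k) / of_int n"
    using F k l by (simp add: sig_eq ipoly_zeta_power[of F l])
  also have "\<dots> = ipoly F (\<zeta> ^ (k * l)) / of_int n" by (simp add: ipoly_pcompose power_mult)
  also have "\<dots> = sig (k * l) x" using F sig_eq[OF F(1) not_dvd_mult[OF k l]] by simp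
  finally show ?thesis .
qed

lemma sig_cong: "\<not> p dvd k \<Longrightarrow> k mod p = l mod p \<Longrightarrow> x \<in> K \<Longrightarrow> sig k x = sig l x"
proof -
  assume k: "\<not> p dvd k" and kl: "k mod p = l mod p" and "x \<in> K"
  then obtain F n where F: "n \<noteq> 0" "x = ipoly F \<zeta> / of_int n" by (elim K_E)
  have l: "\<not> p dvd l" using k kl by (simp add: dvd_eq_mod_eq_0)
  show ?thesis unfolding F(2) sig_eq[OF F(1) k] sig_eq[OF F(1) l] zeta_power_cong[OF kl] ..
qed

lemma not_dvd_1: "\<not> p dvd 1" using gt2 by simp

lemma not_dvd_range: "k \<in> {1..<p} \<Longrightarrow> \<not> p dvd k"
  by (auto dest: dvd_imp_le)

lemma sig_id: "x \<in> K \<Longrightarrow> sig 1 x = x"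
  using not_dvd_1 by (elim K_E) (simp add: sig_eq del: One_nat_def)

lemma sig_inverse_exists:
  assumes "\<not> p dvd k"
  obtains l where "\<not> p dvd l" "\<And>x. x \<in> K \<Longrightarrow> sig l (sig k x) = x" "\<And>x. x \<in> K \<Longrightarrow> sig k (sig l x) = x"
    "k * l mod p = 1"
proof -
  obtain l where l: "k * l mod p = 1" "\<not> p dvd l" using mod_inverse[OF assms] .
  have eq: "k * l mod p = 1 mod p" using l gt2 by simp
  have "sig l (sig k x) = x \<and> sig k (sig l x) = x" if "x \<in> K" for x
    using sig_sig[OF assms l(2) that] sig_sig[OF l(2) assms that] that
      sig_cong[OF not_dvd_mult[OF assms l(2)] eq that] sig_id[OF that] by (simp add: mult.commute)
  then show thesis using that l by blast
qed

lemma sig_eq_0_iff: "\<not> p dvd k \<Longrightarrow> x \<in> K \<Longrightarrow> sig k x = 0 \<longleftrightarrow> x = 0"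
  by (metis sig_inverse_exists sig_0)

lemma bij_mult_mod:
  assumes "\<not> p dvd l"
  shows "bij_betw (\<lambda>k. l * k mod p) {1..<p} {1..<p}"
proof -
  have into: "(\<lambda>k. l * k mod p) ` {1..<p} \<subseteq> {1..<p}"
  proof
    fix y assume "y \<in> (\<lambda>k. l * k mod p) ` {1..<p}"
    then obtain k where k: "k \<in> {1..<p}" "y = l * k mod p" by auto
    then have "\<not> p dvd l * k" using not_dvd_mult[OF assms not_dvd_range] by blast
    then have "y \<noteq> 0" using k by (simp add: dvd_eq_mod_eq_0)
    then show "y \<in> {1..<p}" using k gt2 by simp
  qed
  have inj: "inj_on (\<lambda>k. l * k mod p) {1..<p}"
  proof (rule inj_onI)
    fix j k assume jk: "j \<in> {1..<p}" "k \<in> {1..<p}" "l * j mod p = l * k mod p"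
    have "coprime l p" using assms prime by (metis coprime_commute prime_imp_coprime)
    then have "[j = k] (mod p)" using jk(3) cong_mult_lcancel_nat[of l p j k] by (simp add: Cong.cong_def)
    then show "j = k" using jk by (simp add: Cong.cong_def)
  qed
  show ?thesis using inj endo_inj_surj[OF _ into inj] by (intro bij_betw_imageI) simp_all
qed

definition norm_K :: "complex \<Rightarrow> complex" where "norm_K x = (\<Prod>k\<in>{1..<p}. sig k x)"
definition trace_K :: "complex \<Rightarrow> complex" where "trace_K x = (\<Sum>k\<in>{1..<p}. sig k x)"

lemma sig_sig_mod: "\<not> p dvd l \<Longrightarrow> k \<in> {1..<p} \<Longrightarrow> x \<in> K \<Longrightarrow> sig l (sig k x) = sig (l * k mod p) x"
  using sig_sig[of l k x] sig_cong[of "l * k" "l * k mod p" x] not_dvd_mult[of l k] not_dvd_range[of k]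
  by simp

lemma sig_norm: "\<not> p dvd l \<Longrightarrow> x \<in> K \<Longrightarrow> sig l (norm_K x) = norm_K x"
proof -
  assume l: "\<not> p dvd l" and x: "x \<in> K"
  have "sig l (\<Prod>k\<in>{1..<p}. sig k x) = (\<Prod>k\<in>{1..<p}. sig l (sig k x))"
    by (intro sig_prod l sig_in_K not_dvd_range x)
  also have "\<dots> = (\<Prod>k\<in>{1..<p}. sig (l * k mod p) x)" by (intro prod.cong refl sig_sig_mod l x)
  also have "\<dots> = (\<Prod>k\<in>{1..<p}. sig k x)" by (rule prod.reindex_bij_betw[OF bij_mult_mod[OF l]])
  finally show ?thesis unfolding norm_K_def .
qed

lemma norm_in_K: "x \<in> K \<Longrightarrow> norm_K x \<in> K"
  unfolding norm_K_def by (intro K_prod) (simp add: not_dvd_range)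
lemma sum_zeta_powers_pos:
  "(\<Sum>k\<in>{1..<p}. (\<zeta> ^ k) ^ i) = of_int (if p dvd i then int p - 1 else -1)"
proof -
  have S: "{..<p} = insert 0 {1..<p}" using gt2 by auto
  have "1 + (\<Sum>k\<in>{1..<p}. (\<zeta> ^ i) ^ k) = (if p dvd i then of_nat p else 0)"
    using sum_zeta_powers[of i] unfolding S by simp
  then have "(\<Sum>k\<in>{1..<p}. (\<zeta> ^ i) ^ k) = of_int (if p dvd i then int p - 1 else -1)"
    by (auto simp: algebra_simps add_eq_0_iff split: if_splits)
  moreover have "(\<zeta> ^ k) ^ i = (\<zeta> ^ i) ^ k" for k by (simp add: power_mult[symmetric] mult.commute)
  ultimately show ?thesis by simp
qed

lemma trace_ipoly:
  assumes "n \<noteq> 0"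
  shows "trace_K (ipoly F \<zeta> / of_int n) =
    of_int (\<Sum>i\<le>degree F. coeff F i * (if p dvd i then int p - 1 else -1)) / of_int n"
proof -
  have "trace_K (ipoly F \<zeta> / of_int n) = (\<Sum>k\<in>{1..<p}. ipoly F (\<zeta> ^ k)) / of_int n"
    unfolding trace_K_def sum_divide_distrib
    using assms by (intro sum.cong refl sig_eq not_dvd_range)
  also have "(\<Sum>k\<in>{1..<p}. ipoly F (\<zeta> ^ k))
    = (\<Sum>i\<le>degree F. \<Sum>k\<in>{1..<p}. of_int (coeff F i) * (\<zeta> ^ k) ^ i)"
    unfolding ipoly_altdef by (rule sum.swap)
  also have "\<dots> = (\<Sum>i\<le>degree F. of_int (coeff F i) * of_int (if p dvd i then int p - 1 else -1))"
    unfolding sum_distrib_left[symmetric] sum_zeta_powers_pos ..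
  finally show ?thesis by simp
qed

lemma trace_Rats: "x \<in> K \<Longrightarrow> trace_K x \<in> \<rat>"
proof -
  assume "x \<in> K"
  then obtain F n where F: "n \<noteq> 0" "x = ipoly F \<zeta> / of_int n" by (rule K_E)
  show ?thesis unfolding F(2) trace_ipoly[OF F(1)] by (intro Rats_divide Rats_of_int)
qed

text \<open>
  Such an element is its trace divided by \<open>p - 1\<close>, and traces of powers of \<open>\<zeta>\<close> are integers.
\<close>

lemma fixed_Rats:
  assumes x: "x \<in> K" and fix1: "\<And>l. l \<in> {1..<p} \<Longrightarrow> sig l x = x"
  shows "x \<in> \<rat>"
proof -
  have "trace_K x = of_nat (p - 1) * x" unfolding trace_K_def using fix1 by simp
  then have "x = trace_K x / of_nat (p - 1)" using gt2 by simp
  then show ?thesis using trace_Rats[OF x] by (metis Rats_divide Rats_of_nat)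
qed

lemma norm_Rats: "x \<in> K \<Longrightarrow> norm_K x \<in> \<rat>"
  by (intro fixed_Rats norm_in_K sig_norm not_dvd_range)

lemma norm_eq_0_iff: "x \<in> K \<Longrightarrow> norm_K x = 0 \<longleftrightarrow> x = 0"
  unfolding norm_K_def using gt2 by (auto simp: sig_eq_0_iff not_dvd_range)

lemma norm_factor: "x \<in> K \<Longrightarrow> norm_K x = x * (\<Prod>k\<in>{2..<p}. sig k x)"
proof -
  assume x: "x \<in> K"
  have S: "{1..<p} = insert 1 {2..<p}" using gt2 by auto
  show ?thesis unfolding norm_K_def S using sig_id[OF x] by simp
qed

lemma K_inverse [simp]: "x \<in> K \<Longrightarrow> inverse x \<in> K"
proof (cases "x = 0")
  case False
  assume x: "x \<in> K"
  have "inverse x = (\<Prod>k\<in>{2..<p}. sig k x) * inverse (norm_K x)"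
    using False norm_eq_0_iff[OF x] norm_factor[OF x] by (simp add: field_simps)
  moreover have "inverse (norm_K x) \<in> K" using norm_Rats[OF x] by (intro K_Rats) simp
  moreover have "(\<Prod>k\<in>{2..<p}. sig k x) \<in> K" using x by (intro K_prod) (simp add: not_dvd_range)
  ultimately show ?thesis by simp
qed simp

lemma K_divide [simp]: "x \<in> K \<Longrightarrow> y \<in> K \<Longrightarrow> x / y \<in> K" by (simp add: divide_inverse)

lemma sig_inverse: "\<not> p dvd k \<Longrightarrow> x \<in> K \<Longrightarrow> sig k (inverse x) = inverse (sig k x)"
proof (cases "x = 0")
  case False
  assume k: "\<not> p dvd k" and x: "x \<in> K"
  have "sig k x * sig k (inverse x) = 1" using sig_mult[of x "inverse x" k] x k False by simp
  then show ?thesis by (simp add: inverse_unique)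
qed simp

definition \<O> :: "complex set" where "\<O> = {x \<in> K. algebraic_int x}"

lemma O_K: "x \<in> \<O> \<Longrightarrow> x \<in> K" and O_int: "x \<in> \<O> \<Longrightarrow> algebraic_int x" by (auto simp: \<O>_def)
lemma O_ipoly [simp]: "ipoly F \<zeta> \<in> \<O>" by (auto simp: \<O>_def intro: algebraic_int_ipoly)
lemma O_add [simp]: "x \<in> \<O> \<Longrightarrow> y \<in> \<O> \<Longrightarrow> x + y \<in> \<O>" by (auto simp: \<O>_def intro: algebraic_int_add)
lemma O_mult [simp]: "x \<in> \<O> \<Longrightarrow> y \<in> \<O> \<Longrightarrow> x * y \<in> \<O>" by (auto simp: \<O>_def intro: algebraic_int_mult)
lemma O_uminus [simp]: "x \<in> \<O> \<Longrightarrow> - x \<in> \<O>" by (auto simp: \<O>_def)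
lemma O_diff [simp]: "x \<in> \<O> \<Longrightarrow> y \<in> \<O> \<Longrightarrow> x - y \<in> \<O>" using O_add[of x "- y"] by simp
lemma O_of_int [simp]: "of_int n \<in> \<O>" by (auto simp: \<O>_def)
lemma O_of_nat [simp]: "of_nat n \<in> \<O>" by (auto simp: \<O>_def)
lemma O_0 [simp]: "0 \<in> \<O>" and O_1 [simp]: "1 \<in> \<O>" and O_zeta [simp]: "\<zeta> \<in> \<O>"
  by (auto simp: \<O>_def)
lemma O_power [simp]: "x \<in> \<O> \<Longrightarrow> x ^ n \<in> \<O>" by (induction n) auto
lemma O_sum: "(\<And>i. i \<in> I \<Longrightarrow> f i \<in> \<O>) \<Longrightarrow> (\<Sum>i\<in>I. f i) \<in> \<O>"
  by (induction I rule: infinite_finite_induct) auto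
lemma O_prod: "(\<And>i. i \<in> I \<Longrightarrow> f i \<in> \<O>) \<Longrightarrow> (\<Prod>i\<in>I. f i) \<in> \<O>"
  by (induction I rule: infinite_finite_induct) auto

text \<open>
  Conjugates satisfy the same integral equations; this is what carries integrality over.
\<close>

lemma sig_ipoly_arg:
  assumes k: "\<not> p dvd k" and x: "x \<in> K"
  shows "sig k (ipoly F x) = ipoly F (sig k x)"
proof (induction F)
  case (pCons a F)
  have "ipoly F x \<in> K" unfolding ipoly_altdef using x by (intro K_sum) simp
  then show ?case using pCons k x by (simp add: sig_add sig_mult)
qed (use k in simp)

lemma sig_O [simp]: "\<not> p dvd k \<Longrightarrow> x \<in> \<O> \<Longrightarrow> sig k x \<in> \<O>"
proof -
  assume k: "\<not> p dvd k" and x: "x \<in> \<O>"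
  obtain F where F: "poly (map_poly of_int F) x = 0" "lead_coeff F = 1"
    using O_int[OF x] by (auto simp: algebraic_int_altdef_ipoly)
  have "ipoly F (sig k x) = 0"
    using sig_ipoly_arg[OF k O_K[OF x], of F] F k by (simp add: ipoly_def)
  then have "algebraic_int (sig k x)" using F(2) by (auto simp: algebraic_int_altdef_ipoly ipoly_def)
  then show ?thesis using k x by (simp add: \<O>_def)
qed

lemma O_Rats_Ints: "x \<in> \<O> \<Longrightarrow> x \<in> \<rat> \<Longrightarrow> x \<in> \<int>"
  by (intro rational_algebraic_int_is_int O_int)

lemma norm_O_int: "x \<in> \<O> \<Longrightarrow> norm_K x \<in> \<int>"
  by (intro O_Rats_Ints norm_Rats O_K) (auto simp: norm_K_def not_dvd_range intro!: O_prod)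
lemma trace_O_int: "x \<in> \<O> \<Longrightarrow> trace_K x \<in> \<int>"
  by (intro O_Rats_Ints trace_Rats O_K) (auto simp: trace_K_def not_dvd_range intro!: O_sum)

lemma ipoly_low_degree_rep:
  obtains G where "ipoly F \<zeta> = ipoly G \<zeta>" "degree G < p - 1"
proof -
  obtain Q R where QR: "F = cyc_poly * Q + R" "degree R < p - 1" using cyc_poly_reduce .
  then have "ipoly F \<zeta> = ipoly R \<zeta>" using ipoly_cyc_poly[OF not_dvd_1] by simp
  then show thesis using that QR by blast
qed

text \<open>
  The ring of integers is \<open>\<int>[\<zeta>]\<close>. For \<open>x = \<Sum>i<p-1. x\<^sub>i \<zeta>\<^sup>i\<close> the difference of the traces of \<open>x \<zeta>\<^bsup>-i\<^esup>\<close>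
  and of \<open>x \<zeta>\<close> is \<open>p x\<^sub>i\<close>, so all \<open>p x\<^sub>i\<close> are integers; as \<open>p x\<close> is divisible by \<open>p\<close>, total
  ramification makes them multiples of \<open>p\<close>.
\<close>

lemma O_eq: "\<O> = range (\<lambda>F. ipoly F \<zeta>)"
proof
  show "\<O> \<subseteq> range (\<lambda>F. ipoly F \<zeta>)"
  proof
    fix x assume x: "x \<in> \<O>"
    then obtain F0 n where F0: "n \<noteq> 0" "x = ipoly F0 \<zeta> / of_int n" by (auto dest!: O_K elim: K_E)
    obtain F where F: "ipoly F0 \<zeta> = ipoly F \<zeta>" "degree F < p - 1" using ipoly_low_degree_rep .
    have xF: "x = ipoly F \<zeta> / of_int n" using F0 F by simp
    define f where "f = coeff F"
    have tr: "of_int n * trace_K (x * \<zeta> ^ m) = of_int (\<Sum>j<p-1. f j * (if p dvd j + m then int p - 1 else -1))" for m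
    proof -
      have e1: "x * \<zeta> ^ m = ipoly (F * monom 1 m) \<zeta> / of_int n" by (simp add: xF)
      have e2: "F * monom 1 m = monom 1 m * F" by (simp add: mult.commute)
      have "of_int n * trace_K (x * \<zeta> ^ m) = of_int (\<Sum>i\<le>degree (monom 1 m * F).
          coeff (monom 1 m * F) i * (if p dvd i then int p - 1 else -1))"
        unfolding e1 trace_ipoly[OF F0(1)] using F0(1) by (simp add: e2)
      also have "(\<Sum>i\<le>degree (monom 1 m * F).
          coeff (monom 1 m * F) i * (if p dvd i then int p - 1 else -1))
        = (\<Sum>i\<in>{m..<m + (p-1)}. f (i - m) * (if p dvd i then int p - 1 else -1))"
      proof (rule sum.mono_neutral_cong)
        show "coeff (monom 1 m * F) i * (if p dvd i then int p - 1 else -1) = 0"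
          if "i \<in> {..degree (monom 1 m * F)} - {m..<m + (p - 1)}" for i
          using that F(2) by (auto simp: coeff_monom_mult coeff_eq_0)
        show "f (i - m) * (if p dvd i then int p - 1 else -1) = 0"
          if "i \<in> {m..<m + (p - 1)} - {..degree (monom 1 m * F)}" for i
        proof -
          have "coeff (monom 1 m * F) i = 0" using that by (intro coeff_eq_0) auto
          then show ?thesis using that by (simp add: coeff_monom_mult f_def)
        qed
      qed (auto simp: coeff_monom_mult f_def)
      also have "\<dots> = (\<Sum>j<p-1. f j * (if p dvd j + m then int p - 1 else -1))"
        using sum.shift_bounds_nat_ivl[of "\<lambda>i. f (i - m) * (if p dvd i then int p - 1 else -1)" 0 m "p - 1"]
        by (simp add: lessThan_atLeast0 add.commute)
      finally show ?thesis .
    qed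
    have "n dvd int p * f i" for i
    proof (cases "i < p - 1")
      case True
      have "trace_K (x * \<zeta> ^ m) \<in> \<int>" for m using x by (intro trace_O_int) simp
      then have "trace_K (x * \<zeta> ^ (p - i)) - trace_K (x * \<zeta> ^ 1) \<in> \<int>" by (intro Ints_diff)
      then obtain c where "trace_K (x * \<zeta> ^ (p - i)) - trace_K (x * \<zeta> ^ 1) = of_int c" by (auto elim: Ints_cases)
      then have "of_int n * trace_K (x * \<zeta> ^ (p - i)) - of_int n * trace_K (x * \<zeta> ^ 1) = of_int (n * c)"
        by (simp add: right_diff_distrib[symmetric])
      then have "(\<Sum>j<p-1. f j * (if p dvd j + (p - i) then int p - 1 else -1))
          - (\<Sum>j<p-1. f j * (if p dvd j + 1 then int p - 1 else -1)) = n * c"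
        unfolding tr of_int_diff[symmetric] of_int_eq_iff .
      moreover have "(\<Sum>j<p-1. f j * (if p dvd j + (p - i) then int p - 1 else -1))
          - (\<Sum>j<p-1. f j * (if p dvd j + 1 then int p - 1 else -1))
        = (\<Sum>j<p-1. if j = i then int p * f j else 0)"
        unfolding sum_subtractf[symmetric]
      proof (intro sum.cong refl)
        fix j assume j: "j \<in> {..<p-1}"
        have a: "\<not> p dvd j + 1" using j by (auto dest: dvd_imp_le)
        \<comment> \<open>The exponent lies strictly between \<open>0\<close> and \<open>2 p\<close>.\<close>
        have b: "p dvd j + (p - i) \<longleftrightarrow> j = i"
        proof
          assume "p dvd j + (p - i)"
          then obtain q where q: "j + (p - i) = p * q" ..
          have "0 < j + (p - i)" "j + (p - i) < p * 2" using j True by auto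
          then have "0 < q" "q < 2" unfolding q using gt2 by auto
          then have "q = 1" by simp
          then show "j = i" using q True by simp
        qed (use True in auto)
        show "f j * (if p dvd j + (p - i) then int p - 1 else -1) - f j * (if p dvd j + 1 then int p - 1 else -1)
          = (if j = i then int p * f j else 0)"
          using a b by (auto simp: algebra_simps)
      qed
      moreover have "(\<Sum>j<p-1. if j = i then int p * f j else 0) = int p * f i" using True by simp
      ultimately show ?thesis by (metis dvd_triv_left)
    next
      case False
      then have "f i = 0" using F(2) by (simp add: f_def coeff_eq_0)
      then show ?thesis by simp
    qed
    then have "[:n:] dvd smult (int p) F" by (simp add: const_poly_dvd_iff f_def)
    then obtain G where "smult (int p) F = [:n:] * G" ..
    then have G: "smult (int p) F = smult n G" by simp
    have "of_int n * ipoly G \<zeta> = of_int n * (of_nat p * x)"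
      using arg_cong[OF G, of "\<lambda>q. ipoly q \<zeta>"] F0(1) by (simp add: xF)
    then have "ipoly G \<zeta> = of_nat p * x" using F0(1) by simp
    moreover have "degree G < p - 1"
    proof -
      have "degree G = degree (smult n G)" using F0(1) by simp
      also have "\<dots> = degree F" unfolding G[symmetric] using gt2 by simp
      finally show ?thesis using F(2) by simp
    qed
    ultimately have "int p dvd coeff G i" for i using p_dvd_coeffs O_int[OF x] by blast
    then have "[:int p:] dvd G" by (simp add: const_poly_dvd_iff)
    then obtain H where "G = [:int p:] * H" ..
    then have "of_nat p * ipoly H \<zeta> = of_nat p * x" using \<open>ipoly G \<zeta> = of_nat p * x\<close> by simp
    then have "x = ipoly H \<zeta>" using gt2 by simp
    then show "x \<in> range (\<lambda>F. ipoly F \<zeta>)" by blast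
  qed
qed auto

lemma O_E:
  assumes "x \<in> \<O>" obtains F where "x = ipoly F \<zeta>" "degree F < p - 1"
proof -
  obtain F0 where "x = ipoly F0 \<zeta>" using assms O_eq by auto
  moreover obtain F where "ipoly F0 \<zeta> = ipoly F \<zeta>" "degree F < p - 1" using ipoly_low_degree_rep .
  ultimately show thesis using that by simp
qed

end

section \<open>Units and p-th powers\<close>

lemma sum_squares_eq_1:
  fixes d :: "'a \<Rightarrow> int"
  assumes "finite I" "(\<Sum>i\<in>I. (d i)\<^sup>2) = 1"
  obtains t where "t \<in> I" "d t = 1 \<or> d t = -1" "\<And>i. i \<in> I \<Longrightarrow> i \<noteq> t \<Longrightarrow> d i = 0"
proof -
  obtain t where t: "t \<in> I" "d t \<noteq> 0"
  proof (rule ccontr)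
    assume "\<not> thesis"
    then have "(\<Sum>i\<in>I. (d i)\<^sup>2) = 0" using that by (intro sum.neutral) auto
    then show False using assms(2) by simp
  qed
  have eq: "(d t)\<^sup>2 + (\<Sum>i\<in>I - {t}. (d i)\<^sup>2) = 1"
    using sum.remove[OF assms(1) t(1), of "\<lambda>i. (d i)\<^sup>2"] assms(2) by simp
  have ge: "(\<Sum>i\<in>I - {t}. (d i)\<^sup>2) \<ge> 0" by (intro sum_nonneg) simp
  have "(d t)\<^sup>2 > 0" using t(2) by simp
  then have "(d t)\<^sup>2 = 1" "(\<Sum>i\<in>I - {t}. (d i)\<^sup>2) = 0" using eq ge by linarith+
  then have "d t = 1 \<or> d t = -1" "\<And>i. i \<in> I - {t} \<Longrightarrow> d i = 0"
    using assms(1) by (auto simp: power2_eq_1_iff sum_nonneg_eq_0_iff)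
  then show thesis using that t(1) by blast
qed

context cyclotomic begin

lemma not_dvd_p_minus_1: "\<not> p dvd p - 1"
  using gt2 by (auto dest: dvd_imp_le)

lemma sum_zeta_powers_0: "(\<Sum>i<p. \<zeta> ^ i) = 0"
  using sum_zeta_powers[of 1] not_dvd_1 by simp

text \<open>
  Orthogonality of the \<open>p\<close>-th roots of unity; \<open>\<zeta>\<^bsup>(p-1)kj\<^esup>\<close> is the conjugate of \<open>\<zeta>\<^bsup>kj\<^esup>\<close>.
\<close>

lemma parseval:
  fixes f :: "nat \<Rightarrow> int"
  shows "(\<Sum>k<p. (\<Sum>i<p. of_int (f i) * \<zeta> ^ (k * i)) * (\<Sum>j<p. of_int (f j) * \<zeta> ^ ((p - 1) * k * j)))
    = of_int (int p * (\<Sum>i<p. (f i)\<^sup>2))"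
proof -
  have dvd_iff: "p dvd i + (p - 1) * j \<longleftrightarrow> i = j" if "i < p" "j < p" for i j
  proof -
    have "int (i + (p - 1) * j) = (int i - int j) + int p * int j"
      using gt2 by (cases p) (auto simp: algebra_simps)
    then have "int p dvd int (i + (p - 1) * j) \<longleftrightarrow> int p dvd int i - int j"
      by (simp only: dvd_add_left_iff[OF dvd_triv_left])
    then have "p dvd i + (p - 1) * j \<longleftrightarrow> int p dvd int i - int j" by (simp only: int_dvd_int_iff)
    also have "\<dots> \<longleftrightarrow> i = j"
      using that zdvd_imp_le[of "int p" "int i - int j"] zdvd_imp_le[of "int p" "int j - int i"]
      by (cases i j rule: linorder_cases) (auto simp: dvd_diff_commute[of _ "int i"])
    finally show ?thesis .
  qed
  have "(\<Sum>k<p. (\<Sum>i<p. of_int (f i) * \<zeta> ^ (k * i)) * (\<Sum>j<p. of_int (f j) * \<zeta> ^ ((p - 1) * k * j)))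
    = (\<Sum>k<p. \<Sum>i<p. \<Sum>j<p. of_int (f i * f j) * (\<zeta> ^ (i + (p - 1) * j)) ^ k)"
    unfolding sum_product
  proof (intro sum.cong refl)
    fix k i j
    have "k * i + (p - 1) * k * j = (i + (p - 1) * j) * k" by (simp only: distrib_right distrib_left mult_ac)
    then have "\<zeta> ^ (k * i) * \<zeta> ^ ((p - 1) * k * j) = (\<zeta> ^ (i + (p - 1) * j)) ^ k"
      by (simp only: power_add[symmetric] power_mult[symmetric])
    then show "of_int (f i) * \<zeta> ^ (k * i) * (of_int (f j) * \<zeta> ^ ((p - 1) * k * j))
      = of_int (f i * f j) * (\<zeta> ^ (i + (p - 1) * j)) ^ k"
      by (metis (no_types) mult.assoc mult.left_commute of_int_mult)
  qed
  also have "\<dots> = (\<Sum>i<p. \<Sum>j<p. \<Sum>k<p. of_int (f i * f j) * (\<zeta> ^ (i + (p - 1) * j)) ^ k)"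
    by (subst sum.swap) (intro sum.cong refl sum.swap)
  also have "\<dots> = (\<Sum>i<p. \<Sum>j<p. if j = i then of_int (int p * (f i)\<^sup>2) else 0)"
    unfolding sum_distrib_left[symmetric] sum_zeta_powers
  proof (intro sum.cong refl)
    fix i j assume "i \<in> {..<p}" "j \<in> {..<p}"
    then have iff: "p dvd i + (p - 1) * j \<longleftrightarrow> i = j" by (intro dvd_iff) simp_all
    show "of_int (f i * f j) * (if p dvd i + (p - 1) * j then of_nat p else 0)
      = (if j = i then complex_of_int (int p * (f i)\<^sup>2) else 0)"
      unfolding iff by (simp add: power2_eq_square)
  qed
  also have "\<dots> = of_int (int p * (\<Sum>i<p. (f i)\<^sup>2))" by (simp add: sum_distrib_left)
  finally show ?thesis .
qed

text \<open>
  All conjugates of \<open>v = \<Sum>i<p. f\<^sub>i \<zeta>\<^sup>i\<close> have absolute value \<open>1\<close>, so Parseval gives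
  \<open>p \<Sum> f\<^sub>i\<^sup>2 = S\<^sup>2 + p - 1\<close> with \<open>S = \<Sum> f\<^sub>i\<close>. In particular \<open>S \<equiv> \<plusminus>1\<close> modulo \<open>p\<close>. Subtracting a constant
  from all \<open>f\<^sub>i\<close> does not change \<open>v\<close> and makes \<open>S = \<plusminus>1\<close>; then \<open>\<Sum> f\<^sub>i\<^sup>2 = 1\<close>, and a single term survives.
\<close>

lemma unit_modulus_1:
  assumes v: "v \<in> \<O>" and v1: "v * sig (p - 1) v = 1"
  obtains t e where "e = 1 \<or> e = -1" "v = of_int e * \<zeta> ^ t"
proof -
  obtain F where F: "v = ipoly F \<zeta>" "degree F < p - 1" using v by (rule O_E)
  define f where "f = coeff F"
  define S where "S = (\<Sum>i<p. f i)"
  have V: "ipoly F (\<zeta> ^ k) = (\<Sum>i<p. of_int (f i) * \<zeta> ^ (k * i))" for k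
    using F(2) by (subst ipoly_altdef_less[of F p]) (auto simp: f_def power_mult)
  have one: "ipoly F (\<zeta> ^ k) * ipoly F (\<zeta> ^ ((p - 1) * k)) = 1" if k: "k \<in> {1..<p}" for k
  proof -
    have nk: "\<not> p dvd k" using k by (rule not_dvd_range)
    have "sig k v * sig k (sig (p - 1) v) = 1"
      using v1 sig_mult[of v "sig (p - 1) v" k] nk O_K[OF v] not_dvd_p_minus_1 by simp
    moreover have "sig k (sig (p - 1) v) = sig ((p - 1) * k) v"
      using sig_sig[OF nk not_dvd_p_minus_1 O_K[OF v]] by (simp add: mult.commute)
    ultimately show ?thesis
      unfolding F(1) sig_ipoly[OF nk] sig_ipoly[OF not_dvd_mult[OF not_dvd_p_minus_1 nk]] by simp
  qed
  have "(\<Sum>k<p. ipoly F (\<zeta> ^ k) * ipoly F (\<zeta> ^ ((p - 1) * k))) = of_int (S\<^sup>2 + (int p - 1))"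
  proof -
    have Sp: "{..<p} = insert 0 {1..<p}" using gt2 by auto
    have "(\<Sum>k\<in>{1..<p}. ipoly F (\<zeta> ^ k) * ipoly F (\<zeta> ^ ((p - 1) * k))) = (\<Sum>k\<in>{1..<p}. 1)"
      by (intro sum.cong refl one)
    moreover have "ipoly F (\<zeta> ^ 0) * ipoly F (\<zeta> ^ ((p - 1) * 0)) = of_int (S\<^sup>2)"
      unfolding V S_def by (simp add: power2_eq_square)
    ultimately show ?thesis unfolding Sp using gt2 by (simp add: of_nat_diff)
  qed
  then have "complex_of_int (int p * (\<Sum>i<p. (f i)\<^sup>2)) = of_int (S\<^sup>2 + (int p - 1))"
    unfolding V parseval .
  then have eq: "int p * (\<Sum>i<p. (f i)\<^sup>2) = S\<^sup>2 + (int p - 1)" by (simp only: of_int_eq_iff)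
  then have "(S - 1) * (S + 1) = int p * ((\<Sum>i<p. (f i)\<^sup>2) - 1)" by (simp add: power2_eq_square algebra_simps)
  then have "int p dvd (S - 1) * (S + 1)" by simp
  then have "int p dvd S - 1 \<or> int p dvd S + 1" using prime by (simp add: prime_dvd_mult_iff)
  then have "\<exists>e m. (e = 1 \<or> e = -1) \<and> S = e + int p * m"
  proof
    assume "int p dvd S - 1"
    then obtain m where "S - 1 = int p * m" ..
    then show ?thesis by (intro exI[of _ 1] exI[of _ m]) auto
  next
    assume "int p dvd S + 1"
    then obtain m where "S + 1 = int p * m" ..
    then show ?thesis by (intro exI[of _ "-1"] exI[of _ m]) auto
  qed
  then obtain e m where em: "e = 1 \<or> e = -1" "S = e + int p * m" by blast
  \<comment> \<open>The constant \<open>m\<close> is removed from all coefficients; the powers of \<open>\<zeta>\<close> add up to \<open>0\<close>.\<close>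
  define d where "d = (\<lambda>i. f i - m)"
  have d2: "(\<Sum>i<p. (d i)\<^sup>2) = (\<Sum>i<p. (f i)\<^sup>2) - 2 * m * S + int p * m\<^sup>2"
    unfolding d_def S_def by (simp add: power2_diff sum.distrib sum_subtractf sum_distrib_left mult_ac)
  have "int p * (\<Sum>i<p. (d i)\<^sup>2) = int p * (\<Sum>i<p. (f i)\<^sup>2) - 2 * int p * m * S + (int p * m)\<^sup>2"
    unfolding d2 by (simp add: power2_eq_square algebra_simps)
  also have "\<dots> = int p - 1 + (S - int p * m)\<^sup>2"
    unfolding eq by (simp add: power2_eq_square algebra_simps)
  also have "\<dots> = int p * 1" using em by auto
  finally have "(\<Sum>i<p. (d i)\<^sup>2) = 1" using gt2 by simp
  then obtain t where t: "t < p" "d t = 1 \<or> d t = -1" "\<And>i. i < p \<Longrightarrow> i \<noteq> t \<Longrightarrow> d i = 0"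
    using sum_squares_eq_1[of "{..<p}" d] by auto
  have "v = (\<Sum>i<p. of_int (f i) * \<zeta> ^ i)" using V[of 1] F(1) by simp
  also have "\<dots> = (\<Sum>i<p. of_int (d i) * \<zeta> ^ i) + of_int m * (\<Sum>i<p. \<zeta> ^ i)"
    unfolding sum_distrib_left sum.distrib[symmetric] by (intro sum.cong) (auto simp: d_def algebra_simps)
  also have "(\<Sum>i<p. of_int (d i) * \<zeta> ^ i) = (\<Sum>i<p. if i = t then of_int (d t) * \<zeta> ^ t else 0)"
    by (intro sum.cong) (auto simp: t(3))
  finally have "v = of_int (d t) * \<zeta> ^ t" using t(1) sum_zeta_powers_0 by simp
  then show thesis using that t(2) by blast
qed

lemma freshman:
  assumes "x \<in> \<O>" "y \<in> \<O>"
  shows "\<exists>d\<in>\<O>. (x + y) ^ p = x ^ p + y ^ p + of_nat p * d"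
proof -
  have S: "{..p} = insert 0 (insert p {1..<p})" using gt2 by auto
  define d where "d = (\<Sum>k\<in>{1..<p}. of_nat ((p choose k) div p) * x ^ k * y ^ (p - k))"
  have "(\<Sum>k\<in>{1..<p}. of_nat (p choose k) * x ^ k * y ^ (p - k)) = of_nat p * d"
    unfolding d_def sum_distrib_left
  proof (intro sum.cong refl)
    fix k assume "k \<in> {1..<p}"
    then have "p dvd (p choose k)" using prime by (intro dvd_choose_prime) auto
    then have "p choose k = p * ((p choose k) div p)" by (rule dvd_mult_div_cancel[symmetric])
    then have "complex_of_nat (p choose k) = of_nat p * of_nat ((p choose k) div p)"
      by (metis of_nat_mult)
    then show "of_nat (p choose k) * x ^ k * y ^ (p - k)
      = of_nat p * (of_nat ((p choose k) div p) * x ^ k * y ^ (p - k))" by simp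
  qed
  then have "(x + y) ^ p = x ^ p + y ^ p + of_nat p * d"
    unfolding binomial_ring S using gt2 by (simp add: algebra_simps)
  moreover have "d \<in> \<O>" unfolding d_def using assms by (intro O_sum) simp
  ultimately show ?thesis by blast
qed

lemma pth_power_cong_int:
  assumes "x \<in> \<O>"
  shows "\<exists>r. \<exists>d\<in>\<O>. x ^ p = of_int r + of_nat p * d"
proof -
  have "\<exists>r. \<exists>d\<in>\<O>. ipoly F \<zeta> ^ p = of_int r + of_nat p * d" for F
  proof (induction F)
    case 0
    have "(0 :: complex) ^ p = 0" using gt2 by (intro zero_power) simp
    then show ?case by (intro exI[of _ 0] bexI[of _ 0]) auto
  next
    case (pCons a F)
    then obtain r d where d: "d \<in> \<O>" "ipoly F \<zeta> ^ p = of_int r + of_nat p * d" by blast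
    obtain d' where d': "d' \<in> \<O>"
      "(of_int a + \<zeta> * ipoly F \<zeta>) ^ p = of_int a ^ p + (\<zeta> * ipoly F \<zeta>) ^ p + of_nat p * d'"
      using freshman[of "of_int a" "\<zeta> * ipoly F \<zeta>"] by auto
    have "ipoly (pCons a F) \<zeta> ^ p = of_int (a ^ p + r) + of_nat p * (d + d')"
      using d' d(2) root by (simp add: power_mult_distrib algebra_simps)
    then show ?case using d d' O_add by blast
  qed
  then show ?thesis using assms O_eq by auto
qed

end

section \<open>Invertibility of fractional ideals\<close>

lemma cyclo_field_simps [simp]:
  "x \<otimes>\<^bsub>cyclo_field z\<^esub> y = x * y" "x \<oplus>\<^bsub>cyclo_field z\<^esub> y = x + y"
  "\<one>\<^bsub>cyclo_field z\<^esub> = 1" "\<zero>\<^bsub>cyclo_field z\<^esub> = 0"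
  by (simp_all add: cyclo_field_def ring_of_type_algebra_def)

text \<open>
  Used to express the content of an integer polynomial by its coefficients.
\<close>

lemma gcd_list_in_subgroup:
  fixes B :: "int set"
  assumes zero: "0 \<in> B" and add: "\<And>x y. x \<in> B \<Longrightarrow> y \<in> B \<Longrightarrow> x + y \<in> B"
    and mult: "\<And>x k. x \<in> B \<Longrightarrow> k * x \<in> B" and "set xs \<subseteq> B"
  shows "gcd_list xs \<in> B"
  using assms(4)
proof (induction xs)
  case (Cons x xs)
  obtain u v where "u * x + v * gcd_list xs = gcd x (gcd_list xs)" using bezout_int by blast
  moreover have "u * x + v * gcd_list xs \<in> B" using Cons by (intro add mult) auto
  ultimately show ?case by simp
qed (simp add: zero)

context cyclotomic begin

abbreviation iprod :: "complex set \<Rightarrow> complex set \<Rightarrow> complex set" where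
  "iprod \<equiv> ideal_prod (cyclo_field \<zeta>)"

lemma iprod_mult: "x \<in> I \<Longrightarrow> y \<in> J \<Longrightarrow> x * y \<in> iprod I J"
  using ideal_prod.prod[of x I y J "cyclo_field \<zeta>"] by simp
lemma iprod_add: "x \<in> iprod I J \<Longrightarrow> y \<in> iprod I J \<Longrightarrow> x + y \<in> iprod I J"
  using ideal_prod.sum[of x "cyclo_field \<zeta>" I J y] by simp

lemma iprod_induct [consumes 1, case_names mult add]:
  assumes "x \<in> iprod I J" "\<And>x y. x \<in> I \<Longrightarrow> y \<in> J \<Longrightarrow> P (x * y)"
    "\<And>x y. x \<in> iprod I J \<Longrightarrow> P x \<Longrightarrow> y \<in> iprod I J \<Longrightarrow> P y \<Longrightarrow> P (x + y)"
  shows "P x"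
  using assms(1) by (induction rule: ideal_prod.induct) (use assms in auto)

text \<open>
  Nonzero \<open>\<O>\<close>-submodules of \<open>K\<close> with a common denominator, as an intrinsic form of the quotients of
  ideals by elements.
\<close>

definition fractional :: "complex set \<Rightarrow> bool" where
  "fractional I \<longleftrightarrow> I \<subseteq> K \<and> (\<exists>x\<in>I. x \<noteq> 0) \<and> (\<forall>x\<in>I. \<forall>y\<in>I. x + y \<in> I) \<and>
     (\<forall>r\<in>\<O>. \<forall>x\<in>I. r * x \<in> I) \<and> (\<exists>d\<in>\<O>. d \<noteq> 0 \<and> (\<forall>x\<in>I. d * x \<in> \<O>))"

definition principal :: "complex \<Rightarrow> complex set" where
  "principal x = (\<lambda>r. x * r) ` \<O>"

lemma fractional_K: "fractional I \<Longrightarrow> x \<in> I \<Longrightarrow> x \<in> K"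
  and fractional_add: "fractional I \<Longrightarrow> x \<in> I \<Longrightarrow> y \<in> I \<Longrightarrow> x + y \<in> I"
  and fractional_scale: "fractional I \<Longrightarrow> r \<in> \<O> \<Longrightarrow> x \<in> I \<Longrightarrow> r * x \<in> I"
  unfolding fractional_def by blast+

lemma fractional_0: "fractional I \<Longrightarrow> 0 \<in> I"
  using fractional_scale[of I 0] unfolding fractional_def by auto

lemma fractional_sum: "fractional I \<Longrightarrow> (\<And>i. i \<in> S \<Longrightarrow> f i \<in> I) \<Longrightarrow> (\<Sum>i\<in>S. f i) \<in> I"
  by (induction S rule: infinite_finite_induct) (auto intro: fractional_add fractional_0)

lemma fractional_diff: "fractional I \<Longrightarrow> x \<in> I \<Longrightarrow> y \<in> I \<Longrightarrow> x - y \<in> I"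
  using fractional_add[of I x "- y"] fractional_scale[of I "-1" y] O_uminus[OF O_1] by simp

lemma fractional_O: "fractional \<O>"
  unfolding fractional_def using O_K O_1 zero_neq_one by (auto intro!: bexI[of _ 1])

lemma fractional_principal: "x \<in> K \<Longrightarrow> x \<noteq> 0 \<Longrightarrow> fractional (principal x)"
proof -
  assume x: "x \<in> K" "x \<noteq> 0"
  obtain F n where F: "n \<noteq> 0" "x = ipoly F \<zeta> / of_int n" using x(1) by (rule K_E)
  have "of_int n * (x * r) \<in> \<O>" if "r \<in> \<O>" for r using F that by simp
  then have "\<exists>d\<in>\<O>. d \<noteq> 0 \<and> (\<forall>y\<in>principal x. d * y \<in> \<O>)"
    using F(1) by (intro bexI[of _ "of_int n"]) (auto simp: principal_def)
  moreover have "y + z \<in> principal x" if yz: "y \<in> principal x" "z \<in> principal x" for y z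
  proof -
    obtain r s where "r \<in> \<O>" "s \<in> \<O>" "y = x * r" "z = x * s" using yz by (auto simp: principal_def)
    then have "r + s \<in> \<O>" "y + z = x * (r + s)" by (simp_all add: distrib_left)
    then show ?thesis unfolding principal_def by blast
  qed
  moreover have "r * y \<in> principal x" if ry: "r \<in> \<O>" "y \<in> principal x" for r y
  proof -
    obtain s where "s \<in> \<O>" "y = x * s" using ry by (auto simp: principal_def)
    then have "r * s \<in> \<O>" "r * y = x * (r * s)" using ry by simp_all
    then show ?thesis unfolding principal_def by blast
  qed
  moreover have "x \<in> principal x" unfolding principal_def using O_1 by (metis image_eqI mult.right_neutral)
  moreover have "principal x \<subseteq> K" using x O_K by (auto simp: principal_def)
  ultimately show ?thesis
    unfolding fractional_def using x(2) by blast
qed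

lemma fractional_iprod:
  assumes I: "fractional I" and J: "fractional J"
  shows "fractional (iprod I J)"
proof -
  have "x \<in> K" if "x \<in> iprod I J" for x
    using that by (induction rule: iprod_induct) (simp_all add: fractional_K[OF I] fractional_K[OF J])
  moreover have "r * x \<in> iprod I J" if "x \<in> iprod I J" "r \<in> \<O>" for x r
    using that
  proof (induction rule: iprod_induct)
    case (mult x y)
    then have "(r * x) * y \<in> iprod I J" by (intro iprod_mult fractional_scale[OF I])
    then show ?case by (simp add: mult.assoc)
  qed (auto simp: distrib_left intro: iprod_add)
  moreover obtain x y where "x \<in> I" "x \<noteq> 0" "y \<in> J" "y \<noteq> 0" using I J unfolding fractional_def by blast
  then have "x * y \<in> iprod I J" "x * y \<noteq> 0" by (auto intro: iprod_mult)
  moreover obtain d e where d: "d \<in> \<O>" "d \<noteq> 0" "\<forall>x\<in>I. d * x \<in> \<O>" and e: "e \<in> \<O>" "e \<noteq> 0" "\<forall>x\<in>J. e * x \<in> \<O>"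
    using I J unfolding fractional_def by blast
  have "d * e * x \<in> \<O>" if "x \<in> iprod I J" for x
    using that
  proof (induction rule: iprod_induct)
    case (mult x y)
    then have "(d * x) * (e * y) \<in> \<O>" using d e by simp
    then show ?case by (simp add: mult_ac)
  qed (auto simp: distrib_left)
  then have "\<exists>d\<in>\<O>. d \<noteq> 0 \<and> (\<forall>x\<in>iprod I J. d * x \<in> \<O>)"
    using d e by (intro bexI[of _ "d * e"]) auto
  ultimately show ?thesis unfolding fractional_def using iprod_add by blast
qed

lemma iprod_mono: "I \<subseteq> I' \<Longrightarrow> J \<subseteq> J' \<Longrightarrow> iprod I J \<subseteq> iprod I' J'"
proof
  fix x assume sub: "I \<subseteq> I'" "J \<subseteq> J'" and "x \<in> iprod I J"
  from this(3) show "x \<in> iprod I' J'"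
    by (induction rule: iprod_induct) (use sub in \<open>auto intro: iprod_mult iprod_add\<close>)
qed

lemma iprod_comm: "iprod I J = iprod J I"
proof -
  have "x \<in> iprod J I" if "x \<in> iprod I J" for I J x
    using that by (induction rule: iprod_induct) (metis iprod_mult mult.commute, rule iprod_add)
  then show ?thesis by blast
qed

lemma iprod_assoc: "iprod (iprod I J) L = iprod I (iprod J L)"
proof -
  have 1: "x \<in> iprod I (iprod J L)" if x: "x \<in> iprod (iprod I J) L" for I J L x
    using x
  proof (induction rule: iprod_induct)
    case (mult x z)
    from mult(1) show ?case
    proof (induction rule: iprod_induct)
      case (mult x y)
      then show ?case using \<open>z \<in> L\<close> by (simp add: mult.assoc iprod_mult)
    next
      case (add x y)
      then show ?case by (simp add: distrib_right iprod_add)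
    qed
  qed (rule iprod_add)
  have "iprod I (iprod J L) \<subseteq> iprod (iprod I J) L"
  proof
    fix x assume "x \<in> iprod I (iprod J L)"
    then have "x \<in> iprod (iprod L J) I" by (simp only: iprod_comm[of I] iprod_comm[of J L])
    then have "x \<in> iprod L (iprod J I)" by (rule 1)
    then show "x \<in> iprod (iprod I J) L" by (simp only: iprod_comm[of L] iprod_comm[of J I])
  qed
  then show ?thesis using 1 by blast
qed

lemma iprod_O: "fractional I \<Longrightarrow> iprod \<O> I = I"
proof -
  assume I: "fractional I"
  have "x \<in> I" if "x \<in> iprod \<O> I" for x
    using that by (induction rule: iprod_induct) (auto intro: fractional_scale[OF I] fractional_add[OF I])
  moreover have "x \<in> iprod \<O> I" if "x \<in> I" for x using iprod_mult[of 1 \<O> x I] that by simp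
  ultimately show ?thesis by blast
qed

lemma iprod_principal: "iprod (principal x) (principal y) = principal (x * y)"
proof -
  have "z \<in> principal (x * y)" if "z \<in> iprod (principal x) (principal y)" for z
    using that
  proof (induction rule: iprod_induct)
    case (mult u v)
    then obtain r s where rs: "r \<in> \<O>" "s \<in> \<O>" "u = x * r" "v = y * s" by (auto simp: principal_def)
    have "u * v = x * y * (r * s)" by (simp add: rs mult_ac)
    then show ?case unfolding principal_def using rs O_mult by blast
  next
    case (add u v)
    then obtain r s where rs: "r \<in> \<O>" "s \<in> \<O>" "u = x * y * r" "v = x * y * s" by (auto simp: principal_def)
    have "u + v = x * y * (r + s)" by (simp add: rs distrib_left)
    then show ?case unfolding principal_def using rs O_add by blast
  qed
  moreover have "z \<in> iprod (principal x) (principal y)" if "z \<in> principal (x * y)" for z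
  proof -
    obtain r where r: "r \<in> \<O>" "z = x * y * r" using \<open>z \<in> principal (x * y)\<close> by (auto simp: principal_def)
    have "(x * r) * (y * 1) \<in> iprod (principal x) (principal y)"
      using r O_1 unfolding principal_def by (intro iprod_mult) blast+
    then show ?thesis using r by (simp add: mult_ac)
  qed
  ultimately show ?thesis by blast
qed

lemma principal_1: "principal 1 = \<O>" by (auto simp: principal_def)

lemma fractional_sig:
  assumes k: "\<not> p dvd k" and I: "fractional I"
  shows "fractional (sig k ` I)"
proof -
  obtain l where l: "\<not> p dvd l" "\<And>x. x \<in> K \<Longrightarrow> sig k (sig l x) = x" using sig_inverse_exists[OF k] by metis
  have "x + y \<in> sig k ` I" if xy: "x \<in> sig k ` I" "y \<in> sig k ` I" for x y
  proof -
    obtain u v where uv: "u \<in> I" "v \<in> I" "x = sig k u" "y = sig k v" using xy by blast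
    then have "x + y = sig k (u + v)" using sig_add[of u v k] k fractional_K[OF I] by simp
    then show ?thesis using uv fractional_add[OF I] by blast
  qed
  moreover have "r * x \<in> sig k ` I" if rx: "r \<in> \<O>" "x \<in> sig k ` I" for r x
  proof -
    obtain u where u: "u \<in> I" "x = sig k u" using rx by blast
    have "sig k (sig l r * u) = r * x"
      using rx(1) u k l fractional_K[OF I] O_K by (simp add: sig_mult)
    moreover have "sig l r * u \<in> I" using u l rx(1) fractional_scale[OF I] by simp
    ultimately show ?thesis by (metis imageI)
  qed
  moreover obtain d where d: "d \<in> \<O>" "d \<noteq> 0" "\<forall>x\<in>I. d * x \<in> \<O>" using I unfolding fractional_def by blast
  have "sig k d * x \<in> \<O>" if x: "x \<in> sig k ` I" for x
  proof -
    obtain u where u: "u \<in> I" "x = sig k u" using x by blast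
    have "sig k (d * u) \<in> \<O>" using d u k by simp
    then show ?thesis using u d k fractional_K[OF I] O_K by (simp add: sig_mult)
  qed
  then have "\<exists>d\<in>\<O>. d \<noteq> 0 \<and> (\<forall>x\<in>sig k ` I. d * x \<in> \<O>)"
    using d k O_K by (intro bexI[of _ "sig k d"]) (auto simp: sig_eq_0_iff)
  moreover obtain x where "x \<in> I" "x \<noteq> 0" using I unfolding fractional_def by blast
  then have "sig k x \<noteq> 0" "sig k x \<in> sig k ` I" using k fractional_K[OF I] by (auto simp: sig_eq_0_iff)
  moreover have "sig k ` I \<subseteq> K" using k fractional_K[OF I] by auto
  ultimately show ?thesis unfolding fractional_def by blast
qed

lemma sig_iprod:
  assumes k: "\<not> p dvd k" and I: "fractional I" and J: "fractional J"
  shows "sig k ` iprod I J = iprod (sig k ` I) (sig k ` J)"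
proof -
  have "sig k x \<in> iprod (sig k ` I) (sig k ` J)" if "x \<in> iprod I J" for x
    using that
  proof (induction rule: iprod_induct)
    case (mult x y)
    then have "sig k (x * y) = sig k x * sig k y"
      using k fractional_K[OF I] fractional_K[OF J] by (simp add: sig_mult)
    then show ?case using mult iprod_mult by simp
  next
    case (add x y)
    then have "sig k (x + y) = sig k x + sig k y"
      using k fractional_K[OF fractional_iprod[OF I J]] by (simp add: sig_add)
    then show ?case using add iprod_add by simp
  qed
  moreover have "x \<in> sig k ` iprod I J" if "x \<in> iprod (sig k ` I) (sig k ` J)" for x
    using that
  proof (induction rule: iprod_induct)
    case (mult x y)
    then obtain u v where uv: "u \<in> I" "v \<in> J" "x = sig k u" "y = sig k v" by blast
    then have "x * y = sig k (u * v)" using k fractional_K[OF I] fractional_K[OF J] by (simp add: sig_mult)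
    then show ?case using uv iprod_mult by blast
  next
    case (add x y)
    then show ?case using fractional_add[OF fractional_sig[OF k fractional_iprod[OF I J]]] by blast
  qed
  ultimately show ?thesis by blast
qed

lemma sig_image_O: "\<not> p dvd k \<Longrightarrow> sig k ` \<O> = \<O>"
proof -
  assume k: "\<not> p dvd k"
  obtain l where l: "\<not> p dvd l" "\<And>x. x \<in> K \<Longrightarrow> sig k (sig l x) = x" using sig_inverse_exists[OF k] by metis
  have "x \<in> sig k ` \<O>" if "x \<in> \<O>" for x using l sig_O[of l x] that O_K by (metis imageI)
  then show ?thesis using k by auto
qed

lemma sig_principal:
  assumes k: "\<not> p dvd k" and x: "x \<in> K"
  shows "sig k ` principal x = principal (sig k x)"
proof -
  have "sig k ` principal x = (\<lambda>r. sig k x * sig k r) ` \<O>"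
    unfolding principal_def image_image using k x O_K by (intro image_cong refl sig_mult) auto
  also have "\<dots> = (\<lambda>r. sig k x * r) ` (sig k ` \<O>)" by (simp add: image_image)
  finally show ?thesis using sig_image_O[OF k] by (simp add: principal_def)
qed

definition inverse_ideal :: "complex set \<Rightarrow> complex set" where
  "inverse_ideal I = {y \<in> K. \<forall>x\<in>I. x * y \<in> \<O>}"

lemma fractional_inverse:
  assumes I: "fractional I"
  shows "fractional (inverse_ideal I)"
proof -
  obtain d where d: "d \<in> \<O>" "d \<noteq> 0" "\<forall>x\<in>I. d * x \<in> \<O>" using I unfolding fractional_def by blast
  obtain x where x: "x \<in> I" "x \<noteq> 0" using I unfolding fractional_def by blast
  have dx: "d * x \<in> \<O>" "d * x \<noteq> 0" using d x by auto
  have "d \<in> inverse_ideal I" using d O_K by (auto simp: inverse_ideal_def mult.commute)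
  moreover have "(d * x) * y \<in> \<O>" if "y \<in> inverse_ideal I" for y
  proof -
    have "x * y \<in> \<O>" using that x by (auto simp: inverse_ideal_def)
    then show ?thesis using d by (simp add: mult.assoc)
  qed
  then have "\<exists>d\<in>\<O>. d \<noteq> 0 \<and> (\<forall>y\<in>inverse_ideal I. d * y \<in> \<O>)" using dx by blast
  moreover have "y + z \<in> inverse_ideal I" if "y \<in> inverse_ideal I" "z \<in> inverse_ideal I" for y z
    using that by (auto simp: inverse_ideal_def distrib_left)
  moreover have "r * y \<in> inverse_ideal I" if "r \<in> \<O>" "y \<in> inverse_ideal I" for r y
    using that O_K by (auto simp: inverse_ideal_def mult.left_commute[of _ r])
  moreover have "inverse_ideal I \<subseteq> K" by (auto simp: inverse_ideal_def)
  ultimately show ?thesis unfolding fractional_def using d(2) by blast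
qed

text \<open>
  The norm of an element is a multiple of it.
\<close>

lemma integral_contains_int:
  assumes J: "fractional J" "J \<subseteq> \<O>"
  obtains N :: int where "N > 0" "of_int N \<in> J"
proof -
  obtain x where x: "x \<in> J" "x \<noteq> 0" using J unfolding fractional_def by blast
  then have xO: "x \<in> \<O>" using J by blast
  have "(\<Prod>k\<in>{2..<p}. sig k x) \<in> \<O>" using xO by (intro O_prod sig_O not_dvd_range) auto
  from fractional_scale[OF J(1) this x(1)] have nJ: "norm_K x \<in> J"
    unfolding norm_factor[OF O_K[OF xO]] by (simp only: mult.commute)
  obtain m where m: "norm_K x = of_int m" using norm_O_int[OF xO] by (auto elim: Ints_cases)
  have "m \<noteq> 0" using norm_eq_0_iff[OF O_K[OF xO]] x(2) m by auto
  moreover have "of_int (- m) \<in> J" using fractional_scale[OF J(1) O_uminus[OF O_1] nJ] m by simp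
  ultimately show thesis using that[of m] that[of "- m"] nJ m by (cases "m > 0") auto
qed

text \<open>
  Since \<open>\<O> = \<int>[\<zeta>]\<close>, coefficients can be reduced modulo \<open>N\<close>, and only finitely many elements have
  coefficients between \<open>0\<close> and \<open>N - 1\<close>.
\<close>

lemma integral_finitely_generated:
  assumes J: "fractional J" "J \<subseteq> \<O>"
  obtains N :: int and S where "N > 0" "of_int N \<in> J" "finite S" "S \<subseteq> J"
    "\<And>x. x \<in> J \<Longrightarrow> \<exists>s\<in>S. \<exists>y\<in>\<O>. x = s + of_int N * y"
proof -
  obtain N :: int where N: "N > 0" "of_int N \<in> J" using integral_contains_int[OF J] .
  define S0 where "S0 = (\<lambda>c. \<Sum>i<p. of_int (c i) * \<zeta> ^ i) ` PiE {..<p} (\<lambda>_. {0..<N})"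
  have "finite S0" unfolding S0_def by (intro finite_imageI finite_PiE) auto
  then have fin: "finite (S0 \<inter> J)" by simp
  have "\<exists>s\<in>S0 \<inter> J. \<exists>y\<in>\<O>. x = s + of_int N * y" if x: "x \<in> J" for x
  proof -
    obtain F where F: "x = ipoly F \<zeta>" "degree F < p - 1" using x J O_E by blast
    define f where "f = coeff F"
    have xf: "x = (\<Sum>i<p. of_int (f i) * \<zeta> ^ i)"
      unfolding F(1) f_def using F(2) by (intro ipoly_altdef_less) simp
    define s where "s = (\<Sum>i<p. of_int (f i mod N) * \<zeta> ^ i)"
    define y where "y = (\<Sum>i<p. of_int (f i div N) * \<zeta> ^ i)"
    have "f i = f i mod N + N * (f i div N)" for i by simp
    then have fi: "complex_of_int (f i) = of_int (f i mod N) + of_int N * of_int (f i div N)" for i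
      by (metis of_int_add of_int_mult)
    have eq: "x = s + of_int N * y"
      unfolding xf s_def y_def sum_distrib_left sum.distrib[symmetric]
      by (intro sum.cong refl, subst fi) (simp add: distrib_right)
    have y: "y \<in> \<O>" unfolding y_def by (intro O_sum) simp
    have "s = (\<Sum>i<p. of_int (restrict (\<lambda>i. f i mod N) {..<p} i) * \<zeta> ^ i)"
      unfolding s_def by (intro sum.cong) auto
    moreover have "restrict (\<lambda>i. f i mod N) {..<p} \<in> PiE {..<p} (\<lambda>_. {0..<N})" using N(1) by auto
    ultimately have "s \<in> S0" unfolding S0_def by (rule image_eqI)
    moreover have "s \<in> J"
    proof -
      have "x - y * of_int N \<in> J" by (intro fractional_diff[OF J(1)] x fractional_scale[OF J(1) y N(2)])
      then show ?thesis using eq by (simp add: mult.commute)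
    qed
    ultimately show ?thesis using eq y by blast
  qed
  then show thesis using that[of N "S0 \<inter> J"] N fin by blast
qed

lemma coeff_map_poly_sig: "\<not> p dvd k \<Longrightarrow> coeff (map_poly (sig k) f) i = sig k (coeff f i)"
  by (rule coeff_map_poly) simp

lemma map_poly_sig_mult:
  assumes k: "\<not> p dvd k" and f: "\<And>i. coeff f i \<in> K" and g: "\<And>i. coeff g i \<in> K"
  shows "map_poly (sig k) (f * g) = map_poly (sig k) f * map_poly (sig k) g"
proof (rule poly_eqI)
  fix n
  have "sig k (\<Sum>i\<le>n. coeff f i * coeff g (n - i))
    = (\<Sum>i\<le>n. sig k (coeff f i) * sig k (coeff g (n - i)))"
    using k f g by (subst sig_sum) (auto intro!: sum.cong simp: sig_mult)
  then show "coeff (map_poly (sig k) (f * g)) n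
    = coeff (map_poly (sig k) f * map_poly (sig k) g) n"
    by (simp add: coeff_map_poly_sig[OF k] coeff_mult)
qed

lemma coeff_prod_closed:
  fixes P :: "'b \<Rightarrow> complex poly"
  assumes "1 \<in> R" "0 \<in> R" "\<And>x y. x \<in> R \<Longrightarrow> y \<in> R \<Longrightarrow> x + y \<in> R" "\<And>x y. x \<in> R \<Longrightarrow> y \<in> R \<Longrightarrow> x * y \<in> R"
    and "\<And>k i. k \<in> A \<Longrightarrow> coeff (P k) i \<in> R"
  shows "coeff (\<Prod>k\<in>A. P k) i \<in> R"
  using assms(5)
proof (induction A arbitrary: i rule: infinite_finite_induct)
  case (insert k A)
  have sum: "(\<Sum>i\<in>I. h i) \<in> R" if "\<And>i. i \<in> I \<Longrightarrow> h i \<in> R" for h and I :: "nat set"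
    using that by (induction I rule: infinite_finite_induct) (auto intro: assms(2,3))
  show ?case using insert by (auto simp: coeff_mult intro!: sum assms(4))
qed (use assms(1,2) in \<open>auto simp: coeff_1\<close>)

lemma map_poly_sig_prod:
  assumes k: "\<not> p dvd k" and f: "\<And>j i. j \<in> A \<Longrightarrow> coeff (P j) i \<in> K"
  shows "map_poly (sig k) (\<Prod>j\<in>A. P j) = (\<Prod>j\<in>A. map_poly (sig k) (P j))"
  using f
proof (induction A rule: infinite_finite_induct)
  case (insert j A)
  have "map_poly (sig k) (P j * prod P A) = map_poly (sig k) (P j) * map_poly (sig k) (prod P A)"
    using insert by (intro map_poly_sig_mult[OF k] coeff_prod_closed) auto
  then show ?case using insert by simp
qed (use k in \<open>auto simp: map_poly_1\<close>)

text \<open>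
  Kronecker's construction. Let \<open>f\<close> be a polynomial whose coefficients generate \<open>J\<close> and \<open>g\<close> the product
  of its other conjugates. Then \<open>f g\<close> is invariant under conjugation, hence has integer coefficients; let
  \<open>c\<close> be their content. By Dedekind's theorem the coefficients of \<open>g\<close> divided by \<open>c\<close> lie in the inverse
  ideal, and \<open>1\<close> is an integral combination of the coefficients of \<open>f g\<close> divided by \<open>c\<close>.
\<close>

lemma one_in_integral_inverse:
  assumes J: "fractional J" "J \<subseteq> \<O>"
  shows "1 \<in> iprod J (inverse_ideal J)"
proof -
  define A where "A = iprod J (inverse_ideal J)"
  have A: "fractional A" unfolding A_def by (intro fractional_iprod J fractional_inverse)
  obtain N :: int and S where N: "N > 0" "of_int N \<in> J" and S: "finite S" "S \<subseteq> J"
    and gen: "\<And>x. x \<in> J \<Longrightarrow> \<exists>s\<in>S. \<exists>y\<in>\<O>. x = s + of_int N * y"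
    using integral_finitely_generated[OF J] by metis
  obtain xs where xs: "set xs = insert (of_int N) S" using finite_list[of "insert (of_int N) S"] S by auto
  define f where "f = Poly xs"
  have fJ: "coeff f i \<in> J" for i
    using xs S N fractional_0[OF J(1)] nth_mem[of i xs] by (auto simp: f_def coeff_Poly_eq nth_default_def)
  then have fO: "coeff f i \<in> \<O>" and fK: "coeff f i \<in> K" for i
    using J O_K by auto
  have fxs: "\<exists>i. x = coeff f i" if "x \<in> set xs" for x
    using that by (auto simp: f_def coeff_Poly_eq nth_default_def in_set_conv_nth)
  define P where "P k = map_poly (sig k) f" for k
  have PO: "coeff (P k) i \<in> \<O>" if "k \<in> {1..<p}" for k i
    unfolding P_def coeff_map_poly_sig[OF not_dvd_range[OF that]] using fO not_dvd_range[OF that] by simp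
  define g where "g = (\<Prod>k\<in>{2..<p}. P k)"
  have gO: "coeff g i \<in> \<O>" for i
    unfolding g_def by (rule coeff_prod_closed) (auto intro: PO)
  define h where "h = (\<Prod>k\<in>{1..<p}. P k)"
  have P1: "P 1 = f"
    by (intro poly_eqI) (simp only: P_def coeff_map_poly_sig[OF not_dvd_1] sig_id[OF fK])
  have h_fg: "h = f * g"
  proof -
    have "{1..<p} = insert 1 {2..<p}" using gt2 by auto
    then show ?thesis unfolding h_def g_def using P1 by simp
  qed
  have hO: "coeff h i \<in> \<O>" for i
    unfolding h_def by (rule coeff_prod_closed) (auto intro: PO)
  have hfix: "map_poly (sig l) h = h" if l: "\<not> p dvd l" for l
  proof -
    have "map_poly (sig l) h = (\<Prod>k\<in>{1..<p}. map_poly (sig l) (P k))"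
      unfolding h_def using PO O_K by (intro map_poly_sig_prod l) blast
    also have "\<dots> = (\<Prod>k\<in>{1..<p}. P (l * k mod p))"
    proof (intro prod.cong refl poly_eqI)
      fix k i assume k: "k \<in> {1..<p}"
      have "l * k mod p \<in> {1..<p}" using bij_mult_mod[OF l] k by (rule bij_betwE[rule_format])
      then have m: "\<not> p dvd l * k mod p" by (rule not_dvd_range)
      show "coeff (map_poly (sig l) (P k)) i = coeff (P (l * k mod p)) i"
        unfolding P_def coeff_map_poly_sig[OF l] coeff_map_poly_sig[OF not_dvd_range[OF k]] coeff_map_poly_sig[OF m]
        by (rule sig_sig_mod[OF l k fK])
    qed
    also have "\<dots> = h" unfolding h_def by (rule prod.reindex_bij_betw[OF bij_mult_mod[OF l]])
    finally show ?thesis .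
  qed
  have "coeff h i \<in> \<int>" for i
  proof (intro O_Rats_Ints hO fixed_Rats O_K[OF hO])
    fix l assume "l \<in> {1..<p}"
    then have l: "\<not> p dvd l" by (rule not_dvd_range)
    then show "sig l (coeff h i) = coeff h i"
      using coeff_map_poly_sig[OF l, of h i] hfix[OF l] by simp
  qed
  then obtain H where H: "h = map_poly of_int H" by (rule intpolyE)
  have "P k \<noteq> 0" if k: "k \<in> {1..<p}" for k
  proof
    assume "P k = 0"
    obtain i where i: "of_int N = coeff f i" using fxs xs by blast
    have "sig k (of_int N) = 0"
      using \<open>P k = 0\<close> coeff_map_poly_sig[OF not_dvd_range[OF k], of f i] i by (simp add: P_def)
    then show False using N(1) not_dvd_range[OF k] by simp
  qed
  then have "h \<noteq> 0" unfolding h_def by simp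
  then have H0: "H \<noteq> 0" using H by auto
  define c where "c = content H"
  have c0: "c \<noteq> 0" using H0 by (simp add: c_def)
  have "algebraic_int (inverse (of_int c) * coeff (f * g) i)" for i
  proof -
    obtain q where "coeff H i = c * q" unfolding c_def using content_dvd_coeff by (metis dvdE)
    then have "inverse (of_int c) * coeff (f * g) i = of_int q"
      unfolding h_fg[symmetric] H using c0 by (simp add: coeff_map_poly)
    then show ?thesis by simp
  qed
  then have int: "algebraic_int (inverse (of_int c) * (coeff f i * coeff g j))" for i j
    by (rule algebraic_int_coeff_mult)
  have gK: "coeff g j / of_int c \<in> K" for j using gO O_K by simp
  have fgO: "coeff f i * (coeff g j / of_int c) \<in> \<O>" for i j
    using int[of i j] K_mult[OF fK gK, of i j] unfolding \<O>_def by (simp add: divide_inverse mult_ac)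
  have inv: "coeff g j / of_int c \<in> inverse_ideal J" for j
  proof -
    have "x * (coeff g j / of_int c) \<in> \<O>" if "x \<in> J" for x
    proof -
      obtain s y where sy: "s \<in> S" "y \<in> \<O>" "x = s + of_int N * y" using gen \<open>x \<in> J\<close> by blast
      obtain i i' where "s = coeff f i" "of_int N = coeff f i'" using fxs xs sy by blast
      then have "x * (coeff g j / of_int c) = coeff f i * (coeff g j / of_int c)
          + y * (coeff f i' * (coeff g j / of_int c))"
        using sy(3) by (simp add: algebra_simps add_divide_distrib)
      then show ?thesis using fgO sy(2) by (metis O_add O_mult)
    qed
    then show ?thesis using gK by (simp add: inverse_ideal_def)
  qed
  have hA: "of_int (coeff H m) / of_int c \<in> A" for m
  proof -
    have "of_int (coeff H m) = coeff (f * g) m"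
      unfolding h_fg[symmetric] H by (simp add: coeff_map_poly)
    then have "of_int (coeff H m) / of_int c
      = (\<Sum>i\<le>m. coeff f i * (coeff g (m - i) / of_int c))"
      by (simp add: coeff_mult sum_divide_distrib)
    also have "\<dots> \<in> A" unfolding A_def
      by (intro fractional_sum[OF A[unfolded A_def]] iprod_mult fJ inv)
    finally show ?thesis .
  qed
  have "gcd_list (coeffs H) \<in> {z. of_int z / of_int c \<in> A}"
  proof (rule gcd_list_in_subgroup)
    show "0 \<in> {z. of_int z / of_int c \<in> A}" using fractional_0[OF A] by simp
    show "x + y \<in> {z. of_int z / of_int c \<in> A}"
      if "x \<in> {z. of_int z / of_int c \<in> A}" "y \<in> {z. of_int z / of_int c \<in> A}" for x y
      using that fractional_add[OF A] by (simp add: add_divide_distrib)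
    show "k * x \<in> {z. of_int z / of_int c \<in> A}" if "x \<in> {z. of_int z / of_int c \<in> A}" for x k
      using that fractional_scale[OF A O_of_int[of k]] by (simp add: times_divide_eq_right[symmetric] del: times_divide_eq_right)
    show "set (coeffs H) \<subseteq> {z. of_int z / of_int c \<in> A}"
    proof
      fix z assume "z \<in> set (coeffs H)"
      then obtain m where "z = coeff H m" by (auto simp: coeffs_def split: if_splits)
      then show "z \<in> {z. of_int z / of_int c \<in> A}" using hA by simp
    qed
  qed
  then have "of_int c / of_int c \<in> A" by (simp add: c_def content_def)
  then show ?thesis using c0 by (simp add: A_def)
qed

text \<open>
  The integral case, applied to \<open>d I\<close> for a common denominator \<open>d\<close> of \<open>I\<close>.
\<close>

theorem iprod_inverse:
  assumes I: "fractional I"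
  shows "iprod I (inverse_ideal I) = \<O>"
proof
  show "iprod I (inverse_ideal I) \<subseteq> \<O>"
  proof
    fix x assume "x \<in> iprod I (inverse_ideal I)"
    then show "x \<in> \<O>" by (induction rule: iprod_induct) (auto simp: inverse_ideal_def)
  qed
  obtain d where d: "d \<in> \<O>" "d \<noteq> 0" "\<forall>x\<in>I. d * x \<in> \<O>" using I unfolding fractional_def by blast
  define J where "J = iprod (principal d) I"
  have J: "fractional J" unfolding J_def by (intro fractional_iprod fractional_principal I O_K d)
  have JO: "J \<subseteq> \<O>"
  proof
    fix x assume "x \<in> J"
    then show "x \<in> \<O>" unfolding J_def
    proof (induction rule: iprod_induct)
      case (mult x y)
      then obtain r where "r \<in> \<O>" "x = d * r" by (auto simp: principal_def)
      moreover have "r * (d * y) \<in> \<O>" using d(3) mult \<open>r \<in> \<O>\<close> by simp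
      ultimately show ?case by (simp add: mult_ac)
    qed auto
  qed
  have sub: "iprod (principal d) (inverse_ideal J) \<subseteq> inverse_ideal I"
  proof
    fix z assume "z \<in> iprod (principal d) (inverse_ideal J)"
    then show "z \<in> inverse_ideal I"
    proof (induction rule: iprod_induct)
      case (mult x y)
      then obtain r where r: "r \<in> \<O>" "x = d * r" by (auto simp: principal_def)
      have "w * (x * y) \<in> \<O>" if "w \<in> I" for w
      proof -
        have "x * w \<in> J" unfolding J_def using mult \<open>w \<in> I\<close> by (intro iprod_mult)
        then have "x * w * y \<in> \<O>" using mult by (auto simp: inverse_ideal_def)
        then show ?thesis by (simp add: mult_ac)
      qed
      moreover have "x * y \<in> K" using r mult d O_K by (auto simp: inverse_ideal_def)
      ultimately show ?case by (simp add: inverse_ideal_def)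
    next
      case (add x y)
      then show ?case using fractional_add[OF fractional_inverse[OF I]] by blast
    qed
  qed
  have "1 \<in> iprod J (inverse_ideal J)" using one_in_integral_inverse[OF J JO] .
  also have "\<dots> = iprod I (iprod (principal d) (inverse_ideal J))"
    unfolding J_def by (simp only: iprod_comm[of "principal d" I] iprod_assoc)
  also have "\<dots> \<subseteq> iprod I (inverse_ideal I)" by (rule iprod_mono[OF order_refl sub])
  finally have one: "1 \<in> iprod I (inverse_ideal I)" .
  show "\<O> \<subseteq> iprod I (inverse_ideal I)"
  proof
    fix r assume "r \<in> \<O>"
    then have "r * 1 \<in> iprod I (inverse_ideal I)"
      by (rule fractional_scale[OF fractional_iprod[OF I fractional_inverse[OF I]] _ one])
    then show "r \<in> iprod I (inverse_ideal I)" by simp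
  qed
qed

end

section \<open>Logarithmic derivatives modulo p\<close>

lemma vanishes_mod_0: "vanishes_mod p m 0"
  by (simp add: vanishes_mod_def)

lemma vanishes_mod_add: "vanishes_mod p m F \<Longrightarrow> vanishes_mod p m G \<Longrightarrow> vanishes_mod p m (F + G)"
  by (simp add: vanishes_mod_def pcompose_add)

lemma vanishes_mod_diff: "vanishes_mod p m F \<Longrightarrow> vanishes_mod p m G \<Longrightarrow> vanishes_mod p m (F - G)"
  by (simp add: vanishes_mod_def pcompose_diff)

lemma vanishes_mod_mult: "vanishes_mod p m F \<Longrightarrow> vanishes_mod p m (G * F)"
  unfolding vanishes_mod_def pcompose_mult coeff_mult
  by (intro allI impI dvd_sum dvd_mult) auto

lemma vanishes_mod_smult: "vanishes_mod p m F \<Longrightarrow> vanishes_mod p m (smult c F)"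
  using vanishes_mod_mult[of p m F "[:c:]"] by simp

lemma vanishes_mod_smult_p: "vanishes_mod p m (smult (int p * c) F)"
  by (simp add: vanishes_mod_def pcompose_smult mult.assoc)

lemma vanishes_mod_mono: "vanishes_mod p m F \<Longrightarrow> n \<le> m \<Longrightarrow> vanishes_mod p n F"
  by (simp add: vanishes_mod_def)

lemma vanishes_mod_eval: "vanishes_mod p m F \<Longrightarrow> 0 < m \<Longrightarrow> int p dvd poly F 1"
proof -
  assume "vanishes_mod p m F" "0 < m"
  then have "int p dvd coeff (F \<circ>\<^sub>p [:1, 1:]) 0" unfolding vanishes_mod_def by blast
  moreover have "coeff (F \<circ>\<^sub>p [:1, 1:]) 0 = poly F 1"
    using poly_pcompose[of F "[:1, 1:]" 0] by (simp add: poly_0_coeff_0)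
  ultimately show ?thesis by simp
qed

text \<open>
  The derivation \<open>X d/dX\<close>, which multiplies \<open>X\<^sup>n\<close> by \<open>n\<close>; under the substitution of the exponential
  series for \<open>X\<close> it is the ordinary derivative.
\<close>

definition euler_op :: "int poly \<Rightarrow> int poly" where
  "euler_op F = [:0, 1:] * pderiv F"

lemma euler_op_add: "euler_op (F + G) = euler_op F + euler_op G"
  by (simp add: euler_op_def pderiv_add algebra_simps)
lemma euler_op_diff: "euler_op (F - G) = euler_op F - euler_op G"
  by (simp add: euler_op_def pderiv_diff)
lemma euler_op_mult: "euler_op (F * G) = euler_op F * G + F * euler_op G"
  unfolding euler_op_def pderiv_mult by (simp add: algebra_simps)
lemma euler_op_smult: "euler_op (smult c F) = smult c (euler_op F)"
  by (simp add: euler_op_def pderiv_smult)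
lemma euler_op_sum: "euler_op (\<Sum>i\<in>I. F i) = (\<Sum>i\<in>I. euler_op (F i))"
  by (induction I rule: infinite_finite_induct) (auto simp: euler_op_add, simp_all add: euler_op_def)
lemma euler_op_const: "euler_op [:c:] = 0"
  by (simp add: euler_op_def pderiv_pCons)
lemma euler_op_monom: "euler_op (monom c n) = smult (int n) (monom c n)"
  by (cases n) (simp_all add: euler_op_def pderiv_monom smult_monom monom_Suc[symmetric] mult.commute)

lemma vanishes_mod_euler_op:
  assumes "vanishes_mod p (Suc m) F"
  shows "vanishes_mod p m (euler_op F)"
proof -
  have "pderiv F \<circ>\<^sub>p [:1, 1:] = pderiv (F \<circ>\<^sub>p [:1, 1:])" by (simp add: pderiv_pcompose pderiv_pCons)
  then have "vanishes_mod p m (pderiv F)"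
    using assms by (simp add: vanishes_mod_def coeff_pderiv)
  then show ?thesis unfolding euler_op_def by (rule vanishes_mod_mult)
qed

lemma vanishes_mod_euler_op_funpow:
  "vanishes_mod p (m + n) F \<Longrightarrow> vanishes_mod p n ((euler_op ^^ m) F)"
proof (induction m arbitrary: n)
  case (Suc m)
  then have "vanishes_mod p (Suc n) ((euler_op ^^ m) F)" by simp
  then show ?case by (simp add: vanishes_mod_euler_op)
qed simp

text \<open>
  A polynomial whose constant Taylor coefficient at \<open>1\<close> is prime to \<open>p\<close> is a unit modulo every power of \<open>X - 1\<close>.
\<close>

lemma vanishes_mod_cancel:
  assumes p: "Factorial_Ring.prime p" and G: "\<not> int p dvd poly G 1" and FG: "vanishes_mod p m (F * G)"
  shows "vanishes_mod p m F"
proof -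
  define f where "f = F \<circ>\<^sub>p [:1, 1:]"
  define g where "g = G \<circ>\<^sub>p [:1, 1:]"
  have g0: "\<not> int p dvd coeff g 0"
    using G poly_pcompose[of G "[:1, 1:]" 0] by (simp add: g_def poly_0_coeff_0)
  have fg: "int p dvd coeff (f * g) i" if "i < m" for i
    using FG that by (simp add: vanishes_mod_def f_def g_def pcompose_mult)
  have "int p dvd coeff f i" if "i < m" for i
    using that
  proof (induction i rule: less_induct)
    case (less i)
    have "coeff (f * g) i = (\<Sum>j<i. coeff f j * coeff g (i - j))
        + coeff f i * coeff g 0"
      unfolding coeff_mult by (simp add: lessThan_Suc_atMost[symmetric])
    moreover have "int p dvd (\<Sum>j<i. coeff f j * coeff g (i - j))"
      using less by (intro dvd_sum dvd_mult2) auto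
    ultimately have "int p dvd coeff f i * coeff g 0"
      using fg[OF less.prems] by (metis dvd_add_right_iff)
    then show ?case using g0 p by (simp add: prime_dvd_mult_iff)
  qed
  then show ?thesis by (simp add: vanishes_mod_def f_def)
qed

text \<open>
  The geometric sum of \<open>z X\<^sup>k\<close>. Modulo \<open>p\<close> and \<open>(X - 1)\<^sup>p\<close> it is, up to the constant \<open>1 - z\<close>, an inverse
  of \<open>1 - z X\<^sup>k\<close>, and iterating the derivation on it yields the sums \<open>\<Sum>j<p. j\<^sup>m z\<^sup>j\<close>.
\<close>

definition twist_poly :: "nat \<Rightarrow> int \<Rightarrow> nat \<Rightarrow> int poly" where
  "twist_poly p z k = (\<Sum>j<p. monom (z ^ j) (k * j))"

lemma euler_op_funpow_twist_poly:
  "(euler_op ^^ m) (twist_poly p z k) = (\<Sum>j<p. smult (int (k * j) ^ m) (monom (z ^ j) (k * j)))"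
proof (induction m)
  case (Suc m)
  show ?case by (simp add: Suc euler_op_sum euler_op_smult euler_op_monom mult_ac)
qed (simp add: twist_poly_def)

text \<open>
  Modulo \<open>p\<close>, \<open>X\<^sup>p - 1\<close> is \<open>(X - 1)\<^sup>p\<close>.
\<close>

lemma freshman_monom:
  assumes p: "Factorial_Ring.prime p"
  shows "vanishes_mod p p (monom 1 p - 1)"
proof -
  have p0: "p > 0" using p by (simp add: prime_gt_0_nat)
  have "int p dvd coeff ((monom 1 p - 1) \<circ>\<^sub>p [:1, 1:]) i" if "i < p" for i
  proof -
    have "(monom 1 p - 1) \<circ>\<^sub>p [:1, 1 :: int:] = [:1, 1:] ^ p - 1"
      by (simp add: pcompose_diff pcompose_1 monom_altdef pcompose_hom.hom_power pcompose_pCons)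
    moreover have "coeff ([:1, 1 :: int:] ^ p) i = int (p choose i)"
      using that by (subst coeff_linear_poly_power) auto
    moreover have "int p dvd int (p choose i) - (if i = 0 then 1 else 0)"
      using that p p0 by (auto intro!: dvd_choose_prime)
    ultimately show ?thesis by (cases "i = 0") (simp_all add: coeff_1)
  qed
  then show ?thesis by (simp add: vanishes_mod_def)
qed

lemma int_fermat:
  assumes p: "Factorial_Ring.prime p"
  shows "int p dvd z ^ p - z"
proof -
  have p0: "p > 0" using p by (simp add: prime_gt_0_nat)
  define w where "w = nat (z mod int p)"
  have w: "[z = int w] (mod int p)" using p0 by (simp add: w_def Cong.cong_def)
  have "[w ^ p = w] (mod p)"
  proof (cases "p dvd w")
    case True
    then show ?thesis using p0 by (simp add: Cong.cong_def dvd_power_same dvd_power mod_eq_0_iff_dvd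
        dvd_imp_mod_0[OF dvd_trans[OF True dvd_power[OF disjI1]]])
  next
    case False
    then have "[w * w ^ (p - 1) = w * 1] (mod p)" using fermat_theorem[OF p] by (intro cong_scalar_left)
    then show ?thesis using p0 by (cases p) auto
  qed
  then have "[int w ^ p = int w] (mod int p)" by (metis cong_int_iff of_nat_power)
  then have "[z ^ p = z] (mod int p)" using w by (meson cong_pow cong_sym cong_trans)
  then show ?thesis by (simp add: cong_iff_dvd_diff)
qed

lemma vanishes_mod_monom_multiple:
  assumes p: "Factorial_Ring.prime p"
  shows "vanishes_mod p p (monom 1 (k * p) - 1)"
proof (induction k)
  case (Suc k)
  have "monom 1 (Suc k * p) - 1
    = monom 1 (k * p) * (monom 1 p - 1) + (monom 1 (k * p) - (1 :: int poly))"
    by (simp add: algebra_simps mult_monom)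
  then show ?case using vanishes_mod_mult[OF freshman_monom[OF p]] Suc vanishes_mod_add by metis
qed (simp add: vanishes_mod_0)

lemma twist_poly_telescope:
  "(1 - monom z k) * twist_poly p z k = 1 - monom (z ^ p) (k * p)"
proof -
  have "twist_poly p z k = (\<Sum>j<p. (monom z k) ^ j)"
    unfolding twist_poly_def by (intro sum.cong refl) (simp add: monom_power mult.commute)
  then have "(1 - monom z k) * twist_poly p z k = 1 - monom z k ^ p"
    using one_diff_power_eq[of "monom z k" p] by simp
  then show ?thesis by (simp add: monom_power mult.commute)
qed

text \<open>
  \<open>D / u\<close> is the logarithmic derivative of \<open>F\<close> modulo \<open>p\<close> and \<open>(X - 1)\<^sup>m\<close>, written without denominators.
\<close>

definition log_deriv_mod :: "nat \<Rightarrow> nat \<Rightarrow> int \<Rightarrow> int poly \<Rightarrow> int poly \<Rightarrow> bool" where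
  "log_deriv_mod p m u D F \<longleftrightarrow> vanishes_mod p m (smult u (euler_op F) - D * F)"

lemma log_deriv_mod_mult:
  assumes "log_deriv_mod p m u D F" "log_deriv_mod p m u E G"
  shows "log_deriv_mod p m u (D + E) (F * G)"
proof -
  have "smult u (euler_op (F * G)) - (D + E) * (F * G)
    = G * (smult u (euler_op F) - D * F) + F * (smult u (euler_op G) - E * G)"
    by (simp add: euler_op_mult algebra_simps smult_add_right)
  then show ?thesis using assms unfolding log_deriv_mod_def
    by (metis vanishes_mod_add vanishes_mod_mult)
qed

lemma log_deriv_mod_1: "log_deriv_mod p m u 0 1"
  using euler_op_const[of 1] by (simp add: log_deriv_mod_def vanishes_mod_0 one_pCons)

lemma log_deriv_mod_power:
  "log_deriv_mod p m u D F \<Longrightarrow> log_deriv_mod p m u (smult (int n) D) (F ^ n)"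
proof (induction n)
  case (Suc n)
  then show ?case using log_deriv_mod_mult[of p m u D F "smult (int n) D" "F ^ n"]
    by (simp add: smult_add_left algebra_simps)
qed (simp add: log_deriv_mod_1)

lemma log_deriv_mod_prod:
  "(\<And>k. k \<in> A \<Longrightarrow> log_deriv_mod p m u (D k) (F k)) \<Longrightarrow> log_deriv_mod p m u (\<Sum>k\<in>A. D k) (\<Prod>k\<in>A. F k)"
  by (induction A rule: infinite_finite_induct) (auto simp: log_deriv_mod_1 log_deriv_mod_mult)

lemma log_deriv_mod_monom: "log_deriv_mod p m u [:u * int t:] (monom c t)"
  by (simp add: log_deriv_mod_def euler_op_monom vanishes_mod_0)

text \<open>
  Let \<open>B = a + b X\<^sup>k\<close> and let \<open>T\<close> be the geometric sum of \<open>z X\<^sup>k\<close>. As \<open>B \<equiv> a (1 - z X\<^sup>k)\<close> modulo \<open>p\<close>, telescoping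
  gives \<open>B T \<equiv> a (1 - z) \<equiv> u\<close>. The derivative of \<open>B\<close> is \<open>k (B - a)\<close>, and
  \<open>u k (B - a) - k (u - a T) B = k a (B T - u)\<close>.
\<close>

lemma log_deriv_mod_binomial:
  assumes p: "Factorial_Ring.prime p" and z: "int p dvd z * a + b"
  defines "u \<equiv> a + b"
  shows "log_deriv_mod p p u (smult (int k) ([:u:] - smult a (twist_poly p z k))) ([:a:] + monom b k)"
proof -
  define B where "B = [:a:] + monom b k"
  define T where "T = twist_poly p z k"
  obtain c where c: "z * a + b = int p * c" using z ..
  have "int p dvd z ^ p - z" by (rule int_fermat[OF p])
  then obtain d where d: "z ^ p - z = int p * d" ..
  have B: "B = smult a (1 - monom z k) + smult (int p * c) (monom 1 k)"
    unfolding B_def c[symmetric]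
    by (simp add: smult_diff_right smult_monom algebra_simps one_pCons flip: add_monom)
  have "B * T - [:u:] = smult a ((1 - monom z k) * T) - [:u:] + smult (int p * c) (monom 1 k * T)"
    unfolding B by (simp add: algebra_simps)
  also have "smult a ((1 - monom z k) * T) = smult a (1 - monom (z ^ p) (k * p))"
    unfolding T_def twist_poly_telescope ..
  also have "\<dots> = smult (- a * z ^ p) (monom 1 (k * p) - 1) + [:a - a * z ^ p:]"
    by (intro poly_eqI) (auto simp: coeff_1 coeff_pCons algebra_simps split: nat.splits)
  also have "a - a * z ^ p = u - int p * (a * d + c)"
  proof -
    have zp: "z ^ p = z + int p * d" using d by simp
    show ?thesis unfolding u_def zp using c by (simp add: algebra_simps)
  qed
  finally have "B * T - [:u:] = smult (- a * z ^ p) (monom 1 (k * p) - 1)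
      + smult (int p * (- (a * d + c))) 1 + smult (int p * c) (monom 1 k * T)"
    by (simp add: one_pCons algebra_simps)
  then have BT: "vanishes_mod p p (B * T - [:u:])"
    using vanishes_mod_monom_multiple[OF p]
    by (simp only: vanishes_mod_add vanishes_mod_smult vanishes_mod_smult_p)
  have eB: "euler_op B = smult (int k) (B - [:a:])"
    unfolding B_def by (simp add: euler_op_add euler_op_const euler_op_monom)
  have "smult u (euler_op B) - smult (int k) ([:u:] - smult a T) * B = smult (int k * a) (B * T - [:u:])"
    unfolding eB by (simp add: smult_diff_right algebra_simps)
  then show ?thesis unfolding log_deriv_mod_def B_def[symmetric] T_def[symmetric]
    using vanishes_mod_smult[OF BT] by simp
qed

lemma funpow_euler_op_add: "(euler_op ^^ m) (F + G) = (euler_op ^^ m) F + (euler_op ^^ m) G"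
  by (induction m) (auto simp: euler_op_add)
lemma funpow_euler_op_diff: "(euler_op ^^ m) (F - G) = (euler_op ^^ m) F - (euler_op ^^ m) G"
  by (induction m) (auto simp: euler_op_diff)
lemma funpow_euler_op_smult: "(euler_op ^^ m) (smult c F) = smult c ((euler_op ^^ m) F)"
  by (induction m) (auto simp: euler_op_smult)
lemma funpow_euler_op_sum: "(euler_op ^^ m) (\<Sum>i\<in>I. F i) = (\<Sum>i\<in>I. (euler_op ^^ m) (F i))"
  by (induction m) (auto simp: euler_op_sum)
lemma funpow_euler_op_const: "m > 0 \<Longrightarrow> (euler_op ^^ m) [:c:] = 0"
proof (induction m)
  case (Suc m)
  then show ?case using euler_op_const[of 0] by (cases m) (auto simp: euler_op_const)
qed simp

lemma poly_funpow_euler_op_log_deriv: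
  assumes "m > 0"
  shows "poly ((euler_op ^^ m) (smult (int k) ([:u:] - smult a (twist_poly p z k)))) 1
    = - a * int k ^ Suc m * (\<Sum>j<p. int j ^ m * z ^ j)"
  unfolding funpow_euler_op_smult funpow_euler_op_diff funpow_euler_op_const[OF assms] euler_op_funpow_twist_poly
  by (simp add: poly_sum poly_monom sum_distrib_left power_mult_distrib mult_ac sum_negf)

text \<open>
  Let \<open>P \<equiv> Q\<close> be the given congruence. Their logarithmic derivatives agree up to one order less, because
  \<open>P\<close> can be cancelled. Applying the derivation \<open>m\<close> times and evaluating at \<open>1\<close> leaves \<open>-a S\<close> times
  \<open>\<Sum>k. n k \<cdot> k\<^bsup>m+1\<^esup>\<close> for \<open>P\<close>, and the same with \<open>p - k\<close> in place of \<open>k\<close> for \<open>Q\<close>, where \<open>S\<close> is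
  the sum in the conclusion. Since \<open>m + 1\<close> is odd, the two sums are congruent to \<open>1\<close> and \<open>-1\<close>, and \<open>p\<close> divides \<open>2 a S\<close>.
\<close>

theorem power_sum_dvd_of_congruence:
  fixes n :: "nat \<Rightarrow> nat" and a b z e :: int
  assumes p: "Factorial_Ring.prime p" "p > 2"
    and a: "\<not> int p dvd a" and ab: "\<not> int p dvd a + b" and z: "int p dvd z * a + b"
    and m: "0 < m" "even m" "m + 3 \<le> p"
    and n: "\<And>k. k \<in> {1..<p} \<Longrightarrow> int p dvd int (n k) * int k ^ Suc m + 1"
    and cong: "vanishes_mod p (p - 1) ((\<Prod>k\<in>{1..<p}. ([:a:] + monom b k) ^ n k)
      - monom e t * (\<Prod>k\<in>{1..<p}. ([:a:] + monom b (p - k)) ^ n k))"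
  shows "int p dvd (\<Sum>j<p. int j ^ m * z ^ j)"
proof -
  define u where "u = a + b"
  define D where "D k = smult (int k) ([:u:] - smult a (twist_poly p z k))" for k
  define S where "S = (\<Sum>j<p. int j ^ m * z ^ j)"
  define P where "P = (\<Prod>k\<in>{1..<p}. ([:a:] + monom b k) ^ n k)"
  define Q where "Q = monom e t * (\<Prod>k\<in>{1..<p}. ([:a:] + monom b (p - k)) ^ n k)"
  define W where "W = (\<Sum>k\<in>{1..<p}. int (n k) * int k ^ Suc m - int (n k) * int (p - k) ^ Suc m)"
  define DP where "DP = (\<Sum>k\<in>{1..<p}. smult (int (n k)) (D k))"
  define DQ where "DQ = [:u * int t:] + (\<Sum>k\<in>{1..<p}. smult (int (n k)) (D (p - k)))"
  have mono: "log_deriv_mod p (p - 2) u E F" if "log_deriv_mod p p u E F" for E F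
    using that vanishes_mod_mono unfolding log_deriv_mod_def by (metis diff_le_self)
  have LB: "log_deriv_mod p (p - 2) u (D k) ([:a:] + monom b k)" for k
    unfolding D_def by (rule mono[OF log_deriv_mod_binomial[OF p(1) z, of k, folded u_def]])
  have LP: "log_deriv_mod p (p - 2) u DP P"
    unfolding DP_def P_def by (intro log_deriv_mod_prod log_deriv_mod_power LB)
  have LQ: "log_deriv_mod p (p - 2) u DQ Q"
    unfolding DQ_def Q_def by (intro log_deriv_mod_mult log_deriv_mod_monom log_deriv_mod_prod log_deriv_mod_power LB)
  have PQ: "vanishes_mod p (Suc (p - 2)) (P - Q)"
    using cong p(2) unfolding P_def Q_def by (simp add: Suc_diff_Suc numeral_2_eq_2)
  have "(DP - DQ) * P = smult u (euler_op (P - Q)) - (smult u (euler_op P) - DP * P)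
      + (smult u (euler_op Q) - DQ * Q) - DQ * (P - Q)"
    by (simp add: euler_op_diff smult_diff_right algebra_simps)
  moreover have "vanishes_mod p (p - 2) (smult u (euler_op (P - Q)))"
    by (intro vanishes_mod_smult vanishes_mod_euler_op PQ)
  moreover have "vanishes_mod p (p - 2) (DQ * (P - Q))"
    by (intro vanishes_mod_mult vanishes_mod_mono[OF PQ]) simp
  ultimately have "vanishes_mod p (p - 2) ((DP - DQ) * P)"
    using LP LQ unfolding log_deriv_mod_def by (simp only: vanishes_mod_add vanishes_mod_diff)
  moreover have "\<not> int p dvd poly P 1"
  proof -
    have "poly P 1 = u ^ (\<Sum>k\<in>{1..<p}. n k)"
      by (simp add: P_def u_def poly_prod poly_monom power_sum)
    moreover have "\<not> int p dvd u ^ N" for N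
      using ab p(1) prime_dvd_power[of "int p" u N] by (auto simp: u_def)
    ultimately show ?thesis by simp
  qed
  ultimately have "vanishes_mod p (p - 2) (DP - DQ)" using vanishes_mod_cancel[OF p(1)] by blast
  then have "vanishes_mod p (m + 1) (DP - DQ)" using m(3) by (elim vanishes_mod_mono) simp
  then have "vanishes_mod p 1 ((euler_op ^^ m) (DP - DQ))" by (rule vanishes_mod_euler_op_funpow)
  then have "int p dvd poly ((euler_op ^^ m) (DP - DQ)) 1" by (rule vanishes_mod_eval) simp
  moreover have "poly ((euler_op ^^ m) (DP - DQ)) 1
    = - a * S * (\<Sum>k\<in>{1..<p}. int (n k) * int k ^ Suc m - int (n k) * int (p - k) ^ Suc m)"
  proof -
    have D1: "poly ((euler_op ^^ m) (D k)) 1 = - a * int k ^ Suc m * S" for k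
      unfolding D_def S_def by (rule poly_funpow_euler_op_log_deriv[OF m(1)])
    show ?thesis
      unfolding DP_def DQ_def funpow_euler_op_diff funpow_euler_op_add funpow_euler_op_sum
        funpow_euler_op_smult funpow_euler_op_const[OF m(1)]
      by (simp only: poly_diff poly_add poly_sum poly_smult poly_0 D1 sum_subtractf sum_distrib_left
          right_diff_distrib add_0_left) (simp only: mult_ac)
  qed
  ultimately have dvd: "int p dvd a * S * W" by (simp add: W_def)
  have "[W = (\<Sum>k\<in>{1..<p}. -2)] (mod int p)"
    unfolding W_def
  proof (intro cong_sum)
    fix k assume k: "k \<in> {1..<p}"
    have "[int (p - k) = - int k] (mod int p)" using k by (simp add: of_nat_diff cong_iff_dvd_diff)
    then have "[int (p - k) ^ Suc m = (- int k) ^ Suc m] (mod int p)" by (rule cong_pow)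
    moreover have "(- int k) ^ Suc m = - (int k ^ Suc m)" using m(2) by (simp add: power_minus_odd)
    ultimately have "[int (n k) * int (p - k) ^ Suc m = int (n k) * - (int k ^ Suc m)] (mod int p)"
      by (metis cong_scalar_left)
    moreover have "[int (n k) * int k ^ Suc m = -1] (mod int p)"
      using n[OF k] by (simp add: cong_iff_dvd_diff)
    moreover from this have "[int (n k) * - (int k ^ Suc m) = - (-1)] (mod int p)"
      by (simp only: mult_minus_right cong_minus_minus_iff)
    ultimately have "[int (n k) * int k ^ Suc m - int (n k) * int (p - k) ^ Suc m = -1 - (- (-1))] (mod int p)"
      by (meson cong_diff cong_trans)
    then show "[int (n k) * int k ^ Suc m - int (n k) * int (p - k) ^ Suc m = -2] (mod int p)" by simp
  qed
  \<comment> \<open>Each of the \<open>p - 1\<close> terms of \<open>W\<close> is \<open>-1 - 1\<close> modulo \<open>p\<close>, so \<open>W \<equiv> 2\<close>.\<close>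
  moreover have "(\<Sum>k\<in>{1..<p}. -2) = 2 - 2 * int p" using p(2) by (simp add: of_nat_diff)
  ultimately have "int p dvd W - (2 - 2 * int p)" by (simp only: cong_iff_dvd_diff)
  then obtain q where "W - (2 - 2 * int p) = int p * q" ..
  then have W: "W = 2 + int p * (q - 2)" by (simp add: algebra_simps)
  have "a * S * W = a * S * 2 + int p * (a * S * (q - 2))" unfolding W by (simp add: algebra_simps)
  then have "int p dvd a * S * 2" using dvd by (metis dvd_add_left_iff dvd_triv_left)
  moreover have "\<not> int p dvd 2" using p(2) by (auto dest: zdvd_imp_le)
  ultimately show ?thesis using a p(1) unfolding S_def[symmetric] by (simp add: prime_dvd_mult_iff)
qed

section \<open>Fermat's equation in the cyclotomic field\<close>

lemma coprime_int_bezout: "coprime a b \<Longrightarrow> \<exists>u v. u * a + v * b = (1 :: int)"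
  using bezout_int[of a b] by simp

context cyclotomic begin

definition comaximal :: "complex \<Rightarrow> complex \<Rightarrow> bool" where
  "comaximal x y \<longleftrightarrow> (\<exists>u\<in>\<O>. \<exists>v\<in>\<O>. u * x + v * y = 1)"

lemma comaximal_sym: "comaximal x y \<Longrightarrow> comaximal y x"
  unfolding comaximal_def by (metis add.commute)

lemma comaximal_mult:
  assumes "x \<in> \<O>" "y \<in> \<O>" "z \<in> \<O>" "comaximal x y" "comaximal x z"
  shows "comaximal x (y * z)"
proof -
  obtain u v where uv: "u \<in> \<O>" "v \<in> \<O>" "u * x + v * y = 1" using assms(4) unfolding comaximal_def by blast
  obtain u' v' where uv': "u' \<in> \<O>" "v' \<in> \<O>" "u' * x + v' * z = 1" using assms(5) unfolding comaximal_def by blast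
  have "(u * (u' * x + v' * z) + v * y * u') * x + (v * v') * (y * z) = (u * x + v * y) * (u' * x + v' * z)"
    by (simp add: algebra_simps)
  also have "\<dots> = 1" using uv uv' by simp
  finally show ?thesis unfolding comaximal_def using assms uv uv' by (metis O_add O_mult)
qed

lemma comaximal_1: "comaximal x 1"
  unfolding comaximal_def by (intro bexI[of _ 0] bexI[of _ 1]) simp_all

lemma comaximal_prod:
  assumes "x \<in> \<O>" "\<And>i. i \<in> A \<Longrightarrow> f i \<in> \<O>" "\<And>i. i \<in> A \<Longrightarrow> comaximal x (f i)"
  shows "comaximal x (\<Prod>i\<in>A. f i)"
  using assms(2,3)
  by (induction A rule: infinite_finite_induct) (auto intro!: comaximal_1 comaximal_mult assms(1) O_prod)

lemma comaximal_power:
  assumes "x \<in> \<O>" "y \<in> \<O>" "comaximal x y"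
  shows "comaximal x (y ^ n)"
  using comaximal_prod[of x "{..<n}" "\<lambda>_. y"] assms by simp

text \<open>
  Up to a power of \<open>\<zeta>\<close>, the difference is a factor of \<open>p = \<Prod>j. 1 - \<zeta>\<^sup>j\<close>.
\<close>

lemma zeta_diff_dvd_p:
  assumes "k mod p \<noteq> l mod p"
  shows "\<exists>w\<in>\<O>. of_nat p = (\<zeta> ^ k - \<zeta> ^ l) * w"
proof -
  define m where "m = (l + (p - 1) * k) mod p"
  have k0: "k + (p - 1) * k = p * k" using gt2 by (cases p) auto
  have zk: "\<zeta> ^ k * \<zeta> ^ ((p - 1) * k) = 1"
    unfolding power_add[symmetric] k0 by (simp add: zeta_power_eq_1_iff)
  have zm: "\<zeta> ^ m = \<zeta> ^ l * \<zeta> ^ ((p - 1) * k)" by (simp only: m_def zeta_power_mod power_add)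
  then have zm': "(\<zeta> ^ k - \<zeta> ^ l) * \<zeta> ^ ((p - 1) * k) = 1 - \<zeta> ^ m" using zk by (simp only: left_diff_distrib)
  have "m \<noteq> 0"
  proof
    assume "m = 0"
    then have "\<zeta> ^ l * \<zeta> ^ ((p - 1) * k) = \<zeta> ^ k * \<zeta> ^ ((p - 1) * k)" using zm zk by simp
    then have "\<zeta> ^ l = \<zeta> ^ k" using zeta_nonzero by (metis mult_right_cancel power_not_zero)
    then show False using assms zeta_power_eq_iff by metis
  qed
  moreover have "m < p" using gt2 by (simp add: m_def)
  ultimately have m: "m \<in> {1..<p}" by simp
  define w where "w = \<zeta> ^ ((p - 1) * k) * (\<Prod>j\<in>{1..<p} - {m}. 1 - \<zeta> ^ j)"
  have "of_nat p = (1 - \<zeta> ^ m) * (\<Prod>j\<in>{1..<p} - {m}. 1 - \<zeta> ^ j)"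
    using prod_one_minus_zeta prod.remove[OF _ m, of "\<lambda>j. 1 - \<zeta> ^ j"] by (metis finite_atLeastLessThan)
  then have "of_nat p = (\<zeta> ^ k - \<zeta> ^ l) * w" unfolding w_def zm'[symmetric] by (simp only: mult.assoc)
  moreover have "w \<in> \<O>" unfolding w_def by (intro O_mult O_power O_zeta O_prod O_diff O_1)
  ultimately show ?thesis by blast
qed

fun ipow :: "complex set \<Rightarrow> nat \<Rightarrow> complex set" where
  "ipow I 0 = \<O>" | "ipow I (Suc n) = iprod (ipow I n) I"

lemma fractional_ipow: "fractional I \<Longrightarrow> fractional (ipow I n)"
  by (induction n) (auto intro: fractional_O fractional_iprod)

lemma power_in_ipow: "x \<in> I \<Longrightarrow> x ^ n \<in> ipow I n"
proof (induction n)
  case (Suc n)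
  then have "x ^ n * x \<in> iprod (ipow I n) I" by (intro iprod_mult)
  then show ?case by (simp add: mult.commute)
qed simp

definition two_generated :: "complex \<Rightarrow> complex \<Rightarrow> complex set" where
  "two_generated x y = {u * x + v * y | u v. u \<in> \<O> \<and> v \<in> \<O>}"

lemma two_generated_I: "u \<in> \<O> \<Longrightarrow> v \<in> \<O> \<Longrightarrow> u * x + v * y \<in> two_generated x y"
  unfolding two_generated_def by blast

lemma two_generated_mem: "x \<in> two_generated x y" "y \<in> two_generated x y"
  using two_generated_I[of 1 0 x y] two_generated_I[of 0 1 x y] by auto

lemma fractional_two_generated:
  assumes x: "x \<in> \<O>" "x \<noteq> 0" and y: "y \<in> \<O>"
  shows "fractional (two_generated x y)"
proof -
  have sub: "two_generated x y \<subseteq> \<O>" using x y by (auto simp: two_generated_def)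
  moreover have "s + t \<in> two_generated x y" if st: "s \<in> two_generated x y" "t \<in> two_generated x y" for s t
  proof -
    obtain u v u' v' where *: "u \<in> \<O>" "v \<in> \<O>" "u' \<in> \<O>" "v' \<in> \<O>" "s = u * x + v * y" "t = u' * x + v' * y"
      using st by (auto simp: two_generated_def)
    have "s + t = (u + u') * x + (v + v') * y" using * by (simp add: algebra_simps)
    then show ?thesis using two_generated_I * by (metis O_add)
  qed
  moreover have "r * s \<in> two_generated x y" if rs: "r \<in> \<O>" "s \<in> two_generated x y" for r s
  proof -
    obtain u v where *: "u \<in> \<O>" "v \<in> \<O>" "s = u * x + v * y" using rs by (auto simp: two_generated_def)
    have "r * s = (r * u) * x + (r * v) * y" using * by (simp add: algebra_simps)
    then show ?thesis using two_generated_I * rs(1) by (metis O_mult)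
  qed
  moreover have "\<exists>d\<in>\<O>. d \<noteq> 0 \<and> (\<forall>x\<in>two_generated x y. d * x \<in> \<O>)"
    using sub by (intro bexI[of _ 1]) auto
  moreover have "two_generated x y \<subseteq> K" using sub O_K by blast
  ultimately show ?thesis unfolding fractional_def using two_generated_mem(1)[of x y] x(2) by blast
qed

text \<open>
  If \<open>x y = z\<^sup>n\<close> with \<open>x\<close> and \<open>y\<close> comaximal, then \<open>(x)\<close> is the \<open>n\<close>-th power of \<open>(x, z)\<close>. Elements of \<open>(x, z)\<^sup>n\<close>
  have the form \<open>r x + s z\<^sup>n\<close>, a multiple of \<open>x\<close>; conversely the power contains \<open>x\<^sup>n\<close> and
  \<open>z\<^sup>n = x y\<close>, hence \<open>x\<close>.
\<close>

lemma ipow_two_generated: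
  assumes x: "x \<in> \<O>" "x \<noteq> 0" and y: "y \<in> \<O>" and z: "z \<in> \<O>"
    and n: "n > 0" and eq: "x * y = z ^ n" and com: "comaximal x y"
  shows "ipow (two_generated x z) n = principal x"
proof
  have span: "\<exists>r\<in>\<O>. \<exists>s\<in>\<O>. t = r * x + s * z ^ m" if "t \<in> ipow (two_generated x z) m" for t m
    using that
  proof (induction m arbitrary: t)
    case 0
    then show ?case by (intro bexI[of _ 0] bexI[of _ t]) auto
  next
    case (Suc m)
    from Suc.prems have "t \<in> iprod (ipow (two_generated x z) m) (two_generated x z)" by simp
    then show ?case
    proof (induction rule: iprod_induct)
      case (mult s t)
      obtain r1 r2 where r: "r1 \<in> \<O>" "r2 \<in> \<O>" "s = r1 * x + r2 * z ^ m" using Suc.IH[OF mult(1)] by blast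
      obtain u v where uv: "u \<in> \<O>" "v \<in> \<O>" "t = u * x + v * z" using mult(2) by (auto simp: two_generated_def)
      have "s * t = (r1 * t + r2 * z ^ m * u) * x + (r2 * v) * z ^ Suc m"
        unfolding r(3) by (simp add: uv(3) algebra_simps)
      moreover have "t \<in> \<O>" using uv x z by simp
      ultimately show ?case using r uv z by (metis O_add O_mult O_power)
    next
      case (add s t)
      then obtain r1 r2 r1' r2' where r: "r1 \<in> \<O>" "r2 \<in> \<O>" "r1' \<in> \<O>" "r2' \<in> \<O>"
        "s = r1 * x + r2 * z ^ Suc m" "t = r1' * x + r2' * z ^ Suc m" by blast
      have "s + t = (r1 + r1') * x + (r2 + r2') * z ^ Suc m"
        unfolding r(5,6) by (simp only: distrib_right add_ac)
      then show ?case using r by (metis O_add)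
    qed
  qed
  show "ipow (two_generated x z) n \<subseteq> principal x"
  proof
    fix t assume "t \<in> ipow (two_generated x z) n"
    then obtain r s where rs: "r \<in> \<O>" "s \<in> \<O>" "t = r * x + s * z ^ n"
      using span by blast
    then have "t = x * (r + s * y)" unfolding eq[symmetric] by (simp add: algebra_simps)
    moreover have "r + s * y \<in> \<O>" using rs y by simp
    ultimately show "t \<in> principal x" unfolding principal_def by blast
  qed
  have frac: "fractional (ipow (two_generated x z) n)"
    by (intro fractional_ipow fractional_two_generated x z)
  have "comaximal y (x ^ (n - 1))" by (intro comaximal_power y x comaximal_sym[OF com])
  then obtain v u where uv: "u \<in> \<O>" "v \<in> \<O>" "v * y + u * x ^ (n - 1) = 1" unfolding comaximal_def by blast
  have "x ^ n = x * x ^ (n - 1)" using n by (cases n) auto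
  then have "u * x ^ n + v * z ^ n = x * (v * y + u * x ^ (n - 1))"
    unfolding eq[symmetric] by (simp add: algebra_simps)
  also have "\<dots> = x" unfolding uv(3) by simp
  finally have "x = u * x ^ n + v * z ^ n" ..
  also have "\<dots> \<in> ipow (two_generated x z) n"
    by (intro fractional_add[OF frac] fractional_scale[OF frac] uv power_in_ipow two_generated_mem)
  finally have "x \<in> ipow (two_generated x z) n" .
  then show "principal x \<subseteq> ipow (two_generated x z) n"
    using fractional_scale[OF frac] by (auto simp: principal_def mult.commute[of x])
qed

lemma principal_eq_imp_associated:
  assumes x: "x \<in> K" "x \<noteq> 0" and eq: "principal x = principal y"
  shows "\<exists>u\<in>\<O>. inverse u \<in> \<O> \<and> x = u * y"
proof -
  have "x \<in> principal x" "y \<in> principal y" unfolding principal_def using O_1 by (metis image_eqI mult.right_neutral)+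
  then obtain u v where uv: "u \<in> \<O>" "x = y * u" "v \<in> \<O>" "y = x * v" using eq unfolding principal_def by blast
  then have "x * 1 = x * (u * v)" by (simp add: mult_ac)
  then have "u * v = 1" using x by simp
  then have "inverse u = v" by (rule inverse_unique)
  then show ?thesis using uv by (auto simp: mult.commute)
qed

lemma O_root: "x \<in> K \<Longrightarrow> x ^ p \<in> \<O> \<Longrightarrow> x \<in> \<O>"
proof -
  assume x: "x \<in> K" "x ^ p \<in> \<O>"
  have "algebraic_int x"
    by (rule algebraic_int_root[where y = "x ^ p" and p = "monom 1 p"])
      (use gt2 O_int[OF x(2)] in \<open>auto simp: poly_monom degree_monom_eq\<close>)
  then show ?thesis using x by (simp add: \<O>_def)
qed

lemma p_dvd_of_int: "w \<in> \<O> \<Longrightarrow> of_int m = of_nat p * w \<Longrightarrow> int p dvd m"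
proof -
  assume w: "w \<in> \<O>" and eq: "of_int m = of_nat p * w"
  then have "w = of_int m / of_nat p" using gt2 by simp
  then have "w \<in> \<rat>" by simp
  then obtain n where "w = of_int n" using O_Rats_Ints[OF w] by (auto elim: Ints_cases)
  then have "complex_of_int m = of_int (int p * n)" using eq by simp
  then show ?thesis by (simp only: of_int_eq_iff dvd_triv_left)
qed

end

locale fermat_first_case = cyclotomic +
  fixes a b c :: int
  assumes fermat: "a ^ p + b ^ p + c ^ p = 0" and coprime_ab: "coprime a b" and c: "\<not> int p dvd c"
begin

definition lin :: "nat \<Rightarrow> complex" where "lin k = of_int a + \<zeta> ^ k * of_int b"

lemma lin_O [simp]: "lin k \<in> \<O>" by (simp add: lin_def)

lemma prod_lin: "(\<Prod>k<p. lin k) = of_int (- c) ^ p"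
proof -
  have "(\<Prod>k<p. lin k) = of_int (a ^ p + b ^ p)" unfolding lin_def prod_add_zeta by simp
  also have "a ^ p + b ^ p = (- c) ^ p" using fermat power_minus_odd[OF odd_p, of c] by simp
  finally show ?thesis by simp
qed

lemma c_nonzero: "c \<noteq> 0" using c by auto

lemma lin_cofactor:
  assumes "k < p"
  shows "lin k * (\<Prod>j\<in>{..<p} - {k}. lin j) = of_int (- c) ^ p"
  using assms prod.remove[of "{..<p}" k lin] prod_lin by simp

lemma lin_nonzero: "k < p \<Longrightarrow> lin k \<noteq> 0"
  using lin_cofactor[of k] c_nonzero by (metis mult_zero_left neg_equal_0_iff_equal of_int_eq_0_iff power_not_zero)

text \<open>
  As \<open>a\<close> and \<open>b\<close> are coprime, the ideal generated by the two factors contains the difference of the two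
  roots of unity, hence \<open>p\<close>; it also contains a power of \<open>c\<close>, which is prime to \<open>p\<close>.
\<close>

lemma comaximal_lin:
  assumes k: "k < p" and l: "l < p" and kl: "k \<noteq> l"
  shows "comaximal (lin k) (lin l)"
proof -
  define T where "T = two_generated (lin k) (lin l)"
  have T: "fractional T" unfolding T_def by (intro fractional_two_generated lin_O lin_nonzero k)
  have kT: "lin k \<in> T" and lT: "lin l \<in> T" unfolding T_def by (rule two_generated_mem)+
  obtain u v where uv: "u * a + v * b = 1" using coprime_int_bezout[OF coprime_ab] by blast
  have "of_int v * (lin k - lin l) - of_int u * (\<zeta> ^ l * lin k - \<zeta> ^ k * lin l)
      = (\<zeta> ^ k - \<zeta> ^ l) * of_int (u * a + v * b)"
  proof -
    have "V * ((A + x * B) - (A + y * B)) - U * (y * (A + x * B) - x * (A + y * B)) = (x - y) * (U * A + V * B)"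
      for U V A B x y :: complex by (simp add: algebra_simps)
    then show ?thesis unfolding lin_def of_int_add of_int_mult .
  qed
  also have "\<dots> = \<zeta> ^ k - \<zeta> ^ l" unfolding uv by simp
  finally have "\<zeta> ^ k - \<zeta> ^ l = of_int v * (lin k - lin l) - of_int u * (\<zeta> ^ l * lin k - \<zeta> ^ k * lin l)" ..
  also have "\<dots> \<in> T"
    by (intro fractional_diff[OF T] fractional_scale[OF T] kT lT O_of_int O_power O_zeta)
  finally have zT: "\<zeta> ^ k - \<zeta> ^ l \<in> T" .
  have "k mod p \<noteq> l mod p" using assms by simp
  then obtain w where w: "w \<in> \<O>" "of_nat p = (\<zeta> ^ k - \<zeta> ^ l) * w" using zeta_diff_dvd_p by blast
  have pT: "of_nat p \<in> T" unfolding w(2) using fractional_scale[OF T w(1) zT] by (simp add: mult.commute)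
  have "(\<Prod>j\<in>{..<p} - {k}. lin j) \<in> \<O>" by (intro O_prod lin_O)
  from fractional_scale[OF T this kT] have cT: "of_int ((- c) ^ p) \<in> T"
    using lin_cofactor[OF k] by (simp add: mult.commute)
  have "coprime (int p) ((- c) ^ p)"
  proof (rule prime_imp_coprime)
    show "\<not> int p dvd (- c) ^ p"
      using c prime prime_dvd_power[of "int p" "- c" p] by auto
  qed (use prime in simp)
  then obtain s t where st: "s * int p + t * (- c) ^ p = 1" by (elim coprime_int_bezout[THEN exE] exE)
  have "of_int s * of_nat p + of_int t * of_int ((- c) ^ p) \<in> T"
    by (intro fractional_add[OF T] fractional_scale[OF T] O_of_int pT cT)
  moreover have "of_int s * of_nat p + of_int t * of_int ((- c) ^ p) = complex_of_int (s * int p + t * (- c) ^ p)"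
    by simp
  ultimately have "1 \<in> T" using st by simp
  then show ?thesis unfolding T_def two_generated_def comaximal_def by force
qed

theorem lin_1_is_pth_power:
  obtains I where "fractional I" "ipow I p = principal (lin 1)"
proof -
  have 1: "1 < p" using gt2 by simp
  define \<beta> where "\<beta> = (\<Prod>j\<in>{..<p} - {1}. lin j)"
  have "comaximal (lin 1) \<beta>"
    unfolding \<beta>_def by (intro comaximal_prod lin_O comaximal_lin 1) auto
  moreover have "\<beta> \<in> \<O>" unfolding \<beta>_def by (intro O_prod lin_O)
  moreover have "lin 1 * \<beta> = of_int (- c) ^ p" unfolding \<beta>_def by (rule lin_cofactor[OF 1])
  ultimately have "ipow (two_generated (lin 1) (of_int (- c))) p = principal (lin 1)"
    using gt2 by (intro ipow_two_generated lin_O lin_nonzero 1 O_of_int) auto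
  moreover have "fractional (two_generated (lin 1) (of_int (- c)))"
    by (intro fractional_two_generated lin_O lin_nonzero 1 O_of_int)
  ultimately show thesis using that by blast
qed

lemma sig_lin: "\<not> p dvd k \<Longrightarrow> sig k (lin j) = lin (j * k)"
  unfolding lin_def by (simp add: sig_add sig_mult sig_power power_mult[symmetric] mult.commute)

lemma lin_cong: "j mod p = k mod p \<Longrightarrow> lin j = lin k"
  unfolding lin_def using zeta_power_cong by metis

text \<open>
  Let \<open>A = u g\<^sup>p\<close> be the product, \<open>A'\<close> and \<open>g'\<close> the complex conjugates of \<open>A\<close> and \<open>g\<close>, and \<open>v\<close> the quotient of
  \<open>u\<close> by its conjugate. Then \<open>A g'\<^sup>p = v A' g\<^sup>p\<close>. Modulo \<open>p\<close>, both \<open>p\<close>-th powers are the same rational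
  integer \<open>r\<close>; it is prime to \<open>p\<close>, because \<open>A\<close> divides a power of \<open>c\<close>, and can be cancelled. Hence
  \<open>A \<equiv> v A'\<close>, and \<open>v\<close> is a root of unity up to sign.
\<close>

theorem congruence_of_pth_power:
  assumes g: "g \<in> K" and u: "u \<in> \<O>" "inverse u \<in> \<O>"
    and eq: "(\<Prod>k\<in>{1..<p}. lin k ^ n k) = u * g ^ p"
  obtains e t where "vanishes_mod p (p - 1) ((\<Prod>k\<in>{1..<p}. ([:a:] + monom b k) ^ n k)
      - monom e t * (\<Prod>k\<in>{1..<p}. ([:a:] + monom b (p - k)) ^ n k))"
proof -
  define A where "A = (\<Prod>k\<in>{1..<p}. lin k ^ n k)"
  define A' where "A' = (\<Prod>k\<in>{1..<p}. lin (p - k) ^ n k)"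
  \<comment> \<open>Complex conjugation is the automorphism with index \<open>p - 1\<close>.\<close>
  define q where "q = p - 1"
  have nq: "\<not> p dvd q" unfolding q_def by (rule not_dvd_p_minus_1)
  have AO: "A \<in> \<O>" "A' \<in> \<O>" unfolding A_def A'_def by (intro O_prod O_power lin_O)+
  have A0: "A \<noteq> 0" unfolding A_def by (auto simp: lin_nonzero)
  have u0: "u \<noteq> 0" using eq A0 by (auto simp: A_def)
  have "g ^ p = inverse u * A" using eq u0 unfolding A_def by (simp add: field_simps)
  then have gO: "g \<in> \<O>" using O_root[OF g] u AO by simp
  have sA: "sig q A = A'"
  proof -
    have "sig q A = (\<Prod>k\<in>{1..<p}. sig q (lin k ^ n k))"
      unfolding A_def by (intro sig_prod nq K_power O_K lin_O)
    also have "\<dots> = A'" unfolding A'_def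
    proof (intro prod.cong refl)
      fix k assume k: "k \<in> {1..<p}"
      have "k * q + k = p * k" unfolding q_def using gt2 by (cases p) (auto simp: algebra_simps)
      moreover have "p - k + k = p" using k by simp
      ultimately have "(k * q + k) mod p = (p - k + k) mod p" by simp
      then have "[k * q + k = p - k + k] (mod p)" by (simp add: Cong.cong_def)
      then have "[k * q = p - k] (mod p)" by (rule cong_add_rcancel_nat[THEN iffD1])
      then have "k * q mod p = (p - k) mod p" by (simp add: Cong.cong_def)
      then have "lin (k * q) = lin (p - k)" by (rule lin_cong)
      then show "sig q (lin k ^ n k) = lin (p - k) ^ n k"
        using nq O_K by (simp add: sig_power sig_lin)
    qed
    finally show ?thesis .
  qed
  define v where "v = u * inverse (sig q u)"
  have su0: "sig q u \<noteq> 0" using u0 nq u O_K by (simp add: sig_eq_0_iff)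
  have vO: "v \<in> \<O>" unfolding v_def using u nq O_K sig_O[OF nq u(2)] by (simp add: sig_inverse)
  have qq: "sig q (sig q u) = u"
  proof -
    have "int (q * q) - 1 = int p * (int p - 2)"
    proof -
      have ip: "int p = int q + 1" using gt2 by (simp add: q_def of_nat_diff)
      show ?thesis unfolding ip by (simp add: algebra_simps)
    qed
    then have "[int (q * q) = int 1] (mod int p)" by (simp add: cong_iff_dvd_diff)
    then have "[q * q = 1] (mod p)" by (simp only: cong_int_iff)
    then have "q * q mod p = 1 mod p" by (simp only: Cong.cong_def)
    then have "sig (q * q) u = sig 1 u" by (intro sig_cong not_dvd_mult nq O_K u)
    then show ?thesis using sig_sig[OF nq nq O_K[OF u(1)]] sig_id[OF O_K[OF u(1)]] by simp
  qed
  have sv: "sig q v = sig q u * inverse u"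
    unfolding v_def using nq u O_K sig_inverse[OF nq, of "sig q u"] qq by (simp add: sig_mult)
  have "v * sig q v = (u * inverse u) * (sig q u * inverse (sig q u))"
    unfolding sv unfolding v_def by (simp only: mult_ac)
  then have "v * sig (p - 1) v = 1" unfolding q_def[symmetric] using u0 su0 by simp
  then obtain t e where te: "v = of_int e * \<zeta> ^ t" using unit_modulus_1[OF vO] by metis
  have sgA: "A' = sig q u * sig q g ^ p"
    unfolding sA[symmetric] A_def eq using nq u g O_K by (simp add: sig_mult sig_power)
  obtain r d where rd: "d \<in> \<O>" "g ^ p = of_int r + of_nat p * d" using pth_power_cong_int[OF gO] by blast
  have sgr: "sig q g ^ p = of_int r + of_nat p * sig q d"
    using arg_cong[OF rd(2), of "sig q"] nq g rd(1) O_K by (simp add: sig_power sig_add sig_mult)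
  \<comment> \<open>Every factor of \<open>A\<close> divides \<open>c\<^sup>p\<close>, so \<open>A\<close> divides a power of \<open>c\<close>.\<close>
  have nr: "\<not> int p dvd r"
  proof
    assume "int p dvd r"
    then obtain r' where "r = int p * r'" ..
    then have Ap: "A = of_nat p * (u * (of_int r' + d))"
      using eq rd(2) by (simp add: A_def algebra_simps)
    define B where "B = (\<Prod>k\<in>{1..<p}. (\<Prod>j\<in>{..<p} - {k}. lin j) ^ n k)"
    have "A * B = (\<Prod>k\<in>{1..<p}. (of_int (- c) ^ p) ^ n k)"
      unfolding A_def B_def prod.distrib[symmetric]
    proof (intro prod.cong refl)
      fix k assume "k \<in> {1..<p}"
      then have "lin k * (\<Prod>j\<in>{..<p} - {k}. lin j) = of_int (- c) ^ p" by (intro lin_cofactor) simp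
      then show "lin k ^ n k * (\<Prod>j\<in>{..<p} - {k}. lin j) ^ n k = (of_int (- c) ^ p) ^ n k"
        unfolding power_mult_distrib[symmetric] by simp
    qed
    also have "\<dots> = of_int ((- c) ^ (\<Sum>k\<in>{1..<p}. p * n k))"
      by (simp add: power_sum power_mult)
    finally have "of_int ((- c) ^ (\<Sum>k\<in>{1..<p}. p * n k)) = of_nat p * (u * (of_int r' + d) * B)"
      using Ap by (simp add: mult.assoc)
    moreover have "u * (of_int r' + d) * B \<in> \<O>"
      unfolding B_def by (intro O_mult O_add u O_of_int rd O_prod O_power lin_O)
    ultimately have "int p dvd (- c) ^ (\<Sum>k\<in>{1..<p}. p * n k)" using p_dvd_of_int by blast
    then have "int p dvd - c" by (rule prime_dvd_power[rotated]) (use prime in simp)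
    then show False using c by simp
  qed
  then have "coprime (int p) r" using prime by (intro prime_imp_coprime) auto
  then obtain s w where sw: "s * int p + w * r = 1" by (elim coprime_int_bezout[THEN exE] exE)
  have "A * sig q g ^ p = v * A' * g ^ p"
    unfolding v_def sgA using eq su0 by (simp add: A_def field_simps)
  then have rX: "of_int r * (A - v * A') = of_nat p * (v * A' * d - A * sig q d)"
    unfolding rd(2) sgr by (simp add: algebra_simps)
  define W where "W = A - v * A'"
  define E where "E = v * A' * d - A * sig q d"
  have "W = of_int (s * int p + w * r) * W" using sw by simp
  also have "\<dots> = of_nat p * (of_int s * W) + of_int w * (of_int r * W)" by (simp add: algebra_simps)
  also have "of_int r * W = of_nat p * E" unfolding W_def E_def by (rule rX)
  also have "of_nat p * (of_int s * W) + of_int w * (of_nat p * E) = of_nat p * (of_int s * W + of_int w * E)"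
    by (simp add: algebra_simps)
  finally have main: "W = of_nat p * (of_int s * W + of_int w * E)" .
  define P where "P = (\<Prod>k\<in>{1..<p}. ([:a:] + monom b k) ^ n k)"
  define Q where "Q = monom e t * (\<Prod>k\<in>{1..<p}. ([:a:] + monom b (p - k)) ^ n k)"
  have "ipoly (P - Q) \<zeta> = W"
    unfolding W_def P_def Q_def A_def A'_def te by (simp add: lin_def mult.commute)
  moreover have "algebraic_int (of_int s * W + of_int w * E)"
    unfolding W_def E_def by (rule O_int) (use AO vO rd(1) nq in simp)
  ultimately have "vanishes_mod p (p - 1) (P - Q)"
    using vanishes_mod_if_p_dvd main by metis
  then show thesis using that unfolding P_def Q_def by blast
qed

end

section \<open>The p-adic integers modulo p\<close>

locale padic =
  fixes p :: nat
  assumes prime_p: "Factorial_Ring.prime p"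
begin

abbreviation Zp :: "(nat \<Rightarrow> int) ring" where "Zp \<equiv> padic_ints p"

lemma p_pos: "0 < p" using prime_p by (rule prime_gt_0_nat)

sublocale Zp: cring Zp
  by (rule padic_ints_cring[OF p_pos])

lemma carrier_iff: "x \<in> carrier Zp \<longleftrightarrow> (\<forall>n. x n \<in> {0..<int p ^ n} \<and> x (Suc n) mod int p ^ n = x n)"
  by (simp add: padic_ints_def)

lemma nth_mult: "(x \<otimes>\<^bsub>Zp\<^esub> y) n = x n * y n mod int p ^ n"
  and nth_add: "(x \<oplus>\<^bsub>Zp\<^esub> y) n = (x n + y n) mod int p ^ n"
  and nth_one: "\<one>\<^bsub>Zp\<^esub> n = 1 mod int p ^ n"
  and nth_zero: "\<zero>\<^bsub>Zp\<^esub> n = 0"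
  by (simp_all add: padic_ints_def)

lemma nth_mod: "x \<in> carrier Zp \<Longrightarrow> x n mod int p ^ n = x n"
  by (auto simp: carrier_iff)

lemma nth_step: "x \<in> carrier Zp \<Longrightarrow> x (Suc n) mod int p ^ n = x n"
  by (auto simp: carrier_iff)

lemma nth_coherent: "x \<in> carrier Zp \<Longrightarrow> x (n + m) mod int p ^ n = x n"
proof (induction m)
  case (Suc m)
  have "x (n + Suc m) mod int p ^ n = (x (Suc (n + m)) mod int p ^ (n + m)) mod int p ^ n"
    by (simp add: mod_mod_cancel le_imp_power_dvd)
  then show ?case using Suc nth_step by simp
qed (simp add: nth_mod)

lemma carrier_mod:
  assumes "\<And>n. [f (Suc n) = f n] (mod int p ^ n)"
  shows "(\<lambda>n. f n mod int p ^ n) \<in> carrier Zp"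
  unfolding carrier_iff
proof (intro allI conjI)
  fix n
  show "f n mod int p ^ n \<in> {0..<int p ^ n}" using p_pos by simp
  have "f (Suc n) mod int p ^ Suc n mod int p ^ n = f (Suc n) mod int p ^ n"
    by (rule mod_mod_cancel) (simp add: le_imp_power_dvd)
  then show "f (Suc n) mod int p ^ Suc n mod int p ^ n = f n mod int p ^ n"
    using assms[of n] by (simp add: Cong.cong_def)
qed

lemma nth_pow: "x \<in> carrier Zp \<Longrightarrow> (x [^]\<^bsub>Zp\<^esub> (k::nat)) n = x n ^ k mod int p ^ n"
proof (induction k)
  case (Suc k)
  have "(x [^]\<^bsub>Zp\<^esub> Suc k) n = (x [^]\<^bsub>Zp\<^esub> k \<otimes>\<^bsub>Zp\<^esub> x) n" by simp
  also have "\<dots> = x n ^ k mod int p ^ n * x n mod int p ^ n" using Suc by (simp only: nth_mult)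
  finally show ?case by (simp add: mod_simps mult.commute)
qed (simp add: nth_one)

lemma nth_minus: "x \<in> carrier Zp \<Longrightarrow> (\<ominus>\<^bsub>Zp\<^esub> x) n = (- x n) mod int p ^ n"
proof -
  assume x: "x \<in> carrier Zp"
  define y where "y = (\<lambda>n. (- x n) mod int p ^ n)"
  have "y \<in> carrier Zp" unfolding y_def
  proof (rule carrier_mod)
    fix n
    have "[x (Suc n) = x n] (mod int p ^ n)" using nth_step[OF x, of n] nth_mod[OF x, of n] by (simp add: Cong.cong_def)
    then show "[- x (Suc n) = - x n] (mod int p ^ n)" by (simp add: cong_minus_minus_iff)
  qed
  moreover have "y \<oplus>\<^bsub>Zp\<^esub> x = \<zero>\<^bsub>Zp\<^esub>"
    by (rule ext) (simp add: nth_add nth_zero y_def mod_simps)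
  ultimately have "\<ominus>\<^bsub>Zp\<^esub> x = y" using Zp.minus_equality x by simp
  then show ?thesis by (simp add: y_def)
qed

lemma of_int_closed: "padic_of_int p k \<in> carrier Zp"
  unfolding padic_of_int_def by (rule Zp.add.int_pow_closed[OF Zp.one_closed])

lemma nth_of_int: "padic_of_int p k n = k mod int p ^ n"
proof -
  have nat: "([m] \<cdot>\<^bsub>Zp\<^esub> \<one>\<^bsub>Zp\<^esub>) n = int m mod int p ^ n" for m :: nat
  proof (induction m)
    case 0 then show ?case by (simp add: nth_zero)
  next
    case (Suc m)
    have "[Suc m] \<cdot>\<^bsub>Zp\<^esub> \<one>\<^bsub>Zp\<^esub> = [m] \<cdot>\<^bsub>Zp\<^esub> \<one>\<^bsub>Zp\<^esub> \<oplus>\<^bsub>Zp\<^esub> \<one>\<^bsub>Zp\<^esub>" by simp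
    then show ?case by (simp only: nth_add Suc nth_one[of n]) (simp add: mod_simps add.commute)
  qed
  show ?thesis
  proof (cases "k \<ge> 0")
    case True
    then show ?thesis by (simp add: padic_of_int_def add_pow_int_ge nat)
  next
    case False
    then have "padic_of_int p k n = (\<ominus>\<^bsub>Zp\<^esub> ([nat (- k)] \<cdot>\<^bsub>Zp\<^esub> \<one>\<^bsub>Zp\<^esub>)) n"
      by (simp add: padic_of_int_def add_pow_int_lt)
    also have "\<dots> = (- ([nat (- k)] \<cdot>\<^bsub>Zp\<^esub> \<one>\<^bsub>Zp\<^esub>) n) mod int p ^ n"
      by (rule nth_minus) simp
    also have "\<dots> = k mod int p ^ n" using False by (simp add: nat mod_simps)
    finally show ?thesis .
  qed
qed

text \<open>
  Congruence modulo \<open>p\<close> only concerns the component of index \<open>1\<close>, the residue modulo \<open>p\<close>; a \<open>p\<close>-adic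
  integer with residue \<open>0\<close> is divided by \<open>p\<close> by shifting and dividing its components.
\<close>

lemma cong_iff:
  assumes x: "x \<in> carrier Zp" and y: "y \<in> carrier Zp"
  shows "padic_cong p x y \<longleftrightarrow> x 1 = y 1"
proof -
  define d where "d = x \<ominus>\<^bsub>Zp\<^esub> y"
  have d: "d \<in> carrier Zp" unfolding d_def using x y by simp
  have d1: "d 1 = (x 1 - y 1) mod int p"
    unfolding d_def a_minus_def using y by (simp add: nth_add nth_minus mod_simps)
  have "padic_cong p x y \<longleftrightarrow> d 1 = 0"
  proof
    assume "padic_cong p x y"
    then obtain w where "w \<in> carrier Zp" "d = padic_of_int p (int p) \<otimes>\<^bsub>Zp\<^esub> w"
      unfolding padic_cong_def d_def factor_def by blast
    then show "d 1 = 0" by (simp add: nth_mult nth_of_int)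
  next
    assume "d 1 = 0"
    have dvd: "int p dvd d (Suc n)" for n
      using nth_coherent[OF d, of 1 n] \<open>d 1 = 0\<close> by (simp add: dvd_eq_mod_eq_0)
    define w where "w = (\<lambda>n. (d (Suc n) div int p) mod int p ^ n)"
    have wc: "w \<in> carrier Zp" unfolding w_def
    proof (rule carrier_mod)
      fix n
      have "[d (Suc (Suc n)) = d (Suc n)] (mod int p ^ Suc n)"
        using nth_step[OF d, of "Suc n"] nth_mod[OF d, of "Suc n"] by (simp add: Cong.cong_def)
      then have "int p * int p ^ n dvd int p * (d (Suc (Suc n)) div int p - d (Suc n) div int p)"
        using dvd by (simp add: cong_iff_dvd_diff right_diff_distrib)
      then show "[d (Suc (Suc n)) div int p = d (Suc n) div int p] (mod int p ^ n)"
        using p_pos by (simp add: cong_iff_dvd_diff)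
    qed
    have "d = padic_of_int p (int p) \<otimes>\<^bsub>Zp\<^esub> w"
    proof
      fix n
      have "(padic_of_int p (int p) \<otimes>\<^bsub>Zp\<^esub> w) n = int p * (d (Suc n) div int p) mod int p ^ n"
        by (simp add: nth_mult nth_of_int w_def mod_simps)
      also have "\<dots> = d n" using dvd[of n] nth_step[OF d] by simp
      finally show "d n = (padic_of_int p (int p) \<otimes>\<^bsub>Zp\<^esub> w) n" ..
    qed
    then show "padic_cong p x y" using wc unfolding padic_cong_def d_def factor_def by blast
  qed
  also have "\<dots> \<longleftrightarrow> [x 1 = y 1] (mod int p)" by (simp only: d1 cong_iff_dvd_diff dvd_eq_mod_eq_0)
  also have "\<dots> \<longleftrightarrow> x 1 = y 1" using nth_mod[OF x, of 1] nth_mod[OF y, of 1] by (simp add: Cong.cong_def)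
  finally show ?thesis .
qed

text \<open>
  The inverses modulo the powers \<open>p\<^sup>n\<close> fit together because they are unique.
\<close>

lemma Units_iff: "x \<in> Units Zp \<longleftrightarrow> x \<in> carrier Zp \<and> \<not> int p dvd x 1"
proof (intro iffI conjI)
  assume "x \<in> Units Zp"
  then obtain y where "x \<otimes>\<^bsub>Zp\<^esub> y = \<one>\<^bsub>Zp\<^esub>" unfolding Units_def by blast
  then have "x 1 * y 1 mod int p = 1" using nth_mult[of x y 1] nth_one[of 1] prime_gt_1_nat[OF prime_p] by simp
  then show "\<not> int p dvd x 1" by (metis dvd_mult2 dvd_imp_mod_0 zero_neq_one)
next
  assume "x \<in> carrier Zp \<and> \<not> int p dvd x 1"
  then have x: "x \<in> carrier Zp" "\<not> int p dvd x 1" by auto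
  have cop: "coprime (x n) (int p ^ n)" for n
  proof (cases n)
    case (Suc m)
    have "x n mod int p = x 1" using nth_coherent[OF x(1), of 1 m] Suc by simp
    then have "\<not> int p dvd x n" using x(2) by (metis dvd_mod_iff dvd_refl)
    then have "coprime (int p) (x n)" using prime_p by (intro prime_imp_coprime) auto
    then show ?thesis by (simp add: coprime_commute)
  qed simp
  then have "\<forall>n. \<exists>y. [x n * y = 1] (mod int p ^ n)" using coprime_iff_invertible_int by blast
  then obtain y where y: "\<And>n. [x n * y n = 1] (mod int p ^ n)" by metis
  have yc: "(\<lambda>n. y n mod int p ^ n) \<in> carrier Zp"
  proof (rule carrier_mod)
    fix n
    have "[x (Suc n) * y (Suc n) = 1] (mod int p ^ n)"
      by (rule cong_dvd_modulus[OF y]) (simp add: le_imp_power_dvd)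
    moreover have "[x (Suc n) = x n] (mod int p ^ n)"
      using nth_step[OF x(1), of n] nth_mod[OF x(1), of n] by (simp add: Cong.cong_def)
    ultimately have "[x n * y (Suc n) = x n * y n] (mod int p ^ n)"
      using y[of n] by (meson cong_scalar_right cong_sym cong_trans)
    then show "[y (Suc n) = y n] (mod int p ^ n)" using cop by (simp add: cong_mult_lcancel)
  qed
  have "x \<otimes>\<^bsub>Zp\<^esub> (\<lambda>n. y n mod int p ^ n) = \<one>\<^bsub>Zp\<^esub>"
    using y by (intro ext) (simp add: nth_mult nth_one mod_simps Cong.cong_def)
  then show "x \<in> Units Zp" unfolding Units_def using x(1) yc Zp.m_comm[OF x(1) yc] by auto
qed (auto simp: Units_def)

lemma inv_1:
  assumes "x \<in> Units Zp"
  shows "[x 1 * (inv\<^bsub>Zp\<^esub> x) 1 = 1] (mod int p)"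
proof -
  have "x \<otimes>\<^bsub>Zp\<^esub> inv\<^bsub>Zp\<^esub> x = \<one>\<^bsub>Zp\<^esub>" using assms by (rule Zp.Units_r_inv)
  then have "x 1 * (inv\<^bsub>Zp\<^esub> x) 1 mod int p ^ 1 = 1 mod int p ^ 1" using nth_mult nth_one by metis
  then show ?thesis by (simp add: Cong.cong_def)
qed

text \<open>
  Raising to the \<open>p\<close>-th power gains a factor \<open>p\<close>, since \<open>\<Sum>i<p. v\<^bsup>p-1-i\<^esup> u\<^sup>i\<close> is
  divisible by \<open>p\<close> if \<open>u \<equiv> v\<close> modulo \<open>p\<close>.
\<close>

lemma power_p_power_cong:
  fixes x y :: int
  assumes "[x = y] (mod int p)"
  shows "[x ^ p ^ n = y ^ p ^ n] (mod int p ^ Suc n)"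
proof (induction n)
  case 0
  then show ?case using assms by simp
next
  case (Suc n)
  define u where "u = x ^ p ^ n"
  define v where "v = y ^ p ^ n"
  have uv: "[u = v] (mod int p ^ Suc n)" using Suc by (simp add: u_def v_def)
  have uvp: "[u = v] (mod int p)" by (rule cong_dvd_modulus[OF uv]) simp
  have "[(\<Sum>i<p. v ^ (p - Suc i) * u ^ i) = (\<Sum>i<p. v ^ (p - Suc i) * v ^ i)] (mod int p)"
    by (intro cong_sum cong_mult cong_pow uvp cong_refl)
  also have "(\<Sum>i<p. v ^ (p - Suc i) * v ^ i) = (\<Sum>i<p. v ^ (p - 1))"
    by (intro sum.cong refl) (simp flip: power_add)
  also have "\<dots> = int p * v ^ (p - 1)" by simp
  finally have "int p dvd (\<Sum>i<p. v ^ (p - Suc i) * u ^ i)"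
    by (metis cong_dvd_iff dvd_triv_left)
  moreover have "int p ^ Suc n dvd u - v" using uv by (simp add: cong_iff_dvd_diff)
  ultimately have "int p ^ Suc n * int p dvd (u - v) * (\<Sum>i<p. v ^ (p - Suc i) * u ^ i)" by (intro mult_dvd_mono)
  then have "int p ^ Suc (Suc n) dvd u ^ p - v ^ p"
    unfolding power_diff_sumr2 by (simp only: power_Suc mult.commute)
  moreover have "u ^ p = x ^ p ^ Suc n" "v ^ p = y ^ p ^ Suc n"
    by (simp_all add: u_def v_def power_mult[symmetric] mult.commute)
  ultimately show ?case by (simp add: cong_iff_dvd_diff)
qed

text \<open>
  The Teichmueller representative is the limit of \<open>k\<close> raised to the powers \<open>p\<^sup>n\<close>; it is unique because a
  \<open>(p - 1)\<close>-st root of unity is fixed by raising to the \<open>p\<close>-th power.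
\<close>

lemma teichmuller:
  assumes k: "\<not> p dvd k"
  shows "teichmuller p k \<in> Units Zp" and "teichmuller p k 1 = int k mod int p"
proof -
  define x where "x = (\<lambda>n. int k ^ p ^ n mod int p ^ n)"
  have xc: "x \<in> carrier Zp" unfolding x_def
  proof (rule carrier_mod)
    fix n
    have "[int k ^ p = int k] (mod int p)" using int_fermat[OF prime_p] by (simp add: cong_iff_dvd_diff)
    from power_p_power_cong[OF this] have "[int k ^ p ^ Suc n = int k ^ p ^ n] (mod int p ^ Suc n)"
      by (simp add: power_mult[symmetric] mult.commute)
    then show "[int k ^ p ^ Suc n = int k ^ p ^ n] (mod int p ^ n)"
      by (rule cong_dvd_modulus) (simp add: le_imp_power_dvd)
  qed
  have pow1: "x [^]\<^bsub>Zp\<^esub> (p - 1) = \<one>\<^bsub>Zp\<^esub>"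
  proof
    fix n
    have "[k ^ (p - 1) = 1] (mod p)" by (rule fermat_theorem[OF prime_p k])
    then have "[int k ^ (p - 1) = 1] (mod int p)" by (metis cong_int_iff of_nat_1 of_nat_power)
    from power_p_power_cong[OF this] have "[(int k ^ (p - 1)) ^ p ^ n = 1] (mod int p ^ Suc n)" by simp
    then have "[(int k ^ (p - 1)) ^ p ^ n = 1] (mod int p ^ n)"
      by (rule cong_dvd_modulus) (simp add: le_imp_power_dvd)
    then have "[(int k ^ p ^ n) ^ (p - 1) = 1] (mod int p ^ n)"
      by (simp add: power_mult[symmetric] mult.commute)
    then show "(x [^]\<^bsub>Zp\<^esub> (p - 1)) n = \<one>\<^bsub>Zp\<^esub> n"
      unfolding nth_pow[OF xc] nth_one by (simp add: x_def Cong.cong_def power_mod)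
  qed
  have x1: "x 1 = int k mod int p"
    using int_fermat[OF prime_p, of "int k"] by (simp add: x_def mod_eq_dvd_iff)
  have xcong: "padic_cong p x (padic_of_int p (int k))"
    using cong_iff[OF xc of_int_closed] x1 by (simp add: nth_of_int)
  have uniq: "y = x" if y: "y \<in> carrier Zp" "y [^]\<^bsub>Zp\<^esub> (p - 1) = \<one>\<^bsub>Zp\<^esub>" "padic_cong p y (padic_of_int p (int k))" for y
  proof
    fix n
    have "y 1 = x 1" using y(3) cong_iff[OF y(1) of_int_closed] x1 by (simp add: nth_of_int)
    have fixp: "[w n ^ p ^ m = w n] (mod int p ^ n)" if w: "w \<in> carrier Zp" "w [^]\<^bsub>Zp\<^esub> (p - 1) = \<one>\<^bsub>Zp\<^esub>" for w m
    proof (induction m)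
      case (Suc m)
      have "w n ^ (p - 1) mod int p ^ n = 1 mod int p ^ n"
        using nth_pow[OF w(1), of "p - 1" n, unfolded w(2) nth_one] ..
      then have "[w n * w n ^ (p - 1) = w n * 1] (mod int p ^ n)" by (intro cong_scalar_left) (simp add: Cong.cong_def)
      then have "[w n ^ p = w n] (mod int p ^ n)"
        using power_minus_mult[OF p_pos, of "w n"] by (simp only: mult.commute mult_1)
      moreover have "[w n ^ p ^ Suc m = w n ^ p] (mod int p ^ n)"
        using cong_pow[OF Suc, of p] by (simp add: power_mult[symmetric] mult.commute)
      ultimately show ?case using cong_trans by blast
    qed simp
    show "y n = x n"
    proof (cases n)
      case 0
      have "w 0 = 0" if w: "w \<in> carrier Zp" for w
        using spec[OF w[unfolded carrier_iff], of 0] by simp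
      from this[OF xc] this[OF y(1)] show ?thesis using 0 by simp
    next
      case (Suc m)
      have "[y n = x n] (mod int p)"
        using nth_coherent[OF xc, of 1 m] nth_coherent[OF y(1), of 1 m] \<open>y 1 = x 1\<close> Suc by (simp add: Cong.cong_def)
      from power_p_power_cong[OF this, of m] have "[y n ^ p ^ m = x n ^ p ^ m] (mod int p ^ n)" using Suc by simp
      then have "[y n = x n] (mod int p ^ n)"
        using fixp[OF xc pow1, of m] fixp[OF y(1,2), of m] by (meson cong_sym cong_trans)
      then show ?thesis using nth_mod[OF xc] nth_mod[OF y(1)] by (simp add: Cong.cong_def)
    qed
  qed
  have "teichmuller p k = x"
    unfolding teichmuller_def
  proof (rule the_equality)
    show "x \<in> carrier Zp \<and> x [^]\<^bsub>Zp\<^esub> (p - 1) = \<one>\<^bsub>Zp\<^esub> \<and> padic_cong p x (padic_of_int p (int k))"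
      by (intro conjI xc pow1 xcong)
  qed (elim conjE, rule uniq)
  moreover have "x \<in> Units Zp"
    unfolding Units_iff using xc x1 k by (simp add: dvd_mod_iff)
  ultimately show "teichmuller p k \<in> Units Zp" "teichmuller p k 1 = int k mod int p" using x1 by auto
qed

lemma nth_finsum:
  assumes "finite A" "\<And>k. k \<in> A \<Longrightarrow> f k \<in> carrier Zp"
  shows "(\<Oplus>\<^bsub>Zp\<^esub>k\<in>A. f k) n = (\<Sum>k\<in>A. f k n) mod int p ^ n"
  using assms
proof (induction A rule: finite_induct)
  case (insert k A)
  then have "(\<Oplus>\<^bsub>Zp\<^esub>k\<in>insert k A. f k) = f k \<oplus>\<^bsub>Zp\<^esub> (\<Oplus>\<^bsub>Zp\<^esub>k\<in>A. f k)" by (intro Zp.finsum_insert) auto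
  then show ?case using insert by (simp add: nth_add mod_simps)
qed (simp add: nth_zero)

lemma mirimanoff_eval_eq:
  assumes \<phi>: "\<And>k. k \<in> {1..p - 1} \<Longrightarrow> \<phi> (cyclo_aut \<zeta> k) \<in> Units Zp" and z: "z \<in> carrier Zp"
  shows "mirimanoff_eval p \<zeta> \<phi> z = (\<Oplus>\<^bsub>Zp\<^esub>k\<in>{1..p - 1}. inv\<^bsub>Zp\<^esub> (\<phi> (cyclo_aut \<zeta> k)) \<otimes>\<^bsub>Zp\<^esub> z [^]\<^bsub>Zp\<^esub> k)"
proof -
  interpret hom: ring_hom_cring Zp Zp "\<lambda>x. x"
    by (rule ring_hom_cringI[OF Zp.is_cring Zp.is_cring]) (rule ring_hom_memI, simp_all)
  interpret U: UP_pre_univ_prop Zp Zp "\<lambda>x. x" "UP Zp"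
    by (rule UP_pre_univ_prop.intro[OF hom.ring_hom_cring_axioms UP_cring.intro[OF Zp.is_cring]])
  interpret E: ring_hom_cring "UP Zp" Zp "eval Zp Zp (\<lambda>x. x) z"
    by (rule ring_hom_cringI[OF U.UP_cring Zp.is_cring U.eval_ring_hom[OF z]])
  have "mirimanoff_eval p \<zeta> \<phi> z = (\<Oplus>\<^bsub>Zp\<^esub>k\<in>{1..p - 1}.
      eval Zp Zp (\<lambda>x. x) z (up_ring.monom (UP Zp) (inv\<^bsub>Zp\<^esub> (\<phi> (cyclo_aut \<zeta> k))) k))"
    unfolding mirimanoff_eval_def mirimanoff_def
    by (subst E.hom_finsum) (auto simp: comp_def intro!: U.monom_closed Zp.Units_inv_closed \<phi>)
  also have "\<dots> = (\<Oplus>\<^bsub>Zp\<^esub>k\<in>{1..p - 1}. inv\<^bsub>Zp\<^esub> (\<phi> (cyclo_aut \<zeta> k)) \<otimes>\<^bsub>Zp\<^esub> z [^]\<^bsub>Zp\<^esub> k)"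
    by (intro Zp.finsum_cong' refl U.eval_monom z Zp.Units_inv_closed \<phi>)
      (auto intro!: Zp.m_closed Zp.nat_pow_closed z Zp.Units_inv_closed \<phi>)
  finally show ?thesis .
qed

end

section \<open>The class group and the theorem\<close>

context cyclotomic begin

lemma carrier_cyclo_field: "carrier (cyclo_field \<zeta>) = K"
proof -
  define R where "R = (ring_of_type_algebra :: complex ring)"
  interpret R: field R unfolding R_def by (rule field_from_type_algebra)
  have simps: "carrier R = UNIV" "x \<otimes>\<^bsub>R\<^esub> y = x * y" "x \<oplus>\<^bsub>R\<^esub> y = x + y" "\<one>\<^bsub>R\<^esub> = 1" "\<zero>\<^bsub>R\<^esub> = 0" for x y
    by (simp_all add: R_def ring_of_type_algebra_def)
  have neg: "\<ominus>\<^bsub>R\<^esub> x = - x" for x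
    by (rule R.minus_equality) (simp_all add: simps)
  have inv: "inv\<^bsub>R\<^esub> x = inverse x" if "x \<noteq> 0" for x
    by (rule R.comm_inv_char) (use that in \<open>simp_all add: simps\<close>)
  have "x \<in> K" if "x \<in> generate_field R (\<rat> \<union> {\<zeta>})" for x
    using that by (induction rule: generate_field.induct) (auto simp: simps neg inv K_Rats)
  moreover have "x \<in> generate_field R (\<rat> \<union> {\<zeta>})" if x: "x \<in> K" for x
  proof -
    obtain F n where F: "n \<noteq> 0" "x = ipoly F \<zeta> / of_int n" using x by (rule K_E)
    have rat: "q \<in> generate_field R (\<rat> \<union> {\<zeta>})" if "q \<in> \<rat>" for q
      using that by (intro generate_field.incl) simp
    have z: "\<zeta> \<in> generate_field R (\<rat> \<union> {\<zeta>})" by (intro generate_field.incl) simp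
    have mult: "s * t \<in> generate_field R (\<rat> \<union> {\<zeta>})"
      if "s \<in> generate_field R (\<rat> \<union> {\<zeta>})" "t \<in> generate_field R (\<rat> \<union> {\<zeta>})" for s t
      using generate_field.eng_mult[OF that] by (simp add: simps)
    have add: "s + t \<in> generate_field R (\<rat> \<union> {\<zeta>})"
      if "s \<in> generate_field R (\<rat> \<union> {\<zeta>})" "t \<in> generate_field R (\<rat> \<union> {\<zeta>})" for s t
      using generate_field.eng_add[OF that] by (simp add: simps)
    have "ipoly F \<zeta> \<in> generate_field R (\<rat> \<union> {\<zeta>})"
    proof (induction F)
      case 0
      show ?case unfolding ipoly_0 by (rule rat) simp
    next
      case (pCons a F)
      show ?case unfolding ipoly_pCons by (intro add mult z pCons(2) rat) simp
    qed
    from mult[OF this rat[of "1 / of_int n"]] have "ipoly F \<zeta> * (1 / of_int n) \<in> generate_field R (\<rat> \<union> {\<zeta>})"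
      by simp
    then show ?thesis using F by simp
  qed
  ultimately have "generate_field R (\<rat> \<union> {\<zeta>}) = K" by blast
  then show ?thesis by (simp add: cyclo_field_def R_def[symmetric])
qed

lemma cyclo_integers_simps [simp]:
  "carrier (cyclo_integers \<zeta>) = \<O>" "x \<otimes>\<^bsub>cyclo_integers \<zeta>\<^esub> y = x * y"
  "x \<oplus>\<^bsub>cyclo_integers \<zeta>\<^esub> y = x + y" "\<one>\<^bsub>cyclo_integers \<zeta>\<^esub> = 1" "\<zero>\<^bsub>cyclo_integers \<zeta>\<^esub> = 0"
  by (simp_all add: cyclo_integers_def carrier_cyclo_field \<O>_def) (simp_all add: ring_of_type_algebra_def)

lemma cyclo_integers_cring: "cring (cyclo_integers \<zeta>)"
proof (intro cringI abelian_groupI comm_monoidI)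
  fix x assume "x \<in> carrier (cyclo_integers \<zeta>)"
  then show "\<exists>y\<in>carrier (cyclo_integers \<zeta>). y \<oplus>\<^bsub>cyclo_integers \<zeta>\<^esub> x = \<zero>\<^bsub>cyclo_integers \<zeta>\<^esub>"
    by (intro bexI[of _ "- x"]) simp_all
qed (auto simp: algebra_simps)

lemma ideal_cyclo_integers_iff:
  "ideal J (cyclo_integers \<zeta>) \<longleftrightarrow> J \<subseteq> \<O> \<and> 0 \<in> J \<and> (\<forall>x\<in>J. \<forall>y\<in>J. x + y \<in> J) \<and> (\<forall>r\<in>\<O>. \<forall>x\<in>J. r * x \<in> J)"
proof
  assume "ideal J (cyclo_integers \<zeta>)"
  then interpret J: ideal J "cyclo_integers \<zeta>" .
  have A: "additive_subgroup J (cyclo_integers \<zeta>)" by (rule ideal.axioms(1)[OF J.ideal_axioms])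
  show "J \<subseteq> \<O> \<and> 0 \<in> J \<and> (\<forall>x\<in>J. \<forall>y\<in>J. x + y \<in> J) \<and> (\<forall>r\<in>\<O>. \<forall>x\<in>J. r * x \<in> J)"
  proof (intro conjI ballI)
    show "J \<subseteq> \<O>" using J.a_subset by (simp only: cyclo_integers_simps)
    show "0 \<in> J" using additive_subgroup.zero_closed[OF A] by (simp only: cyclo_integers_simps)
    show "x + y \<in> J" if "x \<in> J" "y \<in> J" for x y
      using additive_subgroup.a_closed[OF A that] by (simp only: cyclo_integers_simps)
    show "r * x \<in> J" if "r \<in> \<O>" "x \<in> J" for r x
      using J.I_l_closed[OF that(2), of r] that(1) by (simp only: cyclo_integers_simps)
  qed
next
  assume J: "J \<subseteq> \<O> \<and> 0 \<in> J \<and> (\<forall>x\<in>J. \<forall>y\<in>J. x + y \<in> J) \<and> (\<forall>r\<in>\<O>. \<forall>x\<in>J. r * x \<in> J)"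
  then have sub: "J \<subseteq> \<O>" and zero: "0 \<in> J" and add: "\<And>x y. x \<in> J \<Longrightarrow> y \<in> J \<Longrightarrow> x + y \<in> J"
    and scale: "\<And>r x. r \<in> \<O> \<Longrightarrow> x \<in> J \<Longrightarrow> r * x \<in> J" by blast+
  interpret R: cring "cyclo_integers \<zeta>" by (rule cyclo_integers_cring)
  show "ideal J (cyclo_integers \<zeta>)"
  proof (rule idealI)
    show "ring (cyclo_integers \<zeta>)" by (rule R.ring_axioms)
    show "subgroup J (add_monoid (cyclo_integers \<zeta>))"
    proof (rule R.add.subgroupI)
      show "J \<subseteq> carrier (cyclo_integers \<zeta>)" using sub by (simp only: cyclo_integers_simps)
      show "J \<noteq> {}" using zero by blast
      show "x \<oplus>\<^bsub>cyclo_integers \<zeta>\<^esub> y \<in> J" if "x \<in> J" "y \<in> J" for x y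
        unfolding cyclo_integers_simps by (rule add[OF that])
      fix x assume x: "x \<in> J"
      then have xO: "x \<in> \<O>" using sub by blast
      have "\<ominus>\<^bsub>cyclo_integers \<zeta>\<^esub> x = - x"
        by (rule R.minus_equality) (simp_all add: xO)
      moreover have "- 1 * x \<in> J" by (rule scale[OF O_uminus[OF O_1] x])
      ultimately show "\<ominus>\<^bsub>cyclo_integers \<zeta>\<^esub> x \<in> J" by simp
    qed
    show "x \<otimes>\<^bsub>cyclo_integers \<zeta>\<^esub> y \<in> J" "y \<otimes>\<^bsub>cyclo_integers \<zeta>\<^esub> x \<in> J"
      if "y \<in> J" "x \<in> carrier (cyclo_integers \<zeta>)" for x y
      using scale[of x y] that by (simp_all add: mult.commute)
  qed
qed

lemma fractional_ideals_eq: "fractional_ideals \<zeta> = {I. fractional I}"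
proof (intro equalityI subsetI)
  fix I assume "I \<in> fractional_ideals \<zeta>"
  then obtain J d where J: "I = (\<lambda>x. x / d) ` J" "ideal J (cyclo_integers \<zeta>)" "J \<noteq> {0}" "d \<in> \<O>" "d \<noteq> 0"
    unfolding fractional_ideals_def by auto
  note J' = J(2)[unfolded ideal_cyclo_integers_iff]
  have "I \<subseteq> K" using J J' O_K by auto
  moreover obtain x where "x \<in> J" "x \<noteq> 0" using J(3) J' by blast
  then have "\<exists>x\<in>I. x \<noteq> 0" using J by auto
  moreover have "x + y \<in> I" if xy: "x \<in> I" "y \<in> I" for x y
  proof -
    obtain u v where "u \<in> J" "v \<in> J" "x = u / d" "y = v / d" using xy J(1) by blast
    then have "x + y = (u + v) / d" "u + v \<in> J" using J' by (auto simp: add_divide_distrib)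
    then show ?thesis using J(1) by blast
  qed
  moreover have "r * x \<in> I" if rx: "r \<in> \<O>" "x \<in> I" for r x
  proof -
    obtain u where "u \<in> J" "x = u / d" using rx J(1) by blast
    then have "r * x = (r * u) / d" "r * u \<in> J" using J' rx(1) by auto
    then show ?thesis using J(1) by blast
  qed
  moreover have "\<forall>x\<in>I. d * x \<in> \<O>" using J J' by auto
  ultimately show "I \<in> {I. fractional I}" unfolding fractional_def using J(4,5) by blast
next
  fix I assume "I \<in> {I. fractional I}"
  then have I: "fractional I" by simp
  obtain d where d: "d \<in> \<O>" "d \<noteq> 0" "\<forall>x\<in>I. d * x \<in> \<O>" using I unfolding fractional_def by blast
  define J where "J = (\<lambda>x. d * x) ` I"
  have "ideal J (cyclo_integers \<zeta>)" unfolding ideal_cyclo_integers_iff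
  proof (intro conjI ballI)
    show "J \<subseteq> \<O>" using d by (auto simp: J_def)
    show "0 \<in> J" using fractional_0[OF I] by (auto simp: J_def)
  next
    fix x y assume "x \<in> J" "y \<in> J"
    then obtain u v where "u \<in> I" "v \<in> I" "x = d * u" "y = d * v" by (auto simp: J_def)
    then have "x + y = d * (u + v)" "u + v \<in> I" using fractional_add[OF I] by (auto simp: distrib_left)
    then show "x + y \<in> J" by (auto simp: J_def)
  next
    fix r x assume "r \<in> \<O>" "x \<in> J"
    then obtain u where "u \<in> I" "x = d * u" by (auto simp: J_def)
    then have "r * x = d * (r * u)" "r * u \<in> I" using fractional_scale[OF I \<open>r \<in> \<O>\<close>] by auto
    then show "r * x \<in> J" by (auto simp: J_def)
  qed
  moreover have "J \<noteq> {0}"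
  proof -
    obtain x where "x \<in> I" "x \<noteq> 0" using I unfolding fractional_def by blast
    then have "d * x \<in> J" "d * x \<noteq> 0" using d by (auto simp: J_def)
    then show ?thesis by blast
  qed
  moreover have "I = (\<lambda>x. x / d) ` J" using d(2) by (simp add: J_def image_image)
  ultimately show "I \<in> fractional_ideals \<zeta>" unfolding fractional_ideals_def using d by auto
qed

abbreviation FG :: "complex set monoid" where "FG \<equiv> fractional_ideal_group \<zeta>"
abbreviation CG :: "complex set set monoid" where "CG \<equiv> class_group \<zeta>"
abbreviation Pr :: "complex set set" where "Pr \<equiv> principal_fractional_ideals \<zeta>"

lemma FG_simps [simp]:
  "carrier FG = {I. fractional I}" "I \<otimes>\<^bsub>FG\<^esub> J = iprod I J" "\<one>\<^bsub>FG\<^esub> = \<O>"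
  by (simp_all add: fractional_ideal_group_def fractional_ideals_eq)

sublocale FG: comm_group FG
proof (rule comm_groupI)
  fix I assume "I \<in> carrier FG"
  then have I: "fractional I" by simp
  show "\<exists>J\<in>carrier FG. J \<otimes>\<^bsub>FG\<^esub> I = \<one>\<^bsub>FG\<^esub>"
    using iprod_inverse[OF I] fractional_inverse[OF I] iprod_comm[of I] by (intro bexI[of _ "inverse_ideal I"]) simp_all
qed (simp_all add: fractional_iprod fractional_O iprod_assoc iprod_O, rule iprod_comm)

lemma Pr_eq: "Pr = {principal x | x. x \<in> K \<and> x \<noteq> 0}"
  by (simp add: principal_fractional_ideals_def principal_def carrier_cyclo_field)

lemma principal_in_Pr: "x \<in> K \<Longrightarrow> x \<noteq> 0 \<Longrightarrow> principal x \<in> Pr"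
  unfolding Pr_eq by blast

lemma Pr_E:
  assumes "I \<in> Pr" obtains x where "I = principal x" "x \<in> K" "x \<noteq> 0"
  using assms unfolding Pr_eq by blast

lemma subgroup_Pr: "subgroup Pr FG"
proof (rule FG.subgroupI)
  show "Pr \<subseteq> carrier FG" using fractional_principal by (auto simp: Pr_eq)
  have "principal 1 \<in> Pr" by (rule principal_in_Pr[OF K_1 one_neq_zero])
  then show "Pr \<noteq> {}" by blast
next
  fix I assume "I \<in> Pr"
  then obtain x where x: "I = principal x" "x \<in> K" "x \<noteq> 0" by (rule Pr_E)
  have x': "inverse x \<in> K" "inverse x \<noteq> 0" using K_inverse[OF x(2)] x(3) by auto
  have c1: "principal x \<in> carrier FG" using fractional_principal[OF x(2,3)] by simp
  have c2: "principal (inverse x) \<in> carrier FG" using fractional_principal[OF x'] by simp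
  have "inverse x * x = 1" by (rule left_inverse[OF x(3)])
  then have "principal (inverse x) \<otimes>\<^bsub>FG\<^esub> principal x = \<one>\<^bsub>FG\<^esub>"
    unfolding FG_simps iprod_principal using principal_1 by metis
  then have "inv\<^bsub>FG\<^esub> (principal x) = principal (inverse x)" by (rule FG.inv_equality[OF _ c1 c2])
  then show "inv\<^bsub>FG\<^esub> I \<in> Pr" using principal_in_Pr[OF x'] x(1) by metis
next
  fix I J assume "I \<in> Pr" "J \<in> Pr"
  then obtain x y where xy: "I = principal x" "x \<in> K" "x \<noteq> 0" "J = principal y" "y \<in> K" "y \<noteq> 0"
    by (elim Pr_E)
  have "I \<otimes>\<^bsub>FG\<^esub> J = principal (x * y)" unfolding xy(1,4) FG_simps by (rule iprod_principal)
  moreover have "x * y \<in> K" "x * y \<noteq> 0" using xy by simp_all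
  ultimately show "I \<otimes>\<^bsub>FG\<^esub> J \<in> Pr" using principal_in_Pr by simp
qed

lemma normal_Pr: "Pr \<lhd> FG"
  by (rule FG.subgroup_imp_normal[OF subgroup_Pr])

sublocale CG: comm_group CG
  unfolding class_group_def by (rule FG.abelian_FactGroup[OF subgroup_Pr])

definition cls :: "complex set \<Rightarrow> complex set set" where "cls I = Pr #>\<^bsub>FG\<^esub> I"

lemma cls_hom: "group_hom FG CG cls"
proof -
  have "(\<lambda>a. Pr #>\<^bsub>FG\<^esub> a) \<in> hom FG (FG Mod Pr)" by (rule normal.r_coset_hom_Mod[OF normal_Pr])
  then have "cls \<in> hom FG CG" by (simp add: class_group_def cls_def[abs_def])
  then show ?thesis by (intro group_hom.intro group_hom_axioms.intro FG.is_group CG.is_group)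
qed

sublocale cls: group_hom FG CG cls by (rule cls_hom)

lemma cls_eq_1_iff:
  assumes "fractional I"
  shows "cls I = \<one>\<^bsub>CG\<^esub> \<longleftrightarrow> I \<in> Pr"
proof -
  have one: "\<one>\<^bsub>CG\<^esub> = Pr" by (simp add: class_group_def FactGroup_def)
  show ?thesis
    using FG.coset_join1[OF _ _ subgroup_Pr, of I] FG.coset_join2[OF _ subgroup_Pr, of I]
      subgroup.subset[OF subgroup_Pr] assms
    unfolding one cls_def by auto
qed

text \<open>
  The Sylow subgroup of an abelian group is unique and consists of the elements of \<open>p\<close>-power order.
\<close>

lemma p_class_group_eq: "p_class_group p \<zeta> = {x \<in> carrier CG. \<exists>n::nat. x [^]\<^bsub>CG\<^esub> (p ^ n) = \<one>\<^bsub>CG\<^esub>}"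
  unfolding p_class_group_def CG.sylow_subgroup_unique by (rule the_equality) auto

lemma ipow_eq: "fractional I \<Longrightarrow> I [^]\<^bsub>FG\<^esub> (n::nat) = ipow I n"
  by (induction n) simp_all

lemma principal_pow: "principal x [^]\<^bsub>FG\<^esub> (n::nat) = principal (x ^ n)"
  by (induction n) (simp_all add: principal_1 iprod_principal mult.commute)

lemma finprod_principal:
  "finite A \<Longrightarrow> (\<And>k. k \<in> A \<Longrightarrow> f k \<in> K \<and> f k \<noteq> 0) \<Longrightarrow>
    finprod FG (\<lambda>k. principal (f k)) A = principal (\<Prod>k\<in>A. f k)"
proof (induction A rule: finite_induct)
  case (insert k A)
  have "finprod FG (\<lambda>k. principal (f k)) (insert k A) = principal (f k) \<otimes>\<^bsub>FG\<^esub> finprod FG (\<lambda>k. principal (f k)) A"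
    using insert by (intro FG.finprod_insert) (auto simp: fractional_principal)
  then show ?case using insert by (simp add: iprod_principal)
qed (simp add: principal_1)

lemma finprod_cls:
  "finite A \<Longrightarrow> (\<And>k. k \<in> A \<Longrightarrow> fractional (f k)) \<Longrightarrow> finprod CG (\<lambda>k. cls (f k)) A = cls (finprod FG f A)"
proof (induction A rule: finite_induct)
  case (insert k A)
  have "finprod CG (\<lambda>k. cls (f k)) (insert k A) = cls (f k) \<otimes>\<^bsub>CG\<^esub> finprod CG (\<lambda>k. cls (f k)) A"
    using insert by (intro CG.finprod_insert) auto
  also have "\<dots> = cls (f k \<otimes>\<^bsub>FG\<^esub> finprod FG f A)"
    using insert by (subst cls.hom_mult) (auto intro!: FG.finprod_closed[unfolded FG_simps, simplified])
  also have "f k \<otimes>\<^bsub>FG\<^esub> finprod FG f A = finprod FG f (insert k A)"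
    using insert by (intro FG.finprod_insert[symmetric]) auto
  finally show ?case .
qed (use cls.hom_one in simp)

lemma finprod_pow:
  "finite A \<Longrightarrow> (\<And>k. k \<in> A \<Longrightarrow> fractional (f k)) \<Longrightarrow>
    finprod FG f A [^]\<^bsub>FG\<^esub> (n::nat) = finprod FG (\<lambda>k. f k [^]\<^bsub>FG\<^esub> n) A"
proof (induction A rule: finite_induct)
  case (insert k A)
  have fk: "f \<in> A \<rightarrow> carrier FG" "f k \<in> carrier FG" using insert by auto
  have "finprod FG f (insert k A) [^]\<^bsub>FG\<^esub> n = (f k \<otimes>\<^bsub>FG\<^esub> finprod FG f A) [^]\<^bsub>FG\<^esub> n"
    using insert fk by (subst FG.finprod_insert) auto
  also have "\<dots> = f k [^]\<^bsub>FG\<^esub> n \<otimes>\<^bsub>FG\<^esub> finprod FG f A [^]\<^bsub>FG\<^esub> n"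
    using fk by (intro FG.nat_pow_distrib FG.finprod_closed)
  also have "\<dots> = f k [^]\<^bsub>FG\<^esub> n \<otimes>\<^bsub>FG\<^esub> finprod FG (\<lambda>k. f k [^]\<^bsub>FG\<^esub> n) A"
    using insert by simp
  also have "\<dots> = finprod FG (\<lambda>k. f k [^]\<^bsub>FG\<^esub> n) (insert k A)"
    using insert fk by (intro FG.finprod_insert[symmetric]) (auto intro!: FG.nat_pow_closed simp del: FG_simps)
  finally show ?case .
qed (use FG.nat_pow_one[of n] in simp)

lemma sig_ipow:
  assumes k: "\<not> p dvd k" and I: "fractional I"
  shows "sig k ` ipow I n = ipow (sig k ` I) n"
  by (induction n) (simp_all add: sig_image_O[OF k] sig_iprod[OF k fractional_ipow[OF I] I])

definition aut :: "nat \<Rightarrow> complex \<Rightarrow> complex" where "aut k = restrict (sig k) K"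

text \<open>
  The automorphism permutes the principal ideals, so it maps the coset of \<open>I\<close> onto the coset of its image.
\<close>

lemma class_act_cls:
  assumes k: "\<not> p dvd k" and I: "fractional I"
  shows "class_act (aut k) (cls I) = cls (sig k ` I)"
proof -
  obtain l where l: "\<not> p dvd l" "\<And>x. x \<in> K \<Longrightarrow> sig k (sig l x) = x" using sig_inverse_exists[OF k] by metis
  have cls: "cls J = {iprod (principal x) J | x. x \<in> K \<and> x \<noteq> 0}" for J
    by (auto simp: cls_def r_coset_def Pr_eq)
  have im: "aut k ` J = sig k ` J" if "fractional J" for J
    unfolding aut_def using fractional_K[OF that] by (intro image_cong) auto
  have main: "aut k ` iprod (principal x) I = iprod (principal (sig k x)) (sig k ` I)" if "x \<in> K" "x \<noteq> 0" for x
    using that k I by (simp add: im fractional_iprod fractional_principal sig_iprod sig_principal)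
  show ?thesis
  proof (intro equalityI subsetI)
    fix c assume "c \<in> class_act (aut k) (cls I)"
    then obtain x where "x \<in> K" "x \<noteq> 0" "c = aut k ` iprod (principal x) I" unfolding class_act_def cls by blast
    then have "c = iprod (principal (sig k x)) (sig k ` I)" "sig k x \<in> K" "sig k x \<noteq> 0"
      using main k by (auto simp: sig_eq_0_iff)
    then show "c \<in> cls (sig k ` I)" unfolding cls by blast
  next
    fix c assume "c \<in> cls (sig k ` I)"
    then obtain x where x: "x \<in> K" "x \<noteq> 0" "c = iprod (principal x) (sig k ` I)" unfolding cls by blast
    then have "c = aut k ` iprod (principal (sig l x)) I" "sig l x \<in> K" "sig l x \<noteq> 0"
      using main[of "sig l x"] l by (auto simp: sig_eq_0_iff)
    then show "c \<in> class_act (aut k) (cls I)" unfolding class_act_def cls by blast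
  qed
qed

text \<open>
  The order of \<open>y\<close> is \<open>1\<close> or \<open>p\<close>; in the first case the exponent in the definition is the component of
  index \<open>0\<close>, but then both sides are trivial.
\<close>

lemma padic_power_of_p_torsion:
  assumes y: "y \<in> carrier CG" "y [^]\<^bsub>CG\<^esub> p = \<one>\<^bsub>CG\<^esub>" and a: "a 1 \<ge> 0"
  shows "padic_power p CG y a = y [^]\<^bsub>CG\<^esub> nat (a 1)"
proof (cases "y = \<one>\<^bsub>CG\<^esub>")
  case True
  then show ?thesis by (simp add: padic_power_def)
next
  case False
  have "(LEAST n. y [^]\<^bsub>CG\<^esub> (p ^ n) = \<one>\<^bsub>CG\<^esub>) = 1"
  proof (rule Least_equality)
    show "y [^]\<^bsub>CG\<^esub> (p ^ 1) = \<one>\<^bsub>CG\<^esub>" using y by simp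
    fix n assume n: "y [^]\<^bsub>CG\<^esub> (p ^ n) = \<one>\<^bsub>CG\<^esub>"
    show "1 \<le> n" using n False y(1) by (cases n) auto
  qed
  then have "padic_power p CG y a = y [^]\<^bsub>CG\<^esub> a 1" by (simp add: padic_power_def)
  also have "\<dots> = y [^]\<^bsub>CG\<^esub> int (nat (a 1))" using a by simp
  also have "\<dots> = y [^]\<^bsub>CG\<^esub> nat (a 1)" by (rule int_pow_int)
  finally show ?thesis .
qed

lemma aut_zeta: "\<not> p dvd k \<Longrightarrow> aut k \<zeta> = \<zeta> ^ k"
  by (simp add: aut_def)

lemma aut_in_gal:
  assumes k: "\<not> p dvd k"
  shows "aut k \<in> cyclo_gal \<zeta>"
proof -
  obtain l where l: "\<not> p dvd l" "\<And>x. x \<in> K \<Longrightarrow> sig l (sig k x) = x" "\<And>x. x \<in> K \<Longrightarrow> sig k (sig l x) = x"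
    using sig_inverse_exists[OF k] by metis
  have "aut k \<in> Ring.ring_hom (cyclo_field \<zeta>) (cyclo_field \<zeta>)"
    by (rule ring_hom_memI) (use k in \<open>auto simp: carrier_cyclo_field aut_def sig_add sig_mult\<close>)
  moreover have "bij_betw (aut k) K K"
    by (rule bij_betw_byWitness[where f' = "sig l"]) (use k l in \<open>auto simp: aut_def\<close>)
  ultimately show ?thesis
    unfolding cyclo_gal_def ring_iso_def using k by (auto simp: carrier_cyclo_field aut_def sig_Rats K_Rats)
qed

text \<open>
  The image of \<open>\<zeta>\<close> is a root of \<open>X\<^sup>p - 1\<close> different from \<open>1\<close>, and it determines the automorphism.
\<close>

lemma gal_is_aut:
  assumes s: "\<sigma> \<in> cyclo_gal \<zeta>"
  obtains k where "k \<in> {1..<p}" "\<sigma> = aut k"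
proof -
  have hom: "\<sigma> \<in> Ring.ring_hom (cyclo_field \<zeta>) (cyclo_field \<zeta>)" and bij: "bij_betw \<sigma> K K"
    and extn: "\<sigma> \<in> extensional K" and rat: "\<And>q. q \<in> \<rat> \<Longrightarrow> \<sigma> q = q"
    using s unfolding cyclo_gal_def ring_iso_def by (auto simp: carrier_cyclo_field)
  have mult: "\<sigma> (x * y) = \<sigma> x * \<sigma> y" and add: "\<sigma> (x + y) = \<sigma> x + \<sigma> y" if "x \<in> K" "y \<in> K" for x y
    using ring_hom_mult[OF hom, of x y] ring_hom_add[OF hom, of x y] that by (simp_all add: carrier_cyclo_field)
  have one: "\<sigma> 1 = 1" by (rule rat) simp
  have pow: "\<sigma> (\<zeta> ^ n) = \<sigma> \<zeta> ^ n" for n by (induction n) (simp_all add: one mult)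
  have "(\<Prod>k<p. \<sigma> \<zeta> - \<zeta> ^ k * 1) = \<sigma> \<zeta> ^ p - 1 ^ p" by (rule prod_diff_zeta)
  also have "\<dots> = 0" using pow[of p] root one by simp
  finally obtain k where k: "k < p" "\<sigma> \<zeta> = \<zeta> ^ k" by auto
  have "\<zeta> \<noteq> 1" using primitive[of 1] gt2 by simp
  then have "\<sigma> \<zeta> \<noteq> \<sigma> 1" using bij_betw_imp_inj_on[OF bij] by (auto dest: inj_onD)
  then have "k \<noteq> 0" using k one by (cases k) auto
  then have kr: "k \<in> {1..<p}" using k by simp
  then have nk: "\<not> p dvd k" by (rule not_dvd_range)
  have poly: "\<sigma> (ipoly F \<zeta>) = ipoly F (\<zeta> ^ k)" for F
    by (induction F) (simp_all add: rat add mult k(2))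
  have sig: "\<sigma> x = sig k x" if x: "x \<in> K" for x
  proof -
    obtain F n where F: "n \<noteq> 0" "x = ipoly F \<zeta> / of_int n" using x by (rule K_E)
    have "\<sigma> (x * of_int n) = \<sigma> x * of_int n" using mult[OF x K_of_int] rat by simp
    moreover have "x * of_int n = ipoly F \<zeta>" using F by simp
    ultimately have "\<sigma> x = ipoly F (\<zeta> ^ k) / of_int n" using poly F(1) by (simp add: field_simps)
    then show ?thesis unfolding F(2) sig_eq[OF F(1) nk] .
  qed
  have "\<sigma> = aut k"
  proof
    fix x show "\<sigma> x = aut k x"
      unfolding aut_def using sig[of x] extn by (cases "x \<in> K") (simp_all add: extensional_def)
  qed
  then show thesis using that kr by blast
qed

lemma aut_inj: "j \<in> {1..<p} \<Longrightarrow> k \<in> {1..<p} \<Longrightarrow> aut j \<zeta> = aut k \<zeta> \<Longrightarrow> j = k"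
  using zeta_power_eq_iff[of j k] by (simp add: aut_zeta not_dvd_range)

lemma cyclo_aut_eq: "k \<in> {1..<p} \<Longrightarrow> cyclo_aut \<zeta> k = aut k"
  unfolding cyclo_aut_def
proof (rule the_equality)
  assume k: "k \<in> {1..<p}"
  then show "aut k \<in> cyclo_gal \<zeta> \<and> aut k \<zeta> = \<zeta> ^ k" using aut_in_gal aut_zeta not_dvd_range by blast
  fix \<sigma> assume s: "\<sigma> \<in> cyclo_gal \<zeta> \<and> \<sigma> \<zeta> = \<zeta> ^ k"
  then obtain j where j: "j \<in> {1..<p}" "\<sigma> = aut j" using gal_is_aut by blast
  then have "aut j \<zeta> = aut k \<zeta>" using s aut_zeta[OF not_dvd_range[OF k]] by simp
  then show "\<sigma> = aut k" using aut_inj j k by blast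
qed

lemma cyclo_gal_eq: "cyclo_gal \<zeta> = aut ` {1..<p}" and inj_on_aut: "inj_on aut {1..<p}"
  using gal_is_aut aut_in_gal not_dvd_range aut_inj by (blast, metis inj_onI)

lemma range_eq: "{1..p - 1} = {1..<p}" using gt2 by auto

lemma omega_aut:
  assumes k: "k \<in> {1..<p}"
  shows "omega p \<zeta> (aut k) = teichmuller p k"
proof -
  have "(THE k'. k' \<in> {1..p - 1} \<and> aut k = cyclo_aut \<zeta> k') = k"
    unfolding range_eq by (rule the_equality) (use k cyclo_aut_eq inj_onD[OF inj_on_aut] in auto)
  then show ?thesis using aut_in_gal[OF not_dvd_range[OF k]] by (simp add: omega_def)
qed

text \<open>
  The class of \<open>I\<close> has order dividing \<open>p\<close>, so it lies in the \<open>p\<close>-class group and only the residues modulo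
  \<open>p\<close> of the coefficients of \<open>\<theta>\<close> matter. Triviality of its \<open>\<theta>\<close>-th power gives a principal product of
  conjugates of \<open>I\<close>; its \<open>p\<close>-th power is the product of the conjugates of \<open>(\<alpha>)\<close>.
\<close>

theorem principal_of_trivial_component:
  assumes I: "fractional I" and pow: "ipow I p = principal \<alpha>" and \<alpha>: "\<alpha> \<in> K" "\<alpha> \<noteq> 0"
    and \<theta>: "\<And>k. k \<in> {1..<p} \<Longrightarrow> \<theta> (aut k) 1 \<ge> 0"
    and trivial: "\<And>c. c \<in> p_class_group p \<zeta> \<Longrightarrow> group_ring_power p \<zeta> c \<theta> = \<one>\<^bsub>CG\<^esub>"
  obtains g where "g \<in> K" "g \<noteq> 0"
    "principal (\<Prod>k\<in>{1..<p}. sig k \<alpha> ^ nat (\<theta> (aut k) 1)) = principal (g ^ p)"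
proof -
  define n where "n k = nat (\<theta> (aut k) 1)" for k
  define J where "J k = sig k ` I" for k
  have J: "fractional (J k)" if "k \<in> {1..<p}" for k
    unfolding J_def by (rule fractional_sig[OF not_dvd_range[OF that] I])
  have J_carr: "J k \<in> carrier FG" if "k \<in> {1..<p}" for k using J[OF that] by simp
  have Jp: "J k [^]\<^bsub>FG\<^esub> p = principal (sig k \<alpha>)" if "k \<in> {1..<p}" for k
    using ipow_eq[OF J[OF that]] sig_ipow[OF not_dvd_range[OF that] I, of p] pow
      sig_principal[OF not_dvd_range[OF that] \<alpha>(1)] by (simp add: J_def)
  have sa: "sig k \<alpha> \<in> K" "sig k \<alpha> \<noteq> 0" if "k \<in> {1..<p}" for k
    using \<alpha> not_dvd_range[OF that] by (simp_all add: sig_eq_0_iff)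
  have cls_principal: "cls (principal x) = \<one>\<^bsub>CG\<^esub>" if "x \<in> K" "x \<noteq> 0" for x
    using cls_eq_1_iff[OF fractional_principal[OF that]] principal_in_Pr[OF that] by simp
  have carr: "cls (J k) \<in> carrier CG" if "k \<in> {1..<p}" for k using J_carr[OF that] by (rule cls.hom_closed)
  have tors: "cls (J k) [^]\<^bsub>CG\<^esub> p = \<one>\<^bsub>CG\<^esub>" if "k \<in> {1..<p}" for k
    using cls.hom_nat_pow[OF J_carr[OF that], of p] Jp[OF that] cls_principal[OF sa[OF that]] by simp
  have I_carr: "I \<in> carrier FG" using I by simp
  have "cls I [^]\<^bsub>CG\<^esub> p = \<one>\<^bsub>CG\<^esub>"
    using cls.hom_nat_pow[OF I_carr, of p] ipow_eq[OF I] pow cls_principal[OF \<alpha>] by simp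
  then have "cls I [^]\<^bsub>CG\<^esub> (p ^ 1) = \<one>\<^bsub>CG\<^esub>" by simp
  then have "cls I \<in> p_class_group p \<zeta>" unfolding p_class_group_eq using cls.hom_closed[OF I_carr] by blast
  then have "\<one>\<^bsub>CG\<^esub> = group_ring_power p \<zeta> (cls I) \<theta>" by (rule trivial[symmetric])
  also have "\<dots> = finprod CG (\<lambda>k. padic_power p CG (class_act (aut k) (cls I)) (\<theta> (aut k))) {1..<p}"
    unfolding group_ring_power_def cyclo_gal_eq
  proof (rule CG.finprod_reindex[OF _ inj_on_aut])
    show "(\<lambda>\<sigma>. padic_power p CG (class_act \<sigma> (cls I)) (\<theta> \<sigma>)) \<in> aut ` {1..<p} \<rightarrow> carrier CG"
    proof
      fix \<sigma> assume "\<sigma> \<in> aut ` {1..<p}"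
      then obtain k where k: "k \<in> {1..<p}" "\<sigma> = aut k" by blast
      show "padic_power p CG (class_act \<sigma> (cls I)) (\<theta> \<sigma>) \<in> carrier CG"
        unfolding k(2) class_act_cls[OF not_dvd_range[OF k(1)] I] J_def[symmetric]
          padic_power_of_p_torsion[of _ "\<theta> (aut k)", OF carr[OF k(1)] tors[OF k(1)] \<theta>[OF k(1)]]
        by (rule CG.nat_pow_closed[OF carr[OF k(1)]])
    qed
  qed
  also have "\<dots> = finprod CG (\<lambda>k. cls (J k [^]\<^bsub>FG\<^esub> n k)) {1..<p}"
  proof (rule CG.finprod_cong'[OF refl])
    show "(\<lambda>k. cls (J k [^]\<^bsub>FG\<^esub> n k)) \<in> {1..<p} \<rightarrow> carrier CG"
      by (intro funcsetI cls.hom_closed FG.nat_pow_closed J_carr)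
    fix k assume k: "k \<in> {1..<p}"
    show "padic_power p CG (class_act (aut k) (cls I)) (\<theta> (aut k)) = cls (J k [^]\<^bsub>FG\<^esub> n k)"
      unfolding class_act_cls[OF not_dvd_range[OF k] I] J_def[symmetric]
        padic_power_of_p_torsion[of _ "\<theta> (aut k)", OF carr[OF k] tors[OF k] \<theta>[OF k]] n_def
      by (rule cls.hom_nat_pow[OF J_carr[OF k], symmetric])
  qed
  also have "\<dots> = cls (finprod FG (\<lambda>k. J k [^]\<^bsub>FG\<^esub> n k) {1..<p})"
    by (rule finprod_cls) (use FG.nat_pow_closed[OF J_carr] in simp_all)
  finally have triv: "cls (finprod FG (\<lambda>k. J k [^]\<^bsub>FG\<^esub> n k) {1..<p}) = \<one>\<^bsub>CG\<^esub>" ..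
  have "finprod FG (\<lambda>k. J k [^]\<^bsub>FG\<^esub> n k) {1..<p} \<in> carrier FG"
    by (intro FG.finprod_closed funcsetI FG.nat_pow_closed J_carr)
  then have "finprod FG (\<lambda>k. J k [^]\<^bsub>FG\<^esub> n k) {1..<p} \<in> Pr"
    using cls_eq_1_iff triv by simp
  then obtain g where g: "finprod FG (\<lambda>k. J k [^]\<^bsub>FG\<^esub> n k) {1..<p} = principal g" "g \<in> K" "g \<noteq> 0"
    by (rule Pr_E)
  have "principal (g ^ p) = finprod FG (\<lambda>k. J k [^]\<^bsub>FG\<^esub> n k) {1..<p} [^]\<^bsub>FG\<^esub> p"
    unfolding g(1) principal_pow ..
  also have "\<dots> = finprod FG (\<lambda>k. (J k [^]\<^bsub>FG\<^esub> n k) [^]\<^bsub>FG\<^esub> p) {1..<p}"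
    by (rule finprod_pow) (use FG.nat_pow_closed[OF J_carr] in simp_all)
  also have "\<dots> = finprod FG (\<lambda>k. principal (sig k \<alpha> ^ n k)) {1..<p}"
  proof (rule FG.finprod_cong'[OF refl])
    show "(\<lambda>k. principal (sig k \<alpha> ^ n k)) \<in> {1..<p} \<rightarrow> carrier FG"
      using sa fractional_principal by simp
    fix k assume k: "k \<in> {1..<p}"
    have "(J k [^]\<^bsub>FG\<^esub> n k) [^]\<^bsub>FG\<^esub> p = (J k [^]\<^bsub>FG\<^esub> p) [^]\<^bsub>FG\<^esub> n k"
      unfolding FG.nat_pow_pow[OF J_carr[OF k]] by (simp only: mult.commute)
    then show "(J k [^]\<^bsub>FG\<^esub> n k) [^]\<^bsub>FG\<^esub> p = principal (sig k \<alpha> ^ n k)"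
      unfolding Jp[OF k] principal_pow .
  qed
  also have "\<dots> = principal (\<Prod>k\<in>{1..<p}. sig k \<alpha> ^ n k)"
    by (rule finprod_principal) (use sa in simp_all)
  finally show thesis using that g unfolding n_def by metis
qed

end

theorem theorem3p7:
  fixes p :: nat and \<zeta> :: complex and a b c :: int
    and \<chi> :: "(complex \<Rightarrow> complex) \<Rightarrow> (nat \<Rightarrow> int)"
  assumes "Factorial_Ring.prime p" and "p > 2"
    and "\<zeta> ^ p = 1" and "\<forall>k\<in>{1..<p}. \<zeta> ^ k \<noteq> 1"
    and "a \<noteq> 0" and "b \<noteq> 0" and "c \<noteq> 0"
    and "coprime a b" and "coprime b c" and "coprime a c"
    and "a ^ p + b ^ p + c ^ p = 0"
    and "\<not> int p dvd a * b * c"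
    and "\<chi> \<in> padic_characters p \<zeta>" and "odd_character p \<zeta> \<chi>" and "\<chi> \<noteq> omega p \<zeta>"
    and "\<not> padic_cong p
           (mirimanoff_eval p \<zeta> (dual_character p \<zeta> \<chi>)
              (padic_of_int p (- b) \<otimes>\<^bsub>padic_ints p\<^esub> inv\<^bsub>padic_ints p\<^esub> (padic_of_int p a)))
           \<zero>\<^bsub>padic_ints p\<^esub>"
  shows "class_component p \<zeta> \<chi> \<noteq> {\<one>\<^bsub>class_group \<zeta>\<^esub>}"
proof
  assume triv: "class_component p \<zeta> \<chi> = {\<one>\<^bsub>class_group \<zeta>\<^esub>}"
  have pa: "\<not> int p dvd a" and pc: "\<not> int p dvd c"
    using assms(12) by (auto simp: dvd_mult dvd_mult2)
  interpret fermat_first_case p \<zeta> a b c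
    by unfold_locales (use assms pc in auto)
  interpret padic p by unfold_locales (rule prime)
  \<comment> \<open>This keeps \<open>1 - z\<close> a unit modulo \<open>p\<close> for \<open>z = -b/a\<close>.\<close>
  have pab: "\<not> int p dvd a + b"
  proof
    assume "int p dvd a + b"
    moreover have "a + b dvd a ^ p - (- b) ^ p" using dvdI[OF power_diff_sumr2[of a p "- b"]] by simp
    moreover have "a ^ p - (- b) ^ p = (- c) ^ p"
      using fermat power_minus_odd[OF odd_p, of b] power_minus_odd[OF odd_p, of c] by simp
    ultimately have "int p dvd (- c) ^ p" by (metis dvd_trans)
    then have "int p dvd - c" by (rule prime_dvd_power[rotated]) (use prime in simp)
    then show False using pc by simp
  qed
  obtain m where m: "m \<in> {1..p - 1}" and \<chi>_def: "\<chi> = (\<lambda>\<sigma>\<in>cyclo_gal \<zeta>. omega p \<zeta> \<sigma> [^]\<^bsub>Zp\<^esub> m)"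
    using assms(13) unfolding padic_characters_def by blast
  define T where "T k = teichmuller p k" for k
  have T: "T k \<in> Units Zp" "T k \<in> carrier Zp" "[T k 1 = int k] (mod int p)" if "k \<in> {1..<p}" for k
    using teichmuller[OF not_dvd_range[OF that]] by (auto simp: T_def Units_iff Cong.cong_def)
  have gal: "aut k \<in> cyclo_gal \<zeta>" if "k \<in> {1..<p}" for k by (rule aut_in_gal[OF not_dvd_range[OF that]])
  have \<chi>_aut: "\<chi> (aut k) = T k [^]\<^bsub>Zp\<^esub> m" if "k \<in> {1..<p}" for k
    using gal[OF that] omega_aut[OF that] by (simp add: \<chi>_def T_def)
  have \<chi>_unit: "\<chi> (aut k) \<in> Units Zp" if "k \<in> {1..<p}" for k
    unfolding \<chi>_aut[OF that] by (rule Zp.Units_pow_closed[OF T(1)[OF that]])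
  have \<chi>_1: "[\<chi> (aut k) 1 = int k ^ m] (mod int p)" if "k \<in> {1..<p}" for k
  proof -
    have "[\<chi> (aut k) 1 = T k 1 ^ m] (mod int p)"
      unfolding \<chi>_aut[OF that] nth_pow[OF T(2)[OF that]] by (simp add: Cong.cong_def)
    then show ?thesis using cong_pow[OF T(3)[OF that], of m] cong_trans by blast
  qed
  have nth_1_mult: "[(x \<otimes>\<^bsub>Zp\<^esub> y) 1 = x 1 * y 1] (mod int p)" for x y
    by (simp add: nth_mult Cong.cong_def)
  \<comment> \<open>At the index \<open>p - 1 \<equiv> -1\<close> the character takes the value \<open>-1\<close>, and its residue is \<open>(-1)\<^sup>m\<close>.\<close>
  have "odd m"
  proof
    assume "even m"
    have q: "p - 1 \<in> {1..<p}" using gt2 by simp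
    have "\<chi> (aut (p - 1)) = \<ominus>\<^bsub>Zp\<^esub> \<one>\<^bsub>Zp\<^esub>"
      using assms(14) unfolding odd_character_def cyclo_aut_eq[OF q] .
    then have "[\<chi> (aut (p - 1)) 1 = - 1] (mod int p)"
      using nth_minus[OF Zp.one_closed, of 1] nth_one[of 1] by (simp add: Cong.cong_def mod_simps)
    then have 1: "[int (p - 1) ^ m = - 1] (mod int p)" using \<chi>_1[OF q] by (meson cong_sym cong_trans)
    have "[int (p - 1) = - 1] (mod int p)" using gt2 by (simp add: of_nat_diff cong_iff_dvd_diff)
    from cong_pow[OF this, of m] have "[int (p - 1) ^ m = 1] (mod int p)" using \<open>even m\<close> by simp
    with 1 have "[1 = - 1] (mod int p)" by (meson cong_sym cong_trans)
    then have "int p dvd 2" by (simp add: cong_iff_dvd_diff)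
    then show False using gt2 by (auto dest: zdvd_imp_le)
  qed
  have "m \<noteq> 1"
  proof
    assume "m = 1"
    have "\<chi> = omega p \<zeta>"
    proof
      fix \<sigma>
      show "\<chi> \<sigma> = omega p \<zeta> \<sigma>"
      proof (cases "\<sigma> \<in> cyclo_gal \<zeta>")
        case True
        then obtain k where k: "k \<in> {1..<p}" "\<sigma> = aut k" by (rule gal_is_aut)
        show ?thesis unfolding k(2) \<chi>_aut[OF k(1)] omega_aut[OF k(1)] \<open>m = 1\<close>
          using T(2)[OF k(1)] by (simp add: T_def)
      qed (simp add: \<chi>_def omega_def)
    qed
    then show False using assms(15) by simp
  qed
  define r where "r = m - 1"
  have mr: "m = Suc r" using m by (simp add: r_def)
  have r: "0 < r" "even r" "r + 3 \<le> p"
  proof -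
    show "0 < r" using \<open>m \<noteq> 1\<close> mr by simp
    show "even r" using \<open>odd m\<close> mr by simp
    have "m \<noteq> p - 1" using \<open>odd m\<close> odd_p by auto
    then show "r + 3 \<le> p" using m mr by auto
  qed
  have k_cop: "coprime (int k) (int p)" if "k \<in> {1..<p}" for k
    using prime_imp_coprime[of "int p" "int k"] prime not_dvd_range[OF that] by (simp add: coprime_commute)

  define z where "z = padic_of_int p (- b) \<otimes>\<^bsub>Zp\<^esub> inv\<^bsub>Zp\<^esub> (padic_of_int p a)"
  have a_unit: "padic_of_int p a \<in> Units Zp"
    unfolding Units_iff using of_int_closed pa by (simp add: nth_of_int dvd_mod_iff)
  have z: "z \<in> carrier Zp" unfolding z_def by (intro Zp.m_closed of_int_closed Zp.Units_inv_closed a_unit)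
  have za: "int p dvd z 1 * a + b"
  proof -
    have "[padic_of_int p a 1 = a] (mod int p)" "[padic_of_int p (- b) 1 = - b] (mod int p)"
      by (simp_all add: nth_of_int Cong.cong_def)
    have "[z 1 * a = (- b) * (inv\<^bsub>Zp\<^esub> (padic_of_int p a)) 1 * padic_of_int p a 1] (mod int p)"
      unfolding z_def
      by (intro cong_mult cong_trans[OF nth_1_mult] cong_refl) (simp_all add: nth_of_int Cong.cong_def)
    also have "(- b) * (inv\<^bsub>Zp\<^esub> (padic_of_int p a)) 1 * padic_of_int p a 1
      = - b * (padic_of_int p a 1 * (inv\<^bsub>Zp\<^esub> (padic_of_int p a)) 1)" by (simp only: mult_ac)
    also have "[\<dots> = - b * 1] (mod int p)" by (rule cong_scalar_left[OF inv_1[OF a_unit]])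
    finally show ?thesis by (simp add: cong_iff_dvd_diff)
  qed

  \<comment> \<open>The dual character has residue \<open>k\<close> divided by \<open>k\<^sup>m\<close>, so its inverse has residue \<open>k\<^sup>r\<close> with \<open>r = m - 1\<close>.\<close>
  define D where "D k = dual_character p \<zeta> \<chi> (aut k)" for k
  have D: "D k \<in> Units Zp" "[(inv\<^bsub>Zp\<^esub> (D k)) 1 = int k ^ r] (mod int p)" if k: "k \<in> {1..<p}" for k
  proof -
    have Dk: "D k = T k \<otimes>\<^bsub>Zp\<^esub> inv\<^bsub>Zp\<^esub> (\<chi> (aut k))"
      using gal[OF k] omega_aut[OF k] by (simp add: D_def dual_character_def T_def)
    show unit: "D k \<in> Units Zp" unfolding Dk
      by (intro Zp.Units_m_closed T(1) Zp.Units_inv_Units \<chi>_unit k)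
    define w where "w = (inv\<^bsub>Zp\<^esub> (D k)) 1"
    define v where "v = (inv\<^bsub>Zp\<^esub> (\<chi> (aut k))) 1"
    have Dw: "[D k 1 * w = 1] (mod int p)" unfolding w_def by (rule inv_1[OF unit])
    have \<chi>v: "[int k ^ m * v = 1] (mod int p)"
      using inv_1[OF \<chi>_unit[OF k]] cong_scalar_right[OF \<chi>_1[OF k], of v] unfolding v_def
      by (meson cong_sym cong_trans)
    have "[D k 1 = int k * v] (mod int p)"
      unfolding Dk v_def by (rule cong_trans[OF nth_1_mult]) (rule cong_scalar_right[OF T(3)[OF k]])
    from cong_scalar_right[OF this, of w] have "[int k * v * w = 1] (mod int p)"
      using Dw by (meson cong_sym cong_trans)
    from cong_scalar_left[OF this, of "int k ^ r"]
    have "[int k ^ r * (int k * v * w) = int k ^ r] (mod int p)" by simp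
    moreover have "int k ^ r * (int k * v * w) = (int k ^ m * v) * w" by (simp add: mr mult_ac)
    moreover have "[(int k ^ m * v) * w = 1 * w] (mod int p)" by (rule cong_scalar_right[OF \<chi>v])
    ultimately show "[w = int k ^ r] (mod int p)" by (metis cong_sym cong_trans mult_1)
  qed
  have eval: "mirimanoff_eval p \<zeta> (dual_character p \<zeta> \<chi>) z
    = (\<Oplus>\<^bsub>Zp\<^esub>k\<in>{1..p - 1}. inv\<^bsub>Zp\<^esub> (dual_character p \<zeta> \<chi> (cyclo_aut \<zeta> k)) \<otimes>\<^bsub>Zp\<^esub> z [^]\<^bsub>Zp\<^esub> k)"
    by (rule mirimanoff_eval_eq) (use D(1) z in \<open>simp_all only: range_eq cyclo_aut_eq D_def\<close>)
  have term_closed: "inv\<^bsub>Zp\<^esub> (dual_character p \<zeta> \<chi> (cyclo_aut \<zeta> k)) \<otimes>\<^bsub>Zp\<^esub> z [^]\<^bsub>Zp\<^esub> k \<in> carrier Zp"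
    if "k \<in> {1..p - 1}" for k
    using that D(1)[of k] unfolding range_eq D_def
    by (simp only: cyclo_aut_eq Zp.m_closed Zp.Units_inv_closed Zp.nat_pow_closed z)
  have "mirimanoff_eval p \<zeta> (dual_character p \<zeta> \<chi>) z \<in> carrier Zp"
    unfolding eval by (intro Zp.finsum_closed funcsetI term_closed)
  then have eval_nz: "mirimanoff_eval p \<zeta> (dual_character p \<zeta> \<chi>) z 1 \<noteq> 0"
    using assms(16) cong_iff[OF _ Zp.zero_closed] nth_zero[of 1] unfolding z_def[symmetric] by simp
  have eval_1: "mirimanoff_eval p \<zeta> (dual_character p \<zeta> \<chi>) z 1
    = (\<Sum>k\<in>{1..p - 1}. (inv\<^bsub>Zp\<^esub> (dual_character p \<zeta> \<chi> (cyclo_aut \<zeta> k)) \<otimes>\<^bsub>Zp\<^esub> z [^]\<^bsub>Zp\<^esub> k) 1) mod int p"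
    unfolding eval using nth_finsum[of "{1..p - 1}" _ 1, OF _ term_closed] by simp
  have eval_cong: "[(\<Sum>k\<in>{1..p - 1}. (inv\<^bsub>Zp\<^esub> (dual_character p \<zeta> \<chi> (cyclo_aut \<zeta> k)) \<otimes>\<^bsub>Zp\<^esub> z [^]\<^bsub>Zp\<^esub> k) 1)
      = (\<Sum>k\<in>{1..p - 1}. int k ^ r * z 1 ^ k)] (mod int p)"
  proof (rule cong_sum)
    fix k assume "k \<in> {1..p - 1}"
    then have k: "k \<in> {1..<p}" unfolding range_eq .
    have zk: "[(z [^]\<^bsub>Zp\<^esub> k) 1 = z 1 ^ k] (mod int p)"
      unfolding nth_pow[OF z] by (simp add: Cong.cong_def)
    show "[(inv\<^bsub>Zp\<^esub> (dual_character p \<zeta> \<chi> (cyclo_aut \<zeta> k)) \<otimes>\<^bsub>Zp\<^esub> z [^]\<^bsub>Zp\<^esub> k) 1 = int k ^ r * z 1 ^ k] (mod int p)"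
      unfolding cyclo_aut_eq[OF k] D_def[symmetric]
      by (rule cong_trans[OF nth_1_mult]) (rule cong_mult[OF D(2)[OF k] zk])
  qed
  have nonzero: "\<not> int p dvd (\<Sum>k\<in>{1..p - 1}. int k ^ r * z 1 ^ k)"
    using eval_nz unfolding eval_1 dvd_eq_mod_eq_0[symmetric] cong_dvd_iff[OF eval_cong] .

  define e where "e = char_idempotent p \<zeta> \<chi>"
  have p1_unit: "padic_of_int p (int p - 1) \<in> Units Zp"
  proof -
    have "\<not> int p dvd int p - 1" using zdvd_imp_le[of "int p" "int p - 1"] gt2 by auto
    then show ?thesis unfolding Units_iff using of_int_closed gt2 by (simp add: nth_of_int dvd_mod_iff)
  qed
  have e_aut: "e (aut k) = inv\<^bsub>Zp\<^esub> (padic_of_int p (int p - 1)) \<otimes>\<^bsub>Zp\<^esub> inv\<^bsub>Zp\<^esub> (\<chi> (aut k))" if "k \<in> {1..<p}" for k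
    using gal[OF that] by (simp add: e_def char_idempotent_def)
  have e_nonneg: "e (aut k) 1 \<ge> 0" if "k \<in> {1..<p}" for k
  proof -
    have "e (aut k) \<in> carrier Zp" unfolding e_aut[OF that]
      by (intro Zp.m_closed Zp.Units_inv_closed p1_unit \<chi>_unit that)
    then show ?thesis unfolding carrier_iff by simp
  qed
  define n where "n k = nat (e (aut k) 1)" for k
  \<comment> \<open>The idempotent has coefficients \<open>k\<^bsup>-m\<^esup> / (p - 1)\<close>, and \<open>p - 1 \<equiv> -1\<close>.\<close>
  have n: "int p dvd int (n k) * int k ^ Suc r + 1" if k: "k \<in> {1..<p}" for k
  proof -
    define v where "v = (inv\<^bsub>Zp\<^esub> (\<chi> (aut k))) 1"
    define u where "u = (inv\<^bsub>Zp\<^esub> (padic_of_int p (int p - 1))) 1"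
    have \<chi>v: "[int k ^ m * v = 1] (mod int p)"
      using inv_1[OF \<chi>_unit[OF k]] cong_scalar_right[OF \<chi>_1[OF k], of v] unfolding v_def
      by (meson cong_sym cong_trans)
    have "[padic_of_int p (int p - 1) 1 = - 1] (mod int p)"
      by (simp add: nth_of_int Cong.cong_def mod_simps mod_eq_dvd_iff)
    from cong_scalar_right[OF this, of u] have "[- 1 * u = 1] (mod int p)"
      using inv_1[OF p1_unit] unfolding u_def by (meson cong_sym cong_trans)
    then have u: "[u = - 1] (mod int p)" using cong_minus_minus_iff[of "- u" 1 "int p"] by simp
    have "[e (aut k) 1 = u * v] (mod int p)" unfolding e_aut[OF k] u_def v_def by (rule nth_1_mult)
    then have "[e (aut k) 1 * int k ^ m = u * v * int k ^ m] (mod int p)" by (rule cong_scalar_right)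
    also have "u * v * int k ^ m = u * (int k ^ m * v)" by (simp only: mult_ac)
    also have "[\<dots> = - 1 * 1] (mod int p)" by (rule cong_mult[OF u \<chi>v])
    finally show ?thesis using e_nonneg[OF k] by (simp add: n_def mr cong_iff_dvd_diff)
  qed

  obtain I where I: "fractional I" "ipow I p = principal (lin 1)" using lin_1_is_pth_power .
  have trivial: "group_ring_power p \<zeta> x e = \<one>\<^bsub>CG\<^esub>" if "x \<in> p_class_group p \<zeta>" for x
    using triv that unfolding class_component_def e_def by blast
  have lin_1: "lin 1 \<noteq> 0" by (rule lin_nonzero) (use gt2 in simp)
  obtain g where g: "g \<in> K" "g \<noteq> 0"
    "principal (\<Prod>k\<in>{1..<p}. sig k (lin 1) ^ n k) = principal (g ^ p)"
    unfolding n_def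
    by (rule principal_of_trivial_component[where \<theta> = e, OF I O_K[OF lin_O] lin_1 e_nonneg trivial])
  have "(\<Prod>k\<in>{1..<p}. sig k (lin 1) ^ n k) = (\<Prod>k\<in>{1..<p}. lin k ^ n k)"
    by (intro prod.cong refl) (simp add: sig_lin not_dvd_range)
  with g(3) have "principal (\<Prod>k\<in>{1..<p}. lin k ^ n k) = principal (g ^ p)" by simp
  moreover have "(\<Prod>k\<in>{1..<p}. lin k ^ n k) \<in> K" by (intro K_prod K_power O_K lin_O)
  moreover have "(\<Prod>k\<in>{1..<p}. lin k ^ n k) \<noteq> 0" by (auto simp: lin_nonzero)
  ultimately obtain u where u: "u \<in> \<O>" "inverse u \<in> \<O>" "(\<Prod>k\<in>{1..<p}. lin k ^ n k) = u * g ^ p"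
    using principal_eq_imp_associated by blast
  obtain s t where "vanishes_mod p (p - 1) ((\<Prod>k\<in>{1..<p}. ([:a:] + monom b k) ^ n k)
      - monom s t * (\<Prod>k\<in>{1..<p}. ([:a:] + monom b (p - k)) ^ n k))"
    using congruence_of_pth_power[OF g(1) u] .
  then have "int p dvd (\<Sum>j<p. int j ^ r * z 1 ^ j)"
    using power_sum_dvd_of_congruence[OF prime gt2 pa pab za r n] by blast
  moreover have "(\<Sum>j<p. int j ^ r * z 1 ^ j) = (\<Sum>k\<in>{1..p - 1}. int k ^ r * z 1 ^ k)"
    using r(1) by (intro sum.mono_neutral_right) auto
  ultimately show False using nonzero by simp
qed

end
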